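(* Let $V,W,U$ be finite-dimensional real vector spaces, $\rho\ge 1$, let $\mathbf X$ be a $V$-valued $\rho$-branched rough path on $[0,T]$ controlled by $\omega$, let $F\in C^\infty(W,\mathcal L(\mathcal Q(V),W))$, $y_0\in W$, and let $Y\colon[0,T]\to W$ solve the rough differential equation $\mathrm dY_t=F(Y_t)\,\mathrm d\mathbf X_t$, $Y_0=y_0$ (in the sense given in the context). Let $\varphi\in C^{\lfloor\rho\rfloor+1}(W,U)$. Then for all $0\le s\le t\le T$ $$\varphi(Y_t)=\varphi(Y_s)+\int_s^t\mathbf F\varphi(Y_u)\,\mathrm d\mathbf X_u ,$$ where the right-hand side is the rough integral $$\int_s^t\mathbf F\varphi(Y_u)\,\mathrm d\mathbf X_u=\lim_{|\pi|\to0}\sum_{[u,v]\in\pi}\langle\mathbf F\varphi(Y_u),\mathbf X_{u,v}\rangle ,$$ the limit being over partitions $\pi$ of $[s,t]$ with vanishing mesh, and $\mathbf F\varphi(y)$ denoting the linear map $h\mapsto\mathbf F_h\varphi(y)$ on elements $h$ of $\mathcal H_{\mathrm{GL}}(V)$ of weight between $1$ and $\lfloor\rho\rfloor$, so that $\langle\mathbf F\varphi(y),\mathbf X_{u,v}\rangle$ is its value on the positive-weight part of $\mathbf X_{u,v}$.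
   Context: **Forests and Connes–Kreimer.** For a finite-dimensional real vector space $U$, $\mathcal H(U)$ is spanned by non-planar rooted forests (including the empty forest $\mathbf 1$) with vertices decorated by elements of $U$, modulo multilinearity in the decorations. $|f|$ (weight) is the number of vertices, $\mathcal H^{(n)}(U)$ the weight-$n$ part, $\mathcal H^n=\bigoplus_{k\le n}\mathcal H^{(k)}$, $\mathcal H_+$ the span of non-empty forests. $\mathcal H_{\mathrm{CK}}(U)$ is $\mathcal H(U)$ with the disjoint union product and $\Delta_{\mathrm{CK}}f=\sum_A f|_A\otimes f|_{A^c}$, over vertex subsets $A$ closed under passing to descendants (admissible cuts, upper part on the left). $\mathcal P(U)\subset\mathcal H_+(U)$ is the space of primitive elements. Natural growth $\top$ is the bilinear operation with $f\top\mathbf 1=f=\mathbf 1\top f$ and, for non-empty forests, $f\top g=\frac1{|g|}\sum_{v}(\text{graft all roots of }f\text{ onto }v)$, $v$ ranging over vertices of $g$; iterates are bracketed from the left. The map $p_1\otimes\cdots\otimes p_n\mapsto p_1\top\cdots\top p_n$ is a linear isomorphism $\bigotimes(\mathcal P(U))\to\mathcal H_{\mathrm{CK}}(U)$. **Grossman–Larson.** $\mathcal H_{\mathrm{GL}}(V)=(\mathcal H(V),\star,\Delta_{\mathrm{GL}})$, where $f\star g$ is the sum over all ways of, for each tree of $f$, either grafting its root onto a vertex of $g$ by a new edge or leaving it as a separate tree; $\Delta_{\mathrm{GL}}(t_1\cdots t_n)=\sum_{I\subset[n]}t_I\otimes t_{[n]\setminus I}$ for trees $t_i$. It is in graded duality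 with $\mathcal H_{\mathrm{CK}}(V^* )$ through $\langle f,g\rangle=\sum_b\prod_{v}\langle \text{label}_f(v),\text{label}_g(b(v))\rangle$, $b$ ranging over isomorphisms of the undecorated rooted forests $f\to g$ (so $0$ if the shapes differ). $\mathcal Q(V)=\{q\in\mathcal H_{\mathrm{GL}}(V):\langle\mathbf 1,q\rangle=0,\ \langle p_1\top\cdots\top p_n,q\rangle=0\ \forall n\ge2,\ p_i\in\mathcal P(V^* )\}$. $\mathcal H_{\mathrm{GL}}(V)$ is the free associative algebra over $\mathcal Q(V)$ (with product $\star$). Reduced iterated $\Delta_{\mathrm{GL}}$-coproducts of $h\in\mathcal H_+$ are written $h^{(1)}\otimes\cdots\otimes h^{(n)}$ (sum implied). **Branched rough paths.** A control is a continuous $\omega\colon\{0\le s\le t\le T\}\to[0,\infty)$, zero on the diagonal, with $\omega(s,u)+\omega(u,t)\le\omega(s,t)$. A $V$-valued $\rho$-branched rough path controlled by $\omega$ is a map $(s,t)\mapsto\mathbf X_{s,t}\in\mathcal H_{\mathrm{GL}}^{\lfloor\rho\rfloor}(V)$ with (products truncated at weight $\lfloor\rho\rfloor$) $\mathbf X_{s,t}=\mathbf X_{s,u}\star\mathbf X_{u,t}$; $\langle fg,\mathbf X_{s,t}\rangle=\langle f,\mathbf X_{s,t}\rangle\langle g,\mathbf X_{s,t}\rangle$ for $|f|+|g|\le\lfloor\rho\rfloor$ and $\langle\mathbf 1,\mathbf X_{s,t}\rangle=1$; $\sup_{s<t}|\langle f,\mathbf X_{s,t}\rangle|/\omega(s,t)^{|f|/\rho}<\infty$.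 Write $a_{s,t}\approx_m b_{s,t}$ if $a_{s,t}-b_{s,t}=O(\omega(s,t)^{m/\rho})$ uniformly. **Controlled paths.** $\mathscr D^m_{\mathbf X}(E)$ ($m\le\lfloor\rho\rfloor+1$) is the set of maps $\mathbf H\colon[0,T]\to\mathcal L(\mathcal H_{\mathrm{GL}}^{m-1}(V),E)$ with $|\mathbf H_t-\mathbf H_s|=O(\omega(s,t)^{1/\rho})$ and $\langle\mathbf H_t,h\rangle\approx_{m-n}\langle\mathbf H_s,\mathbf X_{s,t}\star h\rangle$ for $h\in\mathcal H_{\mathrm{GL}}^{(n)}(V)$, $0\le n\le m-1$ (truncated). Its trace is $H=\langle\mathbf H,\mathbf 1\rangle$. For a $C^m$ function $\psi$, $\psi(\mathbf H)$ is the controlled path with trace $\psi(H)$ and $\langle\psi(\mathbf H),h\rangle=\sum_{n\ge1}\frac1{n!}\mathrm D^n\psi(H)(\langle\mathbf H,h^{(1)}\rangle,\ldots,\langle\mathbf H,h^{(n)}\rangle)$ for $h\in\mathcal H_+$. **Integration and RDEs.** Only the part of $\mathcal Q(V)$ of weight $\le\lfloor\rho\rfloor$ is relevant. For $\mathbf H\in\mathscr D^{\lfloor\rho\rfloor}_{\mathbf X}(\mathcal L(\mathcal Q(V),W))$, view $\mathbf H_u$ as a linear map on $(\mathcal H_{\mathrm{GL}})_+$ by $h\star q\mapsto\langle\mathbf H_{q;u},h\rangle$ ($h\in\mathcal H_{\mathrm{GL}}$, $q\in\mathcal Q$); $\int_s^t\mathbf H\,\mathrm d\mathbf X=\lim\sum_{[u,v]}\langle\mathbf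 H_u,\mathbf X_{u,v}\rangle$ (pairing truncated at weight $\lfloor\rho\rfloor$), made into a controlled path by $\langle\int\mathbf H\,\mathrm d\mathbf X,h\star q\rangle:=\langle\mathbf H_q,h\rangle$. $Y$ solves $\mathrm dY=F(Y)\,\mathrm d\mathbf X$, $Y_0=y_0$, if there is $\mathbf Y\in\mathscr D^{\lfloor\rho\rfloor}_{\mathbf X}(W)$ with trace $Y$ and $\mathbf Y_t=y_0+\int_0^tF(\mathbf Y)\,\mathrm d\mathbf X$ as controlled paths. **The maps $\widehat F$ and $\mathbf F$.** Write $F_q\in C^\infty(W,W)$ for $q\in\mathcal Q(V)$. $\widehat F\colon(\mathcal H_{\mathrm{GL}})_+(V)\to C^\infty(W,W)$ is the linear map determined by $\widehat F_q=F_q$ for $q\in\mathcal Q(V)$ and $\widehat F_{h\star q}(y)=\sum_{n\ge1}\frac1{n!}\mathrm D^nF_q(y)(\widehat F_{h^{(1)}}(y),\ldots,\widehat F_{h^{(n)}}(y))$ for $h\in(\mathcal H_{\mathrm{GL}})_+$, $q\in\mathcal Q$. Then $\mathbf F_h\varphi(y)=\sum_{n\ge1}\frac1{n!}\mathrm D^n\varphi(y)(\widehat F_{h^{(1)}}(y),\ldots,\widehat F_{h^{(n)}}(y))$ for $h\in(\mathcal H_{\mathrm{GL}})_+$. As an $\mathcal L(\mathcal Q(V),U)$-valued integrand, $\mathbf F\varphi(Y)$ has components $h\star q\mapsto\mathbf F_{h\star q}\varphi(Y)$. *)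

theory Defs
  imports
    "HOL-Analysis.Analysis"
    "HOL-Analysis.Finite_Function_Topology"
    "HOL-Combinatorics.Permutations"
begin

section \<open>Rooted forests and formal linear combinations\<close>

datatype 'a tree = Node (root_label: 'a) (branches: "'a tree multiset")

type_synonym 'a forest = "'a tree multiset"

primrec tree_weight :: "'a tree \<Rightarrow> nat" where
  "tree_weight (Node a C) = Suc (\<Sum>\<^sub># (image_mset tree_weight C))"

definition weight :: "'a forest \<Rightarrow> nat" where
  "weight f = (\<Sum>t\<in>#f. tree_weight t)"

text \<open>
  Forests form a commutative monoid under disjoint union, so the convolution product of
  \<^theory>\<open>HOL-Library.Poly_Mapping\<close> is the bilinear extension of disjoint union and its unit is
  the empty forest.  Pairs of forests form a basis of the tensor square; the ring structure on
  \<open>forests2\<close> is the product of the tensor square.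
\<close>

type_synonym 'a forests = "'a forest \<Rightarrow>\<^sub>0 real"
type_synonym 'a forests2 = "('a forest \<times> 'a forest) \<Rightarrow>\<^sub>0 real"

abbreviation basis_vec :: "'k \<Rightarrow> 'k \<Rightarrow>\<^sub>0 real" where
  "basis_vec k \<equiv> Poly_Mapping.single k 1"

definition lin :: "('k \<Rightarrow> 'e::real_vector) \<Rightarrow> ('k \<Rightarrow>\<^sub>0 real) \<Rightarrow> 'e" where
  "lin \<phi> x = (\<Sum>k\<in>Poly_Mapping.keys x. Poly_Mapping.lookup x k *\<^sub>R \<phi> k)"

definition tensor :: "'a forests \<Rightarrow> 'a forests \<Rightarrow> 'a forests2" where
  "tensor x y = lin (\<lambda>f. lin (\<lambda>g. basis_vec (f, g)) y) x"

definition graded :: "nat \<Rightarrow> 'a forests set" where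
  "graded n = {x. \<forall>f\<in>Poly_Mapping.keys x. weight f = n}"

definition filtered :: "nat \<Rightarrow> 'a forests set" where
  "filtered n = {x. \<forall>f\<in>Poly_Mapping.keys x. weight f \<le> n}"

definition nonempty_span :: "'a forests set" where
  "nonempty_span = {x. Poly_Mapping.lookup x {#} = 0}"

definition truncate :: "nat \<Rightarrow> 'a forests \<Rightarrow> 'a forests" where
  "truncate n = lin (\<lambda>f. if weight f \<le> n then basis_vec f else 0)"

definition positive_part :: "'a forests \<Rightarrow> 'a forests" where
  "positive_part = lin (\<lambda>f. if f = {#} then 0 else basis_vec f)"

definition add_root :: "'a \<Rightarrow> 'a forests \<Rightarrow> 'a forests" where
  "add_root a = lin (\<lambda>f. basis_vec {#Node a f#})"

definition linear_on :: "'e::real_vector set \<Rightarrow> ('e \<Rightarrow> 'f::real_vector) \<Rightarrow> bool" where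
  "linear_on S L \<longleftrightarrow>
     (\<forall>x\<in>S. \<forall>y\<in>S. L (x + y) = L x + L y) \<and> (\<forall>c. \<forall>x\<in>S. L (c *\<^sub>R x) = c *\<^sub>R L x)"

lemma lin_basis_vec [simp]: "lin \<phi> (basis_vec k) = \<phi> k"
  by (simp add: lin_def)

lemma lin_alt:
  assumes "finite S" "Poly_Mapping.keys x \<subseteq> S"
  shows "lin \<phi> x = (\<Sum>k\<in>S. Poly_Mapping.lookup x k *\<^sub>R \<phi> k)"
  unfolding lin_def using assms by (intro sum.mono_neutral_left) (auto simp: in_keys_iff)

lemma lookup_scaleR [simp]:
  "Poly_Mapping.lookup (c *\<^sub>R x) k = c *\<^sub>R Poly_Mapping.lookup x k"
proof -
  have "finite {k. c *\<^sub>R Poly_Mapping.lookup x k \<noteq> 0}"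
    by (rule finite_subset[of _ "Poly_Mapping.keys x"]) (auto simp: in_keys_iff)
  then show ?thesis
    by (simp add: scaleR_poly_mapping_def Abs_poly_mapping_inverse)
qed

lemma linear_lin: "linear (lin \<phi>)"
proof (rule linearI)
  fix x y :: "'a \<Rightarrow>\<^sub>0 real" and c :: real
  let ?S = "Poly_Mapping.keys x \<union> Poly_Mapping.keys y"
  have S: "finite ?S" "Poly_Mapping.keys (x + y) \<subseteq> ?S"
    using Poly_Mapping.keys_add[of x y] by auto
  show "lin \<phi> (x + y) = lin \<phi> x + lin \<phi> y"
    using S by (simp add: lin_alt[of ?S] lookup_add scaleR_left_distrib sum.distrib)
  have "Poly_Mapping.keys (c *\<^sub>R x) \<subseteq> Poly_Mapping.keys x"
    by (auto simp: in_keys_iff)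
  then show "lin \<phi> (c *\<^sub>R x) = c *\<^sub>R lin \<phi> x"
    by (simp add: lin_alt[of "Poly_Mapping.keys x"] scaleR_sum_right)
qed

lemma scaleR_conv_times: "c *\<^sub>R x = Poly_Mapping.single 0 c * (x :: 'k::monoid_add \<Rightarrow>\<^sub>0 real)"
  by (rule poly_mapping_eqI)
     (simp add: mult_map_scale_conv_mult[symmetric] Poly_Mapping.map.rep_eq when_def)

lemma forests_scaleR_left:
  "(c *\<^sub>R x) * y = c *\<^sub>R (x * (y :: 'k::monoid_add \<Rightarrow>\<^sub>0 real))"
  by (simp add: scaleR_conv_times mult.assoc)

lemma forests_scaleR_right:
  "x * (c *\<^sub>R y) = c *\<^sub>R (x * (y :: 'k::comm_monoid_add \<Rightarrow>\<^sub>0 real))"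
  by (simp add: scaleR_conv_times mult.left_commute)

lemma linear_times_left: "linear (\<lambda>x. x * (y :: 'k::monoid_add \<Rightarrow>\<^sub>0 real))"
  by (rule linearI) (simp_all add: distrib_right forests_scaleR_left)

lemma linear_times_right: "linear (\<lambda>x. y * (x :: 'k::comm_monoid_add \<Rightarrow>\<^sub>0 real))"
  by (rule linearI) (simp_all add: distrib_left forests_scaleR_right)

lemma poly_mapping_decomp: "x = lin basis_vec (x :: 'k \<Rightarrow>\<^sub>0 real)"
proof (rule poly_mapping_eqI)
  fix k
  have "(\<Sum>l\<in>Poly_Mapping.keys x. Poly_Mapping.lookup x l * Poly_Mapping.lookup (basis_vec l) k)
     = (\<Sum>l\<in>Poly_Mapping.keys x. if l = k then Poly_Mapping.lookup x l else 0)"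
    by (intro sum.cong refl) (simp add: lookup_single when_def)
  also have "\<dots> = Poly_Mapping.lookup x k"
    by (simp add: in_keys_iff)
  finally show "Poly_Mapping.lookup x k = Poly_Mapping.lookup (lin basis_vec x) k"
    by (simp add: lin_def lookup_sum)
qed

lemma linear_ext_basis_vec:
  assumes "linear L" "linear L'" "\<And>k. L (basis_vec k) = L' (basis_vec k)"
  shows "L = (L' :: ('k \<Rightarrow>\<^sub>0 real) \<Rightarrow> 'e::real_vector)"
proof
  fix x
  have *: "M x = lin (\<lambda>k. M (basis_vec k)) x" if "linear M" for M :: "('k \<Rightarrow>\<^sub>0 real) \<Rightarrow> 'e"
    using that
    by (subst poly_mapping_decomp) (simp add: lin_def linear_sum linear_cmul)
  show "L x = L' x"
    by (simp add: *[OF assms(1)] *[OF assms(2)] assms(3))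
qed


section \<open>Decorations in a vector space\<close>

text \<open>
  The space of forests decorated by elements of \<open>V\<close>, modulo multilinearity, is realised as the
  span of the forests decorated by a basis of \<open>V\<close>.  The map \<open>decorate\<close> below sends a
  \<open>V\<close>-decorated forest to its class; it is multilinear in the decorations and universal with
  this property (\<open>decorate_multilinear\<close>, \<open>decorate_universal\<close>).  The same type represents the
  space of forests decorated by the dual of \<open>V\<close>, a label then standing for an element of the
  dual basis.
\<close>

typedef (overloaded) 'v basis = "Basis :: 'v::euclidean_space set"
  using nonempty_Basis by blast

instance basis :: (euclidean_space) finite
proof
  have "(UNIV :: 'a basis set) = Abs_basis ` Basis"
    using Rep_basis Rep_basis_inverse by (metis UNIV_eq_I image_eqI)
  then show "finite (UNIV :: 'a basis set)"
    by (metis finite_Basis finite_imageI)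
qed

type_synonym 'v hopf = "'v basis forests"

primrec decorate_tree :: "'v::euclidean_space tree \<Rightarrow> 'v hopf" where
  "decorate_tree (Node v C) =
     (\<Sum>i\<in>UNIV. (v \<bullet> Rep_basis i) *\<^sub>R add_root i (\<Prod>\<^sub># (image_mset decorate_tree C)))"

definition decorate :: "'v::euclidean_space forest \<Rightarrow> 'v hopf" where
  "decorate f = (\<Prod>t\<in>#f. decorate_tree t)"

text \<open>A slot is a tree as a function of the decoration of one of its vertices.\<close>

inductive_set slots :: "('v \<Rightarrow> 'v tree) set" where
  slot_root: "(\<lambda>v. Node v C) \<in> slots"
| slot_branch: "c \<in> slots \<Longrightarrow> (\<lambda>v. Node a (add_mset (c v) C)) \<in> slots"

definition multilinear_decoration :: "('v::real_vector forest \<Rightarrow> 'e::real_vector) \<Rightarrow> bool" where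
  "multilinear_decoration G \<longleftrightarrow> (\<forall>c\<in>slots. \<forall>C. linear (\<lambda>v. G (add_mset (c v) C)))"

lemma decorate_tree_slot: "c \<in> slots \<Longrightarrow> linear (\<lambda>v. decorate_tree (c v))"
proof (induction rule: slots.induct)
  case (slot_root C)
  show ?case
    by (rule linearI)
       (simp_all add: inner_add_left scaleR_left_distrib sum.distrib scaleR_sum_right)
next
  case (slot_branch c a C)
  have 1: "linear (\<lambda>v. add_root i (decorate_tree (c v) * P))" for i P
    using linear_compose[OF linear_compose[OF slot_branch.IH linear_times_left]
        linear_lin[of "\<lambda>f. basis_vec {#Node i f#}"]]
    by (simp add: o_def add_root_def)
  show ?case
    by (simp, intro linear_compose_sum ballI linear_compose_scale_right 1)
qed

lemma decorate_multilinear: "multilinear_decoration decorate"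
  unfolding multilinear_decoration_def
proof (intro ballI allI)
  fix c :: "'a \<Rightarrow> 'a tree" and C
  assume "c \<in> slots"
  from linear_compose[OF decorate_tree_slot[OF this] linear_times_left[of "decorate C"]]
  show "linear (\<lambda>v. decorate (add_mset (c v) C))"
    by (simp add: decorate_def o_def)
qed

lemma prod_mset_basis_vec: "(\<Prod>t\<in>#f. basis_vec (g t)) = basis_vec (\<Sum>t\<in>#f. g t)"
  by (induction f) (simp_all add: mult_single)

lemma decorate_basis_tree:
  "decorate_tree (map_tree Rep_basis t) = basis_vec {#t#}"
proof (induction t)
  case (Node i C)
  have 1: "(\<Prod>t\<in>#C. decorate_tree (map_tree Rep_basis t)) = basis_vec C"
  proof -
    have "image_mset (\<lambda>t. decorate_tree (map_tree Rep_basis t)) C = image_mset (\<lambda>t. basis_vec {#t#}) C"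
      using Node by (intro image_mset_cong) auto
    then show ?thesis
      by (simp add: prod_mset_basis_vec)
  qed
  have 2: "Rep_basis i \<bullet> Rep_basis j = (if i = j then 1 else 0)" for j
    using Rep_basis[of i] Rep_basis[of j] Rep_basis_inject[of i j] by (simp add: inner_Basis)
  have "decorate_tree (map_tree Rep_basis (Node i C))
      = (\<Sum>j\<in>UNIV. (if i = j then 1 else 0) *\<^sub>R basis_vec {#Node j C#})"
    by (simp add: 1 2 add_root_def multiset.map_comp o_def)
  also have "\<dots> = (\<Sum>j\<in>UNIV. if i = j then basis_vec {#Node j C#} else 0)"
    by (intro sum.cong) auto
  finally show ?case
    by simp
qed

lemma decorate_basis: "decorate (image_mset (map_tree Rep_basis) f) = basis_vec f"
  by (simp add: decorate_def multiset.map_comp o_def decorate_basis_tree prod_mset_basis_vec)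

lemma multilinear_vanish:
  fixes G :: "'v::euclidean_space forest \<Rightarrow> 'e::real_vector"
  assumes "multilinear_decoration G" "\<And>f. G (image_mset (map_tree Rep_basis) f) = 0"
  shows "G f = 0"
proof -
  define T where "T t \<longleftrightarrow> (\<forall>K :: 'v tree \<Rightarrow> 'e. (\<forall>c\<in>slots. linear (\<lambda>v. K (c v))) \<longrightarrow>
     (\<forall>b. K (map_tree Rep_basis b) = 0) \<longrightarrow> K t = 0)" for t
  have forest: "G C = 0" if "\<And>t. t \<in># C \<Longrightarrow> T t" "multilinear_decoration G"
    "\<And>f. G (image_mset (map_tree Rep_basis) f) = 0" for C and G :: "'v forest \<Rightarrow> 'e"
    using that
  proof (induction C arbitrary: G)
    case empty
    from empty(3)[of "{#}"] show ?case by simp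
  next
    case (add t C)
    have "G (add_mset (map_tree Rep_basis b) C) = 0" for b
    proof (rule add.IH)
      show "multilinear_decoration (\<lambda>C. G (add_mset (map_tree Rep_basis b) C))"
        using add.prems(2) unfolding multilinear_decoration_def by (simp add: add_mset_commute)
      show "G (add_mset (map_tree Rep_basis b) (image_mset (map_tree Rep_basis) f)) = 0" for f
        using add.prems(3)[of "add_mset b f"] by simp
    qed (use add.prems(1) in auto)
    moreover have "T t"
      using add.prems(1) by simp
    moreover have "\<forall>c\<in>slots. linear (\<lambda>v. G (add_mset (c v) C))"
      using add.prems(2) unfolding multilinear_decoration_def by auto
    ultimately show ?case
      unfolding T_def by (elim allE[of _ "\<lambda>t. G (add_mset t C)"]) blast
  qed
  have "T t" for t
  proof (induction t)
    case (Node v C)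
    show ?case
      unfolding T_def
    proof (intro allI impI)
      fix K :: "'v tree \<Rightarrow> 'e"
      assume lin: "\<forall>c\<in>slots. linear (\<lambda>v. K (c v))" and van: "\<forall>b. K (map_tree Rep_basis b) = 0"
      have bas: "K (Node e C) = 0" if "e \<in> Basis" for e
      proof (rule forest[where G = "\<lambda>C. K (Node e C)"])
        show "multilinear_decoration (\<lambda>C. K (Node e C))"
          unfolding multilinear_decoration_def
          using bspec[OF lin slot_branch] by blast
        from that obtain i where i: "e = Rep_basis i"
          by (metis Abs_basis_inverse)
        show "K (Node e (image_mset (map_tree Rep_basis) f)) = 0" for f
          using van[rule_format, of "Node i f"] by (simp add: i)
      qed (use Node in auto)
      have L: "linear (\<lambda>v. K (Node v C))"
        using bspec[OF lin slot_root[of C]] .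
      have "K (Node v C) = K (Node (\<Sum>e\<in>Basis. (v \<bullet> e) *\<^sub>R e) C)"
        by (simp add: euclidean_representation)
      also have "\<dots> = (\<Sum>e\<in>Basis. (v \<bullet> e) *\<^sub>R K (Node e C))"
        by (simp add: linear_sum[OF L] linear_cmul[OF L])
      also have "\<dots> = 0"
        by (simp add: bas)
      finally show "K (Node v C) = 0" .
    qed
  qed
  then show ?thesis
    by (rule forest[OF _ assms(1)]) (rule assms(2))
qed

lemma decorate_universal:
  fixes G :: "'v::euclidean_space forest \<Rightarrow> 'e::real_vector"
  assumes G: "multilinear_decoration G"
  shows "\<exists>!L. linear L \<and> (\<forall>f. L (decorate f) = G f)"
proof (rule ex1I)
  define L where "L = lin (\<lambda>f. G (image_mset (map_tree Rep_basis) f))"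
  have L: "linear L"
    unfolding L_def by (rule linear_lin)
  have "multilinear_decoration (\<lambda>f. L (decorate f) - G f)"
    unfolding multilinear_decoration_def
  proof (intro ballI allI linear_compose_sub)
    fix c :: "'v \<Rightarrow> 'v tree" and C
    assume c: "c \<in> slots"
    have "linear (\<lambda>v. decorate (add_mset (c v) C))"
      using decorate_multilinear c unfolding multilinear_decoration_def by blast
    from linear_compose[OF this L] show "linear (\<lambda>v. L (decorate (add_mset (c v) C)))"
      by (simp add: o_def)
    show "linear (\<lambda>v. G (add_mset (c v) C))"
      using G c unfolding multilinear_decoration_def by blast
  qed
  then have "L (decorate f) - G f = 0" for f
    by (rule multilinear_vanish) (simp add: decorate_basis L_def)
  with L show "linear L \<and> (\<forall>f. L (decorate f) = G f)"
    by simp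
  fix L' assume L': "linear L' \<and> (\<forall>f. L' (decorate f) = G f)"
  show "L' = L"
  proof (rule linear_ext_basis_vec)
    show "L' (basis_vec f) = L (basis_vec f)" for f
    proof -
      have "L' (decorate (image_mset (map_tree Rep_basis) f)) = G (image_mset (map_tree Rep_basis) f)"
        using L' by blast
      then show ?thesis
        by (simp add: decorate_basis L_def)
    qed
    show "linear L'" using L' by blast
    show "linear L" by (rule L)
  qed
qed


section \<open>The Hopf algebras of Connes--Kreimer and Grossman--Larson\<close>

text \<open>
  The admissible cuts of a tree are: the whole tree as upper part, or the root kept in the lower
  part together with an admissible cut of the forest of its branches.  Cuts of a forest are
  independent choices of cuts of its trees.  The upper part is the left tensor factor.
\<close>

primrec cuts_tree :: "'a tree \<Rightarrow> 'a forests2" where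
  "cuts_tree (Node a C) = basis_vec ({#Node a C#}, {#}) +
     lin (\<lambda>(f, g). basis_vec (f, {#Node a g#})) (\<Prod>\<^sub># (image_mset cuts_tree C))"

definition coproduct_CK :: "'a forests \<Rightarrow> 'a forests2" where
  "coproduct_CK = lin (\<lambda>f. \<Prod>t\<in>#f. cuts_tree t)"

definition primitives :: "'a forests set" where
  "primitives = {p \<in> nonempty_span. coproduct_CK p = tensor p 1 + tensor 1 p}"

text \<open>The sum over the vertices \<open>v\<close> of all forests obtained by grafting all roots of \<open>f\<close> onto \<open>v\<close>.\<close>

primrec graft_all_tree :: "'a forest \<Rightarrow> 'a tree \<Rightarrow> 'a forests" where
  "graft_all_tree f (Node a C) = basis_vec {#Node a (f + C)#} +
     add_root a (\<Sum>t\<in>#C. graft_all_tree f t * basis_vec (C - {#t#}))"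

definition graft_all :: "'a forest \<Rightarrow> 'a forest \<Rightarrow> 'a forests" where
  "graft_all f g = (\<Sum>t\<in>#g. graft_all_tree f t * basis_vec (g - {#t#}))"

definition natural_growth :: "'a forests \<Rightarrow> 'a forests \<Rightarrow> 'a forests" where
  "natural_growth x y = lin (\<lambda>f. lin (\<lambda>g.
     if f = {#} then basis_vec g else if g = {#} then basis_vec f
     else (1 / real (weight g)) *\<^sub>R graft_all f g) y) x"

text \<open>
  \<open>unshuffle f\<close> is the sum of the pairs \<open>(f\<^sub>I, f\<^sub>J)\<close> over the ways of splitting the trees of \<open>f\<close>
  into two parts, equal trees being distinguished; it is the Grossman--Larson coproduct of \<open>f\<close>.
\<close>

definition unshuffle :: "'a forest \<Rightarrow> 'a forests2" where
  "unshuffle f = (\<Prod>t\<in>#f. basis_vec ({#t#}, {#}) + basis_vec ({#}, {#t#}))"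

definition coproduct_GL :: "'a forests \<Rightarrow> 'a forests2" where
  "coproduct_GL = lin unshuffle"

text \<open>
  To graft the trees of \<open>f\<close> onto several trees, distribute them among these: the convolution
  \<open>conv \<phi> \<psi> f\<close> sums \<open>\<phi> f\<^sub>I * \<psi> f\<^sub>J\<close> over all splittings of \<open>f\<close>, and \<open>conv_prod\<close> is the iterated
  convolution of a multiset of maps.
\<close>

definition conv :: "('a forest \<Rightarrow> 'a forests) \<Rightarrow> ('a forest \<Rightarrow> 'a forests) \<Rightarrow> 'a forest \<Rightarrow> 'a forests" where
  "conv \<phi> \<psi> f = lin (\<lambda>(g, h). \<phi> g * \<psi> h) (unshuffle f)"

definition conv_prod :: "('a forest \<Rightarrow> 'a forests) multiset \<Rightarrow> 'a forest \<Rightarrow> 'a forests" where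
  "conv_prod = fold_mset conv (\<lambda>f. if f = {#} then 1 else 0)"

text \<open>
  \<open>graft_tree t f\<close> sums over all ways of grafting each tree of \<open>f\<close> onto some vertex of \<open>t\<close>: the
  trees not distributed among the branches of \<open>t\<close> are attached to its root.  In \<open>gl_forest f g\<close>
  the trees not distributed among the trees of \<open>g\<close> are left as separate trees.
\<close>

primrec graft_tree :: "'a tree \<Rightarrow> 'a forest \<Rightarrow> 'a forests" where
  "graft_tree (Node a C) =
     (\<lambda>f. add_root a (conv basis_vec (conv_prod (image_mset graft_tree C)) f))"

definition gl_forest :: "'a forest \<Rightarrow> 'a forest \<Rightarrow> 'a forests" where
  "gl_forest f g = conv basis_vec (conv_prod (image_mset graft_tree g)) f"

definition gl_product :: "'a forests \<Rightarrow> 'a forests \<Rightarrow> 'a forests" (infixl "\<star>" 70) where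
  "x \<star> y = lin (\<lambda>f. lin (\<lambda>g. gl_forest f g) y) x"

lemma lin_times_basis_vec:
  "lin \<phi> (basis_vec k * x) = lin (\<lambda>l. \<phi> (k + l)) (x :: 'k::comm_monoid_add \<Rightarrow>\<^sub>0 real)"
proof -
  have "(\<lambda>x. lin \<phi> (basis_vec k * x)) = lin (\<lambda>l. \<phi> (k + l))"
    using linear_compose[OF linear_times_right[of "basis_vec k"] linear_lin[of \<phi>]]
    by (intro linear_ext_basis_vec linear_lin) (simp_all add: o_def mult_single)
  then show ?thesis
    by metis
qed

lemma conv_empty: "conv \<phi> \<psi> {#} = \<phi> {#} * \<psi> {#}"
  by (simp add: conv_def unshuffle_def single_one[symmetric] zero_prod_def del: single_one)

lemma conv_add_mset:
  "conv \<phi> \<psi> (add_mset t f) = conv (\<lambda>g. \<phi> (add_mset t g)) \<psi> f + conv \<phi> (\<lambda>h. \<psi> (add_mset t h)) f"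
  by (simp add: conv_def unshuffle_def distrib_right linear_add[OF linear_lin]
      lin_times_basis_vec case_prod_unfold)

lemma conv_add_left: "conv (\<lambda>g. \<phi> g + \<phi>' g) \<psi> f = conv \<phi> \<psi> f + conv \<phi>' \<psi> f"
  by (induction f arbitrary: \<phi> \<phi>' \<psi>)
     (simp_all add: conv_empty conv_add_mset distrib_right)

lemma conv_commute: "conv \<phi> \<psi> f = conv \<psi> \<phi> f"
  by (induction f arbitrary: \<phi> \<psi>) (simp_all add: conv_empty conv_add_mset add.commute)

lemma conv_assoc: "conv (conv \<phi> \<psi>) \<theta> f = conv \<phi> (conv \<psi> \<theta>) f"
proof (induction f arbitrary: \<phi> \<psi> \<theta>)
  case empty
  then show ?case by (simp add: conv_empty mult.assoc)
next
  case (add t f)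
  have "conv \<phi> (\<lambda>g. \<psi>1 g + \<psi>2 g) f = conv \<phi> \<psi>1 f + conv \<phi> \<psi>2 f" for \<phi> \<psi>1 \<psi>2 :: "'a forest \<Rightarrow> 'a forests"
    by (simp add: conv_commute[of \<phi>] conv_add_left)
  with add show ?case
    by (simp add: conv_add_mset conv_add_left add.assoc)
qed

lemma comp_fun_commute_conv: "comp_fun_commute conv"
proof
  have "conv \<phi> (conv \<psi> \<theta>) f = conv \<psi> (conv \<phi> \<theta>) f" for \<phi> \<psi> \<theta> :: "'a forest \<Rightarrow> 'a forests" and f
    by (metis conv_assoc conv_commute ext)
  then show "conv \<psi> \<circ> conv \<phi> = conv \<phi> \<circ> conv \<psi>" for \<phi> \<psi> :: "'a forest \<Rightarrow> 'a forests"
    by (auto simp: fun_eq_iff)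
qed

lemma conv_prod_empty: "conv_prod {#} f = (if f = {#} then 1 else 0)"
  by (simp add: conv_prod_def)

lemma conv_prod_add_mset: "conv_prod (add_mset \<phi> \<Phi>) = conv \<phi> (conv_prod \<Phi>)"
  unfolding conv_prod_def using comp_fun_commute_conv
  by (rule comp_fun_commute.fold_mset_add_mset)

lemma graft_tree_Node: "graft_tree (Node a C) f = add_root a (gl_forest f C)"
  by (simp add: gl_forest_def)

text \<open>
  \<open>matchings \<Phi> g\<close> sums over the bijections from \<open>\<Phi>\<close> to \<open>g\<close> the products of the values of the
  functions at the trees assigned to them; it does not depend on the chosen enumerations
  (\<open>matchings_mset\<close>).  Hence \<open>forest_pairing k f g\<close> is the sum over all isomorphisms \<open>b\<close> from \<open>f\<close>
  to \<open>g\<close>, decorations disregarded, of the products of \<open>k (label v) (label (b v))\<close> over the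
  vertices \<open>v\<close> of \<open>f\<close>.
\<close>

definition matchings :: "('b \<Rightarrow> real) multiset \<Rightarrow> 'b multiset \<Rightarrow> real" where
  "matchings \<Phi> g =
     (if size \<Phi> \<noteq> size g then 0
      else let fs = (SOME l. mset l = \<Phi>); xs = (SOME l. mset l = g)
           in \<Sum>\<pi> | \<pi> permutes {..<size g}. \<Prod>i<size g. (fs ! i) (xs ! \<pi> i))"

primrec tree_pairing :: "('a \<Rightarrow> 'b \<Rightarrow> real) \<Rightarrow> 'a tree \<Rightarrow> 'b tree \<Rightarrow> real" where
  "tree_pairing k (Node a C) =
     (\<lambda>s. k a (root_label s) * matchings (image_mset (tree_pairing k) C) (branches s))"

definition forest_pairing :: "('a \<Rightarrow> 'b \<Rightarrow> real) \<Rightarrow> 'a forest \<Rightarrow> 'b forest \<Rightarrow> real" where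
  "forest_pairing k f g = matchings (image_mset (tree_pairing k) f) g"

text \<open>The first argument is a combination of forests decorated by the dual basis.\<close>

definition pairing :: "'a forests \<Rightarrow> 'a forests \<Rightarrow> real" where
  "pairing x y = lin (\<lambda>f. lin (\<lambda>g. forest_pairing (\<lambda>i j. of_bool (i = j)) f g) y) x"

lemma matchings_mset:
  assumes "length fs = length xs"
  shows "matchings (mset fs) (mset xs) =
    (\<Sum>\<pi> | \<pi> permutes {..<length xs}. \<Prod>i<length xs. (fs ! i) (xs ! \<pi> i))"
proof -
  define fs' xs' where "fs' = (SOME l. mset l = mset fs)" and "xs' = (SOME l. mset l = mset xs)"
  have "mset fs' = mset fs" "mset xs' = mset xs"
    unfolding fs'_def xs'_def by (rule someI[of _ fs] someI[of _ xs], rule refl)+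
  then obtain \<sigma> \<tau> where \<sigma>: "\<sigma> permutes {..<length fs}" "permute_list \<sigma> fs = fs'"
    and \<tau>: "\<tau> permutes {..<length xs}" "permute_list \<tau> xs = xs'"
    using mset_eq_permutation by metis
  let ?n = "length xs"
  let ?P = "{\<pi>. \<pi> permutes {..<?n}}"
  have \<sigma>n: "\<sigma> permutes {..<?n}"
    using \<sigma>(1) assms by simp
  have "matchings (mset fs) (mset xs) = (\<Sum>\<pi>\<in>?P. \<Prod>i<?n. (fs' ! i) (xs' ! \<pi> i))"
    using assms by (simp add: matchings_def fs'_def xs'_def)
  also have "\<dots> = (\<Sum>\<pi>\<in>?P. \<Prod>i<?n. (fs ! \<sigma> i) (xs ! \<tau> (\<pi> i)))"
  proof (intro sum.cong prod.cong refl)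
    fix \<pi> i assume "\<pi> \<in> ?P" "i \<in> {..<?n}"
    then have "i < ?n" "\<pi> i < ?n"
      using permutes_in_image[of \<pi> "{..<?n}" i] by auto
    then show "(fs' ! i) (xs' ! \<pi> i) = (fs ! \<sigma> i) (xs ! \<tau> (\<pi> i))"
      using \<sigma> \<tau> assms by (auto simp: permute_list_nth)
  qed
  also have "\<dots> = (\<Sum>\<pi>\<in>?P. \<Prod>i<?n. (fs ! \<sigma> i) (xs ! \<pi> i))"
    by (rule setum_permutations_compose_left[OF \<tau>(1),
        of "\<lambda>\<pi>. \<Prod>i<?n. (fs ! \<sigma> i) (xs ! \<pi> i)", unfolded o_def, symmetric])
  also have "\<dots> = (\<Sum>\<pi>\<in>?P. \<Prod>i<?n. (fs ! \<sigma> i) (xs ! \<pi> (\<sigma> i)))"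
    by (rule sum_permutations_compose_right[OF \<sigma>n,
        of "\<lambda>\<pi>. \<Prod>i<?n. (fs ! \<sigma> i) (xs ! \<pi> i)", unfolded o_def])
  also have "\<dots> = (\<Sum>\<pi>\<in>?P. \<Prod>i<?n. (fs ! i) (xs ! \<pi> i))"
  proof (intro sum.cong refl)
    fix \<pi>
    show "(\<Prod>i<?n. (fs ! \<sigma> i) (xs ! \<pi> (\<sigma> i))) = (\<Prod>i<?n. (fs ! i) (xs ! \<pi> i))"
      by (rule prod.permute[OF \<sigma>n, of "\<lambda>i. (fs ! i) (xs ! \<pi> i)", unfolded o_def, symmetric])
  qed
  finally show ?thesis .
qed

text \<open>The iterates \<open>p\<^sub>1 \<top> \<cdots> \<top> p\<^sub>n\<close> with \<open>n \<ge> 2\<close> are the folds over non-empty lists.\<close>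

definition gl_generators :: "'a forests set" where
  "gl_generators = {q. pairing 1 q = 0 \<and>
     (\<forall>p\<in>primitives. \<forall>ps. ps \<noteq> [] \<and> set ps \<subseteq> primitives \<longrightarrow>
        pairing (foldl natural_growth p ps) q = 0)}"


section \<open>Higher derivatives\<close>

fun C_k :: "nat \<Rightarrow> ('a::real_normed_vector \<Rightarrow> 'b::real_normed_vector) \<Rightarrow> bool" where
  "C_k 0 f \<longleftrightarrow> continuous_on UNIV f"
| "C_k (Suc k) f \<longleftrightarrow>
     (\<forall>x. f differentiable (at x)) \<and> (\<forall>v. C_k k (\<lambda>x. frechet_derivative f (at x) v))"

definition smooth :: "('a::real_normed_vector \<Rightarrow> 'b::real_normed_vector) \<Rightarrow> bool" where
  "smooth f \<longleftrightarrow> (\<forall>k. C_k k f)"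

text \<open>For \<open>f\<close> of class \<open>C\<^sup>n\<close>, \<open>derivs f [v\<^sub>1, \<dots>, v\<^sub>n] x\<close> is \<open>D\<^sup>nf(x)(v\<^sub>1, \<dots>, v\<^sub>n)\<close>.\<close>

primrec derivs :: "('a::real_normed_vector \<Rightarrow> 'b::real_normed_vector) \<Rightarrow> 'a list \<Rightarrow> 'a \<Rightarrow> 'b" where
  "derivs f [] = f"
| "derivs f (v # vs) = (\<lambda>x. frechet_derivative (derivs f vs) (at x) v)"

definition reduced_unshuffle :: "'a forest \<Rightarrow> 'a forests2" where
  "reduced_unshuffle f = unshuffle f - basis_vec (f, {#}) - basis_vec ({#}, f)"

text \<open>The \<open>n\<close>-fold reduced coproduct of a non-empty forest; tensors of length \<open>n\<close> are lists.\<close>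

fun reduced_coproduct :: "nat \<Rightarrow> 'a forest \<Rightarrow> 'a forest list \<Rightarrow>\<^sub>0 real" where
  "reduced_coproduct 0 f = 0"
| "reduced_coproduct (Suc 0) f = basis_vec [f]"
| "reduced_coproduct (Suc (Suc n)) f =
     lin (\<lambda>(g, h). lin (\<lambda>hs. basis_vec (g # hs)) (reduced_coproduct (Suc n) h)) (reduced_unshuffle f)"

text \<open>
  The sum over \<open>n \<ge> 1\<close> of \<open>1/n! D\<^sup>n\<psi>(y)(A h\<^sub>1, \<dots>, A h\<^sub>n)\<close>,
  where \<open>h\<^sub>1 \<otimes> \<cdots> \<otimes> h\<^sub>n\<close> is the reduced iterated coproduct of the argument.  The \<open>n\<close>-fold reduced
  coproduct of a forest vanishes if \<open>n\<close> exceeds its number of trees.  The result is \<open>0\<close> on the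
  empty forest, so only values of \<open>A\<close> on non-empty forests enter.
\<close>

definition faa_di_bruno ::
  "('e::real_normed_vector \<Rightarrow> 'f::real_normed_vector) \<Rightarrow> ('a forests \<Rightarrow> 'e) \<Rightarrow> 'e \<Rightarrow> 'a forests \<Rightarrow> 'f" where
  "faa_di_bruno \<psi> A y = lin (\<lambda>f. \<Sum>n=1..size f. (1 / fact n) *\<^sub>R
     lin (\<lambda>hs. derivs \<psi> (map (\<lambda>g. A (basis_vec g)) hs) y) (reduced_coproduct n f))"


section \<open>Branched rough paths, controlled paths and integration\<close>

definition control :: "real \<Rightarrow> (real \<Rightarrow> real \<Rightarrow> real) \<Rightarrow> bool" where
  "control T \<omega> \<longleftrightarrow>
     continuous_on {(s, t). 0 \<le> s \<and> s \<le> t \<and> t \<le> T} (\<lambda>(s, t). \<omega> s t) \<and>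
     (\<forall>s t. 0 \<le> s \<and> s \<le> t \<and> t \<le> T \<longrightarrow> 0 \<le> \<omega> s t) \<and>
     (\<forall>t. 0 \<le> t \<and> t \<le> T \<longrightarrow> \<omega> t t = 0) \<and>
     (\<forall>s u t. 0 \<le> s \<and> s \<le> u \<and> u \<le> t \<and> t \<le> T \<longrightarrow> \<omega> s u + \<omega> u t \<le> \<omega> s t)"

definition approx_order ::
  "real \<Rightarrow> real \<Rightarrow> (real \<Rightarrow> real \<Rightarrow> real) \<Rightarrow> nat \<Rightarrow>
   (real \<Rightarrow> real \<Rightarrow> 'e::real_normed_vector) \<Rightarrow> (real \<Rightarrow> real \<Rightarrow> 'e) \<Rightarrow> bool" where
  "approx_order \<rho> T \<omega> m a b \<longleftrightarrow>
     (\<exists>K. \<forall>s t. 0 \<le> s \<and> s \<le> t \<and> t \<le> T \<longrightarrow> norm (a s t - b s t) \<le> K * \<omega> s t powr (real m / \<rho>))"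

text \<open>
  The growth bound is void for the empty forest, on which \<open>X\<close> is \<open>1\<close>.  It is stated for
  homogeneous elements of weight at least \<open>1\<close> because \<open>0 powr 0 = 0\<close>.
\<close>

definition branched_rough_path ::
  "real \<Rightarrow> real \<Rightarrow> (real \<Rightarrow> real \<Rightarrow> real) \<Rightarrow> (real \<Rightarrow> real \<Rightarrow> 'v::euclidean_space hopf) \<Rightarrow> bool" where
  "branched_rough_path \<rho> T \<omega> X \<longleftrightarrow> (let N = nat \<lfloor>\<rho>\<rfloor> in
     (\<forall>s t. 0 \<le> s \<and> s \<le> t \<and> t \<le> T \<longrightarrow> X s t \<in> filtered N) \<and>
     (\<forall>s u t. 0 \<le> s \<and> s \<le> u \<and> u \<le> t \<and> t \<le> T \<longrightarrow> X s t = truncate N (X s u \<star> X u t)) \<and>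
     (\<forall>s t. 0 \<le> s \<and> s \<le> t \<and> t \<le> T \<longrightarrow>
        pairing 1 (X s t) = 1 \<and>
        (\<forall>a b x y. a + b \<le> N \<and> x \<in> graded a \<and> y \<in> graded b \<longrightarrow>
           pairing (x * y) (X s t) = pairing x (X s t) * pairing y (X s t))) \<and>
     (\<forall>n\<in>{1..N}. \<forall>x\<in>graded n. \<exists>K. \<forall>s t. 0 \<le> s \<and> s < t \<and> t \<le> T \<longrightarrow>
        \<bar>pairing x (X s t)\<bar> \<le> K * \<omega> s t powr (real n / \<rho>)))"

text \<open>
  A linear map on the elements of weight at most \<open>m - 1\<close> is represented by its extension by
  \<open>0\<close> to higher weights, which makes all pairings truncated.  Since these elements form a
  finite-dimensional space, estimates of linear maps are stated pointwise.
\<close>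

definition controlled_path ::
  "real \<Rightarrow> real \<Rightarrow> (real \<Rightarrow> real \<Rightarrow> real) \<Rightarrow> (real \<Rightarrow> real \<Rightarrow> 'v::euclidean_space hopf) \<Rightarrow> nat \<Rightarrow>
   (real \<Rightarrow> 'v hopf \<Rightarrow> 'e::real_normed_vector) \<Rightarrow> bool" where
  "controlled_path \<rho> T \<omega> X m H \<longleftrightarrow>
     (\<forall>t\<in>{0..T}. linear (H t) \<and> (\<forall>h. H t (truncate (m - 1) h) = H t h)) \<and>
     (\<forall>h. approx_order \<rho> T \<omega> 1 (\<lambda>s t. H t h) (\<lambda>s t. H s h)) \<and>
     (\<forall>n<m. \<forall>h\<in>graded n. approx_order \<rho> T \<omega> (m - n) (\<lambda>s t. H t h) (\<lambda>s t. H s (X s t \<star> h)))"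

text \<open>Composition of a controlled path of order \<open>m\<close> with \<open>\<psi>\<close>, at a fixed time.\<close>

definition compose_controlled ::
  "nat \<Rightarrow> ('e::real_normed_vector \<Rightarrow> 'f::real_normed_vector) \<Rightarrow> ('a forests \<Rightarrow> 'e) \<Rightarrow> 'a forests \<Rightarrow> 'f" where
  "compose_controlled m \<psi> A h =
     Poly_Mapping.lookup h {#} *\<^sub>R \<psi> (A 1) + faa_di_bruno \<psi> A (A 1) (truncate (m - 1) h)"

text \<open>
  \<open>L\<close> is a linear map on the elements of positive weight; elements of \<open>X\<close> have weight at most
  \<open>\<lfloor>\<rho>\<rfloor>\<close>, so the pairing is truncated.
\<close>

definition has_rough_integral ::
  "(real \<Rightarrow> real \<Rightarrow> 'v::euclidean_space hopf) \<Rightarrow> (real \<Rightarrow> 'v hopf \<Rightarrow> 'e::real_normed_vector) \<Rightarrow>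
   real \<Rightarrow> real \<Rightarrow> 'e \<Rightarrow> bool" where
  "has_rough_integral X L s t I \<longleftrightarrow>
     (\<forall>\<epsilon>>0. \<exists>\<delta>>0. \<forall>n. \<forall>\<tau> :: nat \<Rightarrow> real.
        \<tau> 0 = s \<and> \<tau> n = t \<and> (\<forall>i<n. \<tau> i < \<tau> (Suc i) \<and> \<tau> (Suc i) - \<tau> i < \<delta>) \<longrightarrow>
        norm ((\<Sum>i<n. L (\<tau> i) (positive_part (X (\<tau> i) (\<tau> (Suc i))))) - I) < \<epsilon>)"

text \<open>
  \<open>H u q\<close> is the component at \<open>q\<close> of a controlled path with values in the linear maps on the
  generators of weight at most \<open>\<lfloor>\<rho>\<rfloor>\<close>, and \<open>L\<close> is the associated linear map on elements of
  positive weight at most \<open>\<lfloor>\<rho>\<rfloor>\<close>; it is unique since the generators freely generate the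
  Grossman--Larson algebra.
\<close>

definition controlled_integrand ::
  "real \<Rightarrow> real \<Rightarrow> (real \<Rightarrow> real \<Rightarrow> real) \<Rightarrow> (real \<Rightarrow> real \<Rightarrow> 'v::euclidean_space hopf) \<Rightarrow>
   (real \<Rightarrow> 'v hopf \<Rightarrow> 'v hopf \<Rightarrow> 'e::real_normed_vector) \<Rightarrow> bool" where
  "controlled_integrand \<rho> T \<omega> X H \<longleftrightarrow> (let N = nat \<lfloor>\<rho>\<rfloor> in
     (\<forall>u\<in>{0..T}. \<forall>h. linear_on (gl_generators \<inter> filtered N) (\<lambda>q. H u q h)) \<and>
     (\<forall>q\<in>gl_generators \<inter> filtered N. controlled_path \<rho> T \<omega> X N (\<lambda>u. H u q)))"

definition integrand_map ::
  "nat \<Rightarrow> ('v::euclidean_space hopf \<Rightarrow> 'v hopf \<Rightarrow> 'e::real_vector) \<Rightarrow> ('v hopf \<Rightarrow> 'e) \<Rightarrow> bool" where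
  "integrand_map N H L \<longleftrightarrow>
     linear_on (nonempty_span \<inter> filtered N) L \<and>
     (\<forall>a b h q. a + b \<le> N \<and> h \<in> filtered a \<and> q \<in> gl_generators \<inter> filtered b \<longrightarrow> L (h \<star> q) = H q h)"

text \<open>\<open>Z\<close> is the integral of \<open>H\<close> from \<open>0\<close>, as a controlled path of order \<open>\<lfloor>\<rho>\<rfloor> + 1\<close>.\<close>

definition controlled_integral ::
  "real \<Rightarrow> real \<Rightarrow> (real \<Rightarrow> real \<Rightarrow> real) \<Rightarrow> (real \<Rightarrow> real \<Rightarrow> 'v::euclidean_space hopf) \<Rightarrow>
   (real \<Rightarrow> 'v hopf \<Rightarrow> 'v hopf \<Rightarrow> 'e::real_normed_vector) \<Rightarrow> (real \<Rightarrow> 'v hopf \<Rightarrow> 'e) \<Rightarrow> bool" where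
  "controlled_integral \<rho> T \<omega> X H Z \<longleftrightarrow> (let N = nat \<lfloor>\<rho>\<rfloor> in
     controlled_integrand \<rho> T \<omega> X H \<and>
     (\<exists>L. (\<forall>u\<in>{0..T}. integrand_map N (H u) (L u)) \<and>
          (\<forall>t\<in>{0..T}. has_rough_integral X L 0 t (Z t 1) \<and>
             (\<forall>h\<in>nonempty_span \<inter> filtered N. Z t h = L t h))))"

text \<open>A smooth map into the linear maps on the generators, \<open>F q\<close> being its component at \<open>q\<close>.\<close>

definition vector_fields :: "('v::euclidean_space hopf \<Rightarrow> 'w::real_normed_vector \<Rightarrow> 'w) \<Rightarrow> bool" where
  "vector_fields F \<longleftrightarrow>
     (\<forall>y. linear_on gl_generators (\<lambda>q. F q y)) \<and> (\<forall>q\<in>gl_generators. smooth (F q))"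

definition rde_solution ::
  "real \<Rightarrow> real \<Rightarrow> (real \<Rightarrow> real \<Rightarrow> real) \<Rightarrow> (real \<Rightarrow> real \<Rightarrow> 'v::euclidean_space hopf) \<Rightarrow>
   ('v hopf \<Rightarrow> 'w::real_normed_vector \<Rightarrow> 'w) \<Rightarrow> 'w \<Rightarrow> (real \<Rightarrow> 'w) \<Rightarrow> bool" where
  "rde_solution \<rho> T \<omega> X F y\<^sub>0 Y \<longleftrightarrow> (let N = nat \<lfloor>\<rho>\<rfloor> in
     \<exists>\<Y> Z. controlled_path \<rho> T \<omega> X N \<Y> \<and>
       controlled_integral \<rho> T \<omega> X (\<lambda>u q. compose_controlled N (F q) (\<Y> u)) Z \<and>
       (\<forall>t\<in>{0..T}. \<Y> t 1 = Y t \<and> \<Y> t 1 = y\<^sub>0 + Z t 1 \<and>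
          (\<forall>h\<in>nonempty_span \<inter> filtered (N - 1). \<Y> t h = Z t h)))"


section \<open>The differential operators\<close>

text \<open>
  \<open>F_hat F G\<close> says that \<open>G\<close> is the linear map determined by \<open>F\<close>; there is exactly one on the
  elements of positive weight, as the generators freely generate the Grossman--Larson algebra.
\<close>

definition F_hat ::
  "('v::euclidean_space hopf \<Rightarrow> 'w::real_normed_vector \<Rightarrow> 'w) \<Rightarrow> ('v hopf \<Rightarrow> 'w \<Rightarrow> 'w) \<Rightarrow> bool" where
  "F_hat F G \<longleftrightarrow>
     (\<forall>h\<in>nonempty_span. smooth (G h)) \<and>
     (\<forall>y. linear_on nonempty_span (\<lambda>h. G h y)) \<and>
     (\<forall>q\<in>gl_generators. G q = F q) \<and>
     (\<forall>h\<in>nonempty_span. \<forall>q\<in>gl_generators. \<forall>y.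
        G (h \<star> q) y = faa_di_bruno (F q) (\<lambda>k. G k y) y h)"

definition F_bold ::
  "('v::euclidean_space hopf \<Rightarrow> 'w::real_normed_vector \<Rightarrow> 'w) \<Rightarrow>
   ('w \<Rightarrow> 'u::real_normed_vector) \<Rightarrow> 'v hopf \<Rightarrow> 'w \<Rightarrow> 'u" where
  "F_bold G \<phi> h y = faa_di_bruno \<phi> (\<lambda>k. G k y) y h"

end

theory Submission
  imports Defs
begin

text \<open>
  Write \<open>l\<^sub>s(h) = Fhat h (Y s)\<close> and \<open>N = \<lfloor>\<rho>\<rfloor>\<close>, let \<open>X\<close> denote the positive-weight part of \<open>X s t\<close>, and let
  orders refer to powers of \<open>\<omega>(s, t)\<^sup>1\<^sup>/\<^sup>\<rho>\<close>.  As \<open>(N + 1) / \<rho> > 1\<close>, sums of errors of order \<open>N + 1\<close> over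
  the intervals of a partition vanish with its mesh (\<open>rough_integral_of_increment\<close>).  Therefore the formula reduces
  to the local expansion \<open>\<phi>(Y t) - \<phi>(Y s) = F_bold Fhat \<phi> X (Y s)\<close> up to order \<open>N + 1\<close>
  (\<open>phi_increment\<close>).

  This expansion is Taylor's formula around \<open>Y s\<close>.  The increment of \<open>Y\<close> is \<open>l\<^sub>s(X)\<close> up to order \<open>N + 1\<close>
  (\<open>Y_increment\<close>), and in \<open>D\<^sup>n\<phi>(l\<^sub>s(X), \<dots>, l\<^sub>s(X))\<close> the \<open>n\<close>-th tensor power of \<open>X\<close> may be replaced by the
  reduced \<open>n\<close>-fold coproduct of \<open>X\<close>, since \<open>X s t\<close> is group-like up to weight \<open>N\<close> and heavier terms have
  order \<open>N + 1\<close> (\<open>faa_di_bruno_group_like\<close>).  The sum of these terms is the definition of \<open>F_bold\<close>.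

  The expansion of \<open>Y\<close> itself is a sewing argument.  By definition \<open>Y\<close> is an integral of the linear maps
  \<open>L\<^sub>s\<close> determined by \<open>L\<^sub>s(h \<star> q) = \<langle>F\<^sub>q(\<Y>\<^sub>s), h\<rangle>\<close>.  They agree with \<open>l\<^sub>s\<close> (\<open>L_Fhat\<close>), and by Chen's
  relation and the controlledness of \<open>F\<^sub>q(\<Y>)\<close> the germ \<open>l\<^sub>s(X s t)\<close> is additive up to order \<open>N + 1\<close>
  (\<open>germ_bound\<close>).

  Both facts need that the products \<open>h \<star> q\<close> with a generator \<open>q\<close> span all elements of positive
  weight (\<open>gl_generated\<close>); this is the algebraic core.  The Grossman--Larson product is dual to the
  Connes--Kreimer coproduct (\<open>duality\<close>) and so it is associative.  A functional that vanishes on all \<open>h \<star> q\<close>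
  would give rise to a nonzero primitive element annihilating the generators.  Such an element is a
  combination of growths \<open>u \<top> p\<close> with \<open>p\<close> primitive, whose coproducts are deconcatenations
  (\<open>coproduct_natural_growth\<close>); comparing the terms of highest left weight shows that no nonzero
  combination of this kind is primitive (\<open>growths_primitive\<close>).
\<close>

section \<open>Linear extension and induction on forests\<close>

abbreviation coef :: "('k \<Rightarrow>\<^sub>0 real) \<Rightarrow> 'k \<Rightarrow> real" where
  "coef \<equiv> Poly_Mapping.lookup"

abbreviation supp :: "('k \<Rightarrow>\<^sub>0 real) \<Rightarrow> 'k set" where
  "supp \<equiv> Poly_Mapping.keys"

lemma lin_add: "lin \<phi> (x + y) = lin \<phi> x + lin \<phi> y"
  by (rule linear_add[OF linear_lin])

lemma lin_diff: "lin \<phi> (x - y) = lin \<phi> x - lin \<phi> y"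
  by (rule linear_diff[OF linear_lin])

lemma lin_scaleR: "lin \<phi> (c *\<^sub>R x) = c *\<^sub>R lin \<phi> x"
  by (rule linear_cmul[OF linear_lin])

lemma lin_zero [simp]: "lin \<phi> 0 = 0"
  by (rule linear_0[OF linear_lin])

lemma linear_of_lin: "linear L \<Longrightarrow> L (lin \<phi> x) = lin (\<lambda>k. L (\<phi> k)) x"
  by (simp add: lin_def linear_sum linear_cmul)

lemma lin_cong: "(\<And>k. k \<in> supp x \<Longrightarrow> \<phi> k = \<psi> k) \<Longrightarrow> lin \<phi> x = lin \<psi> x"
  by (simp add: lin_def)

lemma lin_lin: "lin \<phi> (lin \<psi> x) = lin (\<lambda>k. lin \<phi> (\<psi> k)) x"
  by (rule linear_of_lin[OF linear_lin])

lemma linear_ext_lin: "linear L \<Longrightarrow> L x = lin (\<lambda>k. L (basis_vec k)) x"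
  using linear_of_lin[of L basis_vec x] poly_mapping_decomp[of x] by simp

lemma lin_plus_fun: "lin (\<lambda>k. \<phi> k + \<psi> k) x = lin \<phi> x + lin \<psi> x"
  by (simp add: lin_def scaleR_right_distrib sum.distrib)

lemma lin_scaleR_fun: "lin (\<lambda>k. c *\<^sub>R \<phi> k) x = c *\<^sub>R lin \<phi> x"
  by (simp add: lin_def scaleR_sum_right mult.commute)

lemma lin_zero_fun [simp]: "lin (\<lambda>k. 0) x = 0"
  by (simp add: lin_def)

lemma lin_sum_fun: "lin (\<lambda>k. \<Sum>a\<in>A. \<phi> a k) x = (\<Sum>a\<in>A. lin (\<phi> a) x)"
  unfolding lin_def by (simp add: scaleR_sum_right) (rule sum.swap)

lemma lin_swap: "lin (\<lambda>k. lin (\<lambda>l. M k l) y) x = lin (\<lambda>l. lin (\<lambda>k. M k l) x) y"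
  unfolding lin_def by (simp add: scaleR_sum_right mult.commute) (rule sum.swap)

lemma lin_delta: "lin (\<lambda>k. if k = l then c else 0) x = coef x l *\<^sub>R c"
proof -
  have "lin (\<lambda>k. if k = l then c else 0) x = (\<Sum>k\<in>supp x. if k = l then coef x l *\<^sub>R c else 0)"
    unfolding lin_def by (intro sum.cong) auto
  then show ?thesis by (simp add: in_keys_iff)
qed

lemma times_lin: "y * lin \<phi> x = lin (\<lambda>k. y * \<phi> k) x" for y :: "'k::comm_monoid_add \<Rightarrow>\<^sub>0 real"
  by (rule linear_of_lin[OF linear_times_right])

lemma lin_times: "lin \<phi> x * y = lin (\<lambda>k. \<phi> k * y) x" for y :: "'k::comm_monoid_add \<Rightarrow>\<^sub>0 real"
  by (rule linear_of_lin[OF linear_times_left])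

text \<open>
  Recursions on forests pass from a tree to the forest of its branches.  Adding a tree with known
  branches to a known forest captures both this step and the recursion on the number of trees, so
  that statements about trees need no induction of their own.
\<close>

lemma forest_induct [case_names empty add]:
  assumes empty: "P {#}" and add: "\<And>a C f. P C \<Longrightarrow> P f \<Longrightarrow> P (add_mset (Node a C) f)"
  shows "P f"
proof -
  have forest: "P f" if "\<And>a C. Node a C \<in># f \<Longrightarrow> P C" for f
    using that
  proof (induction f)
    case (add t f)
    obtain a C where t: "t = Node a C" by (cases t)
    have "P C" using add.prems[of a C] by (simp add: t)
    moreover have "P f"
    proof (rule add.IH)
      show "P C" if "Node a C \<in># f" for a C using add.prems[of a C] that by simp
    qed
    ultimately show ?case unfolding t by (rule assms(2))
  qed (simp add: empty)
  have "P (branches t)" for t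
  proof (induction t)
    case (Node a C)
    show ?case by (simp, rule forest) (use Node in force)
  qed
  then have "P C" if "Node a C \<in># f" for a C
    by (metis tree.sel(2))
  then show ?thesis by (rule forest)
qed

section \<open>Sums over splittings of a forest\<close>

text \<open>
  The Grossman--Larson coproduct is used in the dual form of summing a function of the two parts
  over all splittings of \<open>f\<close>.  The recursion \<open>usum_add_mset\<close> decides into which part a tree goes;
  coassociativity and cocommutativity of the coproduct follow from it by induction.
\<close>

definition usum :: "('a forest \<Rightarrow> 'a forest \<Rightarrow> 'e::real_vector) \<Rightarrow> 'a forest \<Rightarrow> 'e" where
  "usum K f = lin (\<lambda>(g, h). K g h) (unshuffle f)"

lemma usum_empty [simp]: "usum K {#} = K {#} {#}"
  by (simp add: usum_def unshuffle_def single_one[symmetric] zero_prod_def del: single_one)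

lemma usum_add_mset:
  "usum K (add_mset t f) = usum (\<lambda>g h. K (add_mset t g) h) f + usum (\<lambda>g h. K g (add_mset t h)) f"
  by (simp add: usum_def unshuffle_def distrib_right lin_add lin_times_basis_vec case_prod_unfold)

lemma usum_plus: "usum (\<lambda>g h. K g h + M g h) f = usum K f + usum M f"
  by (simp add: usum_def case_prod_unfold lin_plus_fun)

lemma usum_zero [simp]: "usum (\<lambda>g h. 0) f = 0"
  by (simp add: usum_def case_prod_unfold)

lemma linear_usum: "linear L \<Longrightarrow> L (usum K f) = usum (\<lambda>g h. L (K g h)) f"
  by (simp add: usum_def case_prod_unfold linear_of_lin)

lemma usum_times_left: "usum (\<lambda>g h. c * K g h) f = c * usum K f" for c :: real
  by (rule linear_usum[OF linear_times, symmetric])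

lemma usum_times_right: "usum (\<lambda>g h. K g h * c) f = usum K f * c" for c :: real
  using usum_times_left[of c K f] by (simp add: mult.commute)

lemma times_usum: "y * usum K f = usum (\<lambda>g h. y * K g h) f" for y :: "'k::comm_monoid_add \<Rightarrow>\<^sub>0 real"
  by (rule linear_usum[OF linear_times_right])

lemma lin_usum: "lin \<phi> (usum K f) = usum (\<lambda>g h. lin \<phi> (K g h)) f"
  by (rule linear_usum[OF linear_lin])

lemma lin_usum_fun: "lin (\<lambda>k. usum (K k) f) x = usum (\<lambda>g h. lin (\<lambda>k. K k g h) x) f"
  unfolding usum_def case_prod_unfold by (rule lin_swap)

lemma usum_commute: "usum K f = usum (\<lambda>g h. K h g) f"
proof (induction f arbitrary: K)
  case (add t f)
  show ?case
    unfolding usum_add_mset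
    by (subst (1 2) add.IH) (rule add.commute)
qed simp

lemma usum_assoc:
  "usum (\<lambda>g h. usum (\<lambda>g1 g2. K g1 g2 h) g) f = usum (\<lambda>g1 h. usum (\<lambda>g2 h2. K g1 g2 h2) h) f"
  by (induction f arbitrary: K) (simp_all add: usum_add_mset usum_plus add.assoc)

lemma usum_left_commute:
  "usum (\<lambda>a h. usum (\<lambda>b c. K a b c) h) f = usum (\<lambda>b h. usum (\<lambda>a c. K a b c) h) f"
proof -
  have "usum (\<lambda>a h. usum (\<lambda>b c. K a b c) h) f = usum (\<lambda>h c. usum (\<lambda>a b. K a b c) h) f"
    by (simp add: usum_assoc)
  also have "\<dots> = usum (\<lambda>h c. usum (\<lambda>b a. K a b c) h) f"
    by (subst usum_commute) (rule refl)
  also have "\<dots> = usum (\<lambda>b h. usum (\<lambda>a c. K a b c) h) f"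
    by (simp add: usum_assoc)
  finally show ?thesis .
qed

lemma usum_swap: "usum (\<lambda>a b. usum (\<lambda>c d. K a b c d) g) f = usum (\<lambda>c d. usum (\<lambda>a b. K a b c d) f) g"
  unfolding usum_def case_prod_unfold by (rule lin_swap)

lemma usum_unit: "usum (\<lambda>x y. if x = {#} then K y else 0) f = K f"
  by (induction f arbitrary: K) (simp_all add: usum_add_mset)

lemma usum_cong:
  assumes "\<And>g h. g + h = f \<Longrightarrow> K g h = M g h"
  shows "usum K f = usum M f"
  using assms
proof (induction f arbitrary: K M)
  case (add t f)
  have "usum (\<lambda>g h. K (add_mset t g) h) f = usum (\<lambda>g h. M (add_mset t g) h) f"
    by (rule add.IH) (simp add: add.prems)
  moreover have "usum (\<lambda>g h. K g (add_mset t h)) f = usum (\<lambda>g h. M g (add_mset t h)) f"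
    by (rule add.IH) (simp add: add.prems)
  ultimately show ?case
    by (simp only: usum_add_mset)
qed simp

lemma conv_usum: "conv \<phi> \<psi> f = usum (\<lambda>g h. \<phi> g * \<psi> h) f"
  by (simp add: conv_def usum_def)

lemma sum_mset_cong: "(\<And>x. x \<in># A \<Longrightarrow> f x = g x) \<Longrightarrow> (\<Sum>x\<in>#A. f x) = (\<Sum>x\<in>#A. g x)"
  by (rule arg_cong[where f = sum_mset]) (rule image_mset_cong)

text \<open>The picked tree is put into the first part: associativity of convolution, for a functional on single trees.\<close>

lemma usum_extract:
  "(\<Sum>s\<in>#g. usum (M s) (g - {#s#})) = usum (\<lambda>x y. \<Sum>s\<in>#x. M s (x - {#s#}) y) g"
proof (induction g arbitrary: M)
  case (add r g)
  have *: "add_mset r g - {#s#} = add_mset r (g - {#s#})" if "s \<in># g" for s and g :: "_ tree multiset"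
    using multi_member_split[OF that] by (auto simp: add_mset_commute[of r])
  have "(\<Sum>s\<in>#g. usum (M s) (add_mset r g - {#s#}))
     = (\<Sum>s\<in>#g. usum (\<lambda>x y. M s (add_mset r x) y) (g - {#s#}) + usum (\<lambda>x y. M s x (add_mset r y)) (g - {#s#}))"
    by (intro sum_mset_cong) (simp add: * usum_add_mset)
  also have "\<dots> = usum (\<lambda>x y. \<Sum>s\<in>#x. M s (add_mset r (x - {#s#})) y) g
       + usum (\<lambda>x y. \<Sum>s\<in>#x. M s (x - {#s#}) (add_mset r y)) g"
    by (simp add: sum_mset.distrib add.IH)
  also have "(\<lambda>x y. \<Sum>s\<in>#x. M s (add_mset r (x - {#s#})) y) = (\<lambda>x y. \<Sum>s\<in>#x. M s (add_mset r x - {#s#}) y)"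
    by (intro ext sum_mset_cong) (simp add: *)
  finally show ?case
    by (simp add: usum_add_mset usum_plus add.assoc)
qed simp

section \<open>The pairing\<close>

lemma matchings_empty: "matchings {#} g = of_bool (g = {#})"
proof (cases "g = {#}")
  case True
  have "matchings (mset []) (mset []) = (1::real)"
    by (subst matchings_mset) simp_all
  with True show ?thesis by simp
next
  case False
  then show ?thesis by (simp add: matchings_def)
qed

text \<open>Expansion of a permanent along a row: a bijection is determined by the partner of one element.\<close>

lemma matchings_add_mset:
  "matchings (add_mset \<phi> \<Phi>) g = (\<Sum>t\<in>#g. \<phi> t * matchings \<Phi> (g - {#t#}))"
proof (cases "size g = Suc (size \<Phi>)")
  case False
  have "(\<Sum>t\<in>#g. \<phi> t * matchings \<Phi> (g - {#t#})) = (\<Sum>t\<in>#g. 0)"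
  proof (intro sum_mset_cong)
    fix t assume "t \<in># g"
    then have "size \<Phi> \<noteq> size (g - {#t#})"
      using False by (metis size_Suc_Diff1)
    then show "\<phi> t * matchings \<Phi> (g - {#t#}) = 0"
      by (simp add: matchings_def)
  qed
  then show ?thesis using False by (simp add: matchings_def)
next
  case True
  obtain fs xs where fs: "mset fs = \<Phi>" and xs: "mset xs = g"
    by (metis ex_mset)
  define n where "n = length fs"
  have n: "length fs = n" "length xs = Suc n"
    using True unfolding n_def fs[symmetric] xs[symmetric] by simp_all
  (* A permutation of {..n} is a transposition of n and its image b after a permutation of {..<n}. *)
  define ys where "ys b = map (\<lambda>j. xs ! Transposition.transpose n b j) [0..<n]" for b
  have ys: "mset (ys b) = g - {#xs ! b#}" if "b < Suc n" for b
  proof -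
    have "Transposition.transpose n b permutes {..<length xs}"
      using that n by (intro permutes_swap_id) auto
    then have "mset (permute_list (Transposition.transpose n b) xs) = mset xs"
      by (rule mset_permute_list)
    moreover have "permute_list (Transposition.transpose n b) xs = ys b @ [xs ! b]"
      by (simp add: permute_list_def ys_def n)
    ultimately have "mset (ys b @ [xs ! b]) = g"
      using xs by simp
    then have "g = add_mset (xs ! b) (mset (ys b))" by simp
    then show ?thesis by simp
  qed
  have "matchings (add_mset \<phi> \<Phi>) g = matchings (mset (fs @ [\<phi>])) (mset xs)"
    by (simp add: fs xs)
  also have "\<dots> = (\<Sum>\<pi> | \<pi> permutes {..<Suc n}. \<Prod>i<Suc n. ((fs @ [\<phi>]) ! i) (xs ! \<pi> i))"
    using n by (subst matchings_mset) auto
  also have "{..<Suc n} = insert n {..<n}" by auto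
  also have "(\<Sum>\<pi> | \<pi> permutes insert n {..<n}. \<Prod>i\<in>insert n {..<n}. ((fs @ [\<phi>]) ! i) (xs ! \<pi> i))
     = (\<Sum>b\<in>insert n {..<n}. \<Sum>q | q permutes {..<n}. \<Prod>i\<in>insert n {..<n}. ((fs @ [\<phi>]) ! i) (xs ! (Transposition.transpose n b \<circ> q) i))"
    by (rule sum_over_permutations_insert) auto
  also have "\<dots> = (\<Sum>b\<in>insert n {..<n}. \<phi> (xs ! b) * matchings \<Phi> (g - {#xs ! b#}))"
  proof (intro sum.cong refl)
    fix b assume "b \<in> insert n {..<n}"
    then have b: "b < Suc n" by auto
    have "(\<Sum>q | q permutes {..<n}. \<Prod>i\<in>insert n {..<n}. ((fs @ [\<phi>]) ! i) (xs ! (Transposition.transpose n b \<circ> q) i))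
      = (\<Sum>q | q permutes {..<n}. \<phi> (xs ! b) * (\<Prod>i<n. (fs ! i) (ys b ! q i)))"
    proof (intro sum.cong refl)
      fix q assume "q \<in> {q. q permutes {..<n}}"
      then have q: "q permutes {..<n}" by simp
      then have "q n = n" by (simp add: permutes_not_in)
      moreover have "ys b ! q i = xs ! Transposition.transpose n b (q i)" if "i < n" for i
        using permutes_in_image[OF q, of i] that by (simp add: ys_def)
      ultimately show "(\<Prod>i\<in>insert n {..<n}. ((fs @ [\<phi>]) ! i) (xs ! (Transposition.transpose n b \<circ> q) i)) = \<phi> (xs ! b) * (\<Prod>i<n. (fs ! i) (ys b ! q i))"
        by (simp add: n nth_append)
    qed
    also have "\<dots> = \<phi> (xs ! b) * matchings (mset fs) (mset (ys b))"
      by (subst matchings_mset) (auto simp: ys_def n sum_distrib_left)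
    finally show "(\<Sum>q | q permutes {..<n}. \<Prod>i\<in>insert n {..<n}. ((fs @ [\<phi>]) ! i) (xs ! (Transposition.transpose n b \<circ> q) i))
      = \<phi> (xs ! b) * matchings \<Phi> (g - {#xs ! b#})"
      by (simp add: ys[OF b] fs)
  qed
  also have "insert n {..<n} = {0..<length xs}" using n by auto
  also have "(\<Sum>b\<in>{0..<length xs}. \<phi> (xs ! b) * matchings \<Phi> (g - {#xs ! b#})) = (\<Sum>t\<leftarrow>xs. \<phi> t * matchings \<Phi> (g - {#t#}))"
    by (simp add: sum_list_sum_nth)
  also have "\<dots> = (\<Sum>t\<in>#g. \<phi> t * matchings \<Phi> (g - {#t#}))"
    by (simp add: xs[symmetric] sum_mset_sum_list[symmetric])
  finally show ?thesis .
qed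

text \<open>The pairing on basis forests; \<open>fp f f\<close> is the number of automorphisms of \<open>f\<close>.\<close>

abbreviation tp :: "'a tree \<Rightarrow> 'a tree \<Rightarrow> real" where
  "tp \<equiv> tree_pairing (\<lambda>i j. of_bool (i = j))"

abbreviation fp :: "'a forest \<Rightarrow> 'a forest \<Rightarrow> real" where
  "fp \<equiv> forest_pairing (\<lambda>i j. of_bool (i = j))"

lemma fp_empty: "fp {#} g = of_bool (g = {#})"
  by (simp add: forest_pairing_def matchings_empty)

lemma fp_add_mset: "fp (add_mset t f) g = (\<Sum>s\<in>#g. tp t s * fp f (g - {#s#}))"
  by (simp add: forest_pairing_def matchings_add_mset)

lemma tp_Node: "tp (Node a C) s = of_bool (a = root_label s) * fp C (branches s)"
  by (simp add: forest_pairing_def)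

text \<open>An isomorphism from a disjoint union splits its target, so disjoint union is dual to splitting.\<close>

lemma fp_union: "fp (f1 + f2) g = usum (\<lambda>x y. fp f1 x * fp f2 y) g"
proof (induction f1 arbitrary: g)
  case empty
  have "usum (\<lambda>x y. fp {#} x * fp f2 y) g = usum (\<lambda>x y. if x = {#} then fp f2 y else 0) g"
    by (intro usum_cong) (simp add: fp_empty)
  also have "\<dots> = fp ({#} + f2) g" by (simp add: usum_unit)
  finally show ?case by (rule sym)
next
  case (add t f1)
  have "fp (add_mset t f1 + f2) g = (\<Sum>s\<in>#g. usum (\<lambda>x y. tp t s * (fp f1 x * fp f2 y)) (g - {#s#}))"
    by (simp add: fp_add_mset add usum_times_left)
  also have "\<dots> = usum (\<lambda>x y. fp (add_mset t f1) x * fp f2 y) g"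
    by (simp add: usum_extract fp_add_mset sum_mset_distrib_right mult.assoc)
  finally show ?case .
qed

lemma fp_orthogonal_pos: "(f \<noteq> g \<longrightarrow> fp f g = 0) \<and> fp f f > 0"
proof (induction f arbitrary: g rule: forest_induct)
  case empty
  then show ?case by (simp add: fp_empty)
next
  case (add a C f)
  let ?t = "Node a C"
  have tp: "(?t \<noteq> s \<longrightarrow> tp ?t s = 0) \<and> tp ?t ?t > 0" for s
    using add.IH(1) by (cases s) (auto simp: tp_Node simp del: tree_pairing.simps)
  have 1: "fp (add_mset ?t f) g = real (count g ?t) * (tp ?t ?t * fp f (g - {#?t#}))" for g
  proof -
    have "fp (add_mset ?t f) g = (\<Sum>s\<in>#g. if s = ?t then tp ?t ?t * fp f (g - {#?t#}) else 0)"
      unfolding fp_add_mset using tp by (intro sum_mset_cong) auto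
    then show ?thesis by (simp add: sum_mset_delta)
  qed
  have "fp (add_mset ?t f) g = 0" if "add_mset ?t f \<noteq> g"
  proof (cases "?t \<in># g")
    case True
    then have "f \<noteq> g - {#?t#}" using that by auto
    then show ?thesis using add.IH(2) 1 by simp
  next
    case False
    then show ?thesis by (simp add: 1 not_in_iff)
  qed
  moreover have "fp (add_mset ?t f) (add_mset ?t f) > 0"
    using add.IH(2) tp by (simp add: 1 del: tree_pairing.simps)
  ultimately show ?case by blast
qed

lemma fp_orthogonal: "f \<noteq> g \<Longrightarrow> fp f g = 0"
  and fp_pos: "fp f f > 0"
  using fp_orthogonal_pos[of f g] by simp_all

lemma lin_fp: "lin (fp f) x = coef x f * fp f f"
proof -
  have "fp f = (\<lambda>g. if g = f then fp f f else 0)"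
    using fp_orthogonal[of f] by (auto simp: fun_eq_iff)
  then show ?thesis by (metis lin_delta real_scaleR_def)
qed

lemma pairing_basis: "pairing (basis_vec f) x = coef x f * fp f f"
  by (simp add: pairing_def lin_fp)

lemma pairing_lin: "pairing x y = lin (\<lambda>f. coef y f * fp f f) x"
  unfolding pairing_def by (simp add: lin_fp)

section \<open>The Grossman--Larson product is dual to the Connes--Kreimer coproduct\<close>

lemma gl_forest_empty_right: "gl_forest h {#} = basis_vec h"
proof -
  have "gl_forest h {#} = usum (\<lambda>x y. if y = {#} then basis_vec x else 0) h"
    unfolding gl_forest_def conv_usum by (intro usum_cong) (simp add: conv_prod_empty)
  also have "\<dots> = basis_vec h"
    by (subst usum_commute) (rule usum_unit)
  finally show ?thesis .
qed

lemma conv_left_commute: "conv \<phi> (conv \<psi> \<theta>) f = conv \<psi> (conv \<phi> \<theta>) f"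
  unfolding conv_usum times_usum by (subst usum_left_commute) (simp add: mult.left_commute)

lemma gl_forest_add_mset:
  "gl_forest h (add_mset t g) = usum (\<lambda>h1 h2. graft_tree t h1 * gl_forest h2 g) h"
  unfolding gl_forest_def image_mset_add_mset conv_prod_add_mset
  by (subst conv_left_commute) (simp add: conv_usum)

lemma lin_mult_real: "lin \<phi> x * c = lin (\<lambda>k. \<phi> k * c) x" for c :: real
  by (simp add: lin_def sum_distrib_right mult.assoc)

lemma mult_lin_real: "c * lin \<phi> x = lin (\<lambda>k. c * \<phi> k) x" for c :: real
  unfolding mult.commute[of c] by (rule lin_mult_real)

lemma lin_prod_real: "lin \<phi> x * lin \<psi> y = lin (\<lambda>k. lin (\<lambda>l. \<phi> k * \<psi> l) y) x" for \<phi> \<psi> :: "_ \<Rightarrow> real"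
  by (subst lin_mult_real) (simp only: mult_lin_real)

lemma lin_times_double:
  fixes x y :: "'k::comm_monoid_add \<Rightarrow>\<^sub>0 real"
  shows "lin \<phi> (x * y) = lin (\<lambda>k. lin (\<lambda>l. \<phi> (k + l)) y) x"
proof -
  have "lin \<phi> (x * y) = lin \<phi> (lin (\<lambda>k. basis_vec k * y) x)"
    by (subst poly_mapping_decomp[of x]) (simp only: lin_times)
  then show ?thesis
    by (simp add: lin_lin lin_times_basis_vec)
qed

lemma lin_times2:
  fixes x y :: "'k::comm_monoid_add \<Rightarrow>\<^sub>0 real" and \<psi> \<theta> :: "'k \<Rightarrow> 'l::comm_monoid_add \<Rightarrow>\<^sub>0 real"
  assumes "\<And>k l. \<phi> (k + l) = \<psi> k * \<theta> l"
  shows "lin \<phi> (x * y) = lin \<psi> x * lin \<theta> y"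
  unfolding lin_times_double assms by (subst lin_times) (simp only: times_lin)

lemma one_forests: "(1 :: 'a forests) = basis_vec {#}"
  unfolding single_one[symmetric] by simp

lemma one_forests2: "(1 :: 'a forests2) = basis_vec ({#}, {#})"
  unfolding single_one[symmetric] zero_prod_def by simp

lemma lin_one [simp]: "lin \<phi> (1 :: 'a forests) = \<phi> {#}"
  unfolding one_forests by (rule lin_basis_vec)

lemma lin_one2 [simp]: "lin \<phi> (1 :: 'a forests2) = \<phi> ({#}, {#})"
  unfolding one_forests2 by simp

lemma graft_tree_alt:
  "graft_tree t h = lin (\<lambda>f. basis_vec {#Node (root_label t) f#}) (gl_forest h (branches t))"
  by (cases t) (simp add: graft_tree_Node add_root_def del: graft_tree.simps)

lemma lin_graft_times:
  "lin \<alpha> (graft_tree t h * x)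
     = lin (\<lambda>f. lin (\<lambda>w. \<alpha> (add_mset (Node (root_label t) f) w)) x) (gl_forest h (branches t))"
  by (simp add: graft_tree_alt lin_times lin_lin lin_times_basis_vec)

lemma lin_graft_times_basis: "lin (\<lambda>w. lin \<alpha> (y * basis_vec w)) x = lin \<alpha> (y * x)" for y :: "'k::comm_monoid_add \<Rightarrow>\<^sub>0 real"
proof -
  have "lin \<alpha> (y * x) = lin \<alpha> (y * lin basis_vec x)"
    by (subst poly_mapping_decomp[of x]) (rule refl)
  then show ?thesis
    by (simp only: times_lin lin_lin)
qed

text \<open>The product of functionals dual to splitting, that is, convolution for the coproduct.\<close>

definition cmul :: "('a forest \<Rightarrow> real) \<Rightarrow> ('a forest \<Rightarrow> real) \<Rightarrow> 'a forest \<Rightarrow> real" where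
  "cmul \<alpha> \<beta> x = usum (\<lambda>y z. \<alpha> y * \<beta> z) x"

text \<open>Grafting onto a tree yields single trees, which are primitive; this gives a Leibniz rule.\<close>

lemma cmul_graft:
  "lin (cmul \<alpha> \<beta>) (graft_tree t h * x) =
     lin (cmul (\<lambda>w. lin \<alpha> (graft_tree t h * basis_vec w)) \<beta>) x +
     lin (cmul \<alpha> (\<lambda>w. lin \<beta> (graft_tree t h * basis_vec w))) x"
proof -
  let ?z = "gl_forest h (branches t)" and ?N = "Node (root_label t)"
  have 1: "lin (\<lambda>f. lin (\<lambda>w. usum (\<lambda>y z. \<alpha> (add_mset (?N f) y) * \<beta> z) w) x) ?z
      = lin (cmul (\<lambda>w. lin \<alpha> (graft_tree t h * basis_vec w)) \<beta>) x"
    by (subst lin_swap) (simp add: cmul_def[abs_def] lin_graft_times lin_mult_real lin_usum_fun)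
  have 2: "lin (\<lambda>f. lin (\<lambda>w. usum (\<lambda>y z. \<alpha> y * \<beta> (add_mset (?N f) z)) w) x) ?z
      = lin (cmul \<alpha> (\<lambda>w. lin \<beta> (graft_tree t h * basis_vec w))) x"
    by (subst lin_swap) (simp add: cmul_def[abs_def] lin_graft_times mult_lin_real lin_usum_fun)
  have "lin (cmul \<alpha> \<beta>) (graft_tree t h * x)
    = lin (\<lambda>f. lin (\<lambda>w. usum (\<lambda>y z. \<alpha> (add_mset (?N f) y) * \<beta> z) w + usum (\<lambda>y z. \<alpha> y * \<beta> (add_mset (?N f) z)) w) x) ?z"
    by (simp add: lin_graft_times cmul_def usum_add_mset)
  then show ?thesis
    by (simp add: lin_plus_fun 1 2)
qed

lemma lin_gl_forest_add_mset:
  "lin \<alpha> (gl_forest h (add_mset t g)) = usum (\<lambda>h1 h2. lin \<alpha> (graft_tree t h1 * gl_forest h2 g)) h"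
  by (simp add: gl_forest_add_mset lin_usum)

text \<open>
  The Grossman--Larson product is compatible with splitting.  Each tree of \<open>g\<close> receives a part of
  \<open>h\<close> and then goes as a whole into one of the two parts, by the Leibniz rule; regrouping the parts
  of \<open>h\<close> by coassociativity and cocommutativity turns this into two separate products.
\<close>

lemma cmul_gl_forest:
  "lin (cmul \<alpha> \<beta>) (gl_forest h g) =
     usum (\<lambda>h1 h2. usum (\<lambda>g1 g2. lin \<alpha> (gl_forest h1 g1) * lin \<beta> (gl_forest h2 g2)) g) h"
proof (induction g arbitrary: \<alpha> \<beta> h)
  case empty
  show ?case by (simp add: gl_forest_empty_right cmul_def)
next
  case (add t g)
  let ?a = "\<lambda>h1 h3 g3. lin \<alpha> (graft_tree t h1 * gl_forest h3 g3)"
  let ?b = "\<lambda>h1 h3 g3. lin \<beta> (graft_tree t h1 * gl_forest h3 g3)"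
  let ?A = "\<lambda>h g. lin \<alpha> (gl_forest h g)" and ?B = "\<lambda>h g. lin \<beta> (gl_forest h g)"
  have "lin (cmul \<alpha> \<beta>) (gl_forest h (add_mset t g))
     = usum (\<lambda>h1 h2. usum (\<lambda>h3 h4. usum (\<lambda>g3 g4. ?a h1 h3 g3 * ?B h4 g4) g) h2
                   + usum (\<lambda>h3 h4. usum (\<lambda>g3 g4. ?A h3 g3 * ?b h1 h4 g4) g) h2) h"
    by (simp add: lin_gl_forest_add_mset cmul_graft add.IH lin_graft_times_basis)
  also have "\<dots> = usum (\<lambda>h1 h2. usum (\<lambda>h3 h4. usum (\<lambda>g3 g4. ?a h1 h3 g3 * ?B h4 g4) g) h2) h
      + usum (\<lambda>h1 h2. usum (\<lambda>h3 h4. usum (\<lambda>g3 g4. ?A h3 g3 * ?b h1 h4 g4) g) h2) h"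
    by (simp add: usum_plus)
  also have "usum (\<lambda>h1 h2. usum (\<lambda>h3 h4. usum (\<lambda>g3 g4. ?a h1 h3 g3 * ?B h4 g4) g) h2) h
     = usum (\<lambda>h' h4. usum (\<lambda>h1 h3. usum (\<lambda>g3 g4. ?a h1 h3 g3 * ?B h4 g4) g) h') h"
    by (rule usum_assoc[symmetric])
  also have "\<dots> = usum (\<lambda>h' h4. usum (\<lambda>g3 g4. ?A h' (add_mset t g3) * ?B h4 g4) g) h"
    by (subst usum_swap) (simp add: usum_times_right lin_gl_forest_add_mset)
  also have "usum (\<lambda>h1 h2. usum (\<lambda>h3 h4. usum (\<lambda>g3 g4. ?A h3 g3 * ?b h1 h4 g4) g) h2) h
     = usum (\<lambda>h3 h2. usum (\<lambda>h1 h4. usum (\<lambda>g3 g4. ?A h3 g3 * ?b h1 h4 g4) g) h2) h"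
    by (rule usum_left_commute)
  also have "\<dots> = usum (\<lambda>h3 h2. usum (\<lambda>g3 g4. ?A h3 g3 * ?B h2 (add_mset t g4)) g) h"
    by (subst usum_swap) (simp add: usum_times_left lin_gl_forest_add_mset)
  finally show ?case
    by (simp add: usum_add_mset usum_plus)
qed

definition pair2 :: "'a forests2 \<Rightarrow> 'a forest \<Rightarrow> 'a forest \<Rightarrow> real" where
  "pair2 z h g = lin (\<lambda>(a, b). fp a h * fp b g) z"

lemma pair2_times:
  "pair2 (z1 * z2) h g = usum (\<lambda>h1 h2. usum (\<lambda>g1 g2. pair2 z1 h1 g1 * pair2 z2 h2 g2) g) h"
proof -
  have *: "fp (fst p + fst q) h * fp (snd p + snd q) g =
     usum (\<lambda>h1 h2. usum (\<lambda>g1 g2. (fp (fst p) h1 * fp (snd p) g1) * (fp (fst q) h2 * fp (snd q) g2)) g) h" for p q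
    unfolding fp_union usum_times_left[symmetric] usum_times_right[symmetric]
    by (subst usum_swap) (simp add: mult_ac)
  show ?thesis
    unfolding pair2_def
    by (simp add: lin_times_double case_prod_unfold * lin_usum_fun lin_prod_real)
qed

lemma pair2_lookup: "pair2 z h g = coef z (h, g) * (fp h h * fp g g)"
proof -
  have "(\<lambda>(a, b). fp a h * fp b g) = (\<lambda>k. if k = (h, g) then fp h h * fp g g else 0)"
    using fp_orthogonal by (fastforce simp: fun_eq_iff)
  then show ?thesis
    unfolding pair2_def by (simp only: lin_delta real_scaleR_def)
qed

lemma pair2_ext: "(\<And>h g. pair2 z h g = pair2 z' h g) \<Longrightarrow> z = z'"
proof (rule poly_mapping_eqI)
  fix k :: "'a forest \<times> 'a forest"
  assume "\<And>h g. pair2 z h g = pair2 z' h g"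
  from this[of "fst k" "snd k"] show "coef z k = coef z' k"
    using fp_pos[of "fst k"] fp_pos[of "snd k"] by (simp add: pair2_lookup)
qed

lemma lin_fp_ext: "(\<And>f. lin (fp f) x = lin (fp f) y) \<Longrightarrow> x = y"
proof (rule poly_mapping_eqI)
  fix f :: "'a forest"
  assume "\<And>f. lin (fp f) x = lin (fp f) y"
  from this[of f] show "coef x f = coef y f"
    using fp_pos[of f] by (simp add: lin_fp)
qed

abbreviation cuts :: "'a forest \<Rightarrow> 'a forests2" where
  "cuts f \<equiv> \<Prod>t\<in>#f. cuts_tree t"

lemma fp_singleton: "fp {#t#} (add_mset s w) = (if w = {#} then tp t s else 0)"
proof (cases "w = {#}")
  case False
  have "(\<Sum>r\<in>#add_mset s w. tp t r * fp {#} (add_mset s w - {#r#})) = (\<Sum>r\<in>#add_mset s w. 0)"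
  proof (intro sum_mset_cong)
    fix r assume "r \<in># add_mset s w"
    then have "size (add_mset s w - {#r#}) = size w"
      by (simp add: size_Diff_singleton)
    then have "add_mset s w - {#r#} \<noteq> {#}" using False by fastforce
    then show "tp t r * fp {#} (add_mset s w - {#r#}) = 0" by (simp add: fp_empty)
  qed
  with False show ?thesis by (simp add: fp_add_mset del: sum_mset_constant)
qed (simp add: fp_add_mset fp_empty)

lemma fp_singleton_empty: "fp {#t#} {#} = 0"
  by (simp add: fp_add_mset)

lemma lin_fp_empty_gl: "lin (fp {#}) (gl_forest h g) = of_bool (h = {#} \<and> g = {#})"
proof (cases g)
  case empty
  show ?thesis by (simp add: empty gl_forest_empty_right fp_empty)
next
  case (add t g')
  have "lin (fp {#}) (graft_tree t h1 * x) = 0" for h1 x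
    unfolding lin_graft_times by (simp add: fp_empty)
  then show ?thesis
    by (simp add: add lin_gl_forest_add_mset)
qed

text \<open>
  A product \<open>h \<star> g\<close> contains a single tree only if \<open>g\<close> is empty, or if \<open>g\<close> is a tree and all of \<open>h\<close>
  is grafted onto it.  These two cases match the two terms in the recursion of \<open>cuts_tree\<close>.
\<close>

lemma duality_tree:
  assumes C: "\<And>h g. lin (fp C) (gl_forest h g) = pair2 (cuts C) h g"
  shows "lin (fp {#Node a C#}) (gl_forest h g) = pair2 (cuts_tree (Node a C)) h g"
proof (cases g)
  case empty
  have "lin (\<lambda>(f, k). fp f h * fp {#Node a k#} {#}) (cuts C) = 0"
    by (simp add: fp_singleton_empty case_prod_unfold)
  with empty show ?thesis
    by (simp add: gl_forest_empty_right pair2_def lin_add lin_lin case_prod_unfold fp_empty)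
next
  case (add s g')
  let ?D = "branches s" and ?b = "root_label s"
  have L: "lin (fp {#Node a C#}) (graft_tree s h1 * x) = of_bool (a = ?b) * pair2 (cuts C) h1 ?D * lin (fp {#}) x" for h1 x
  proof -
    have "lin (fp {#Node a C#}) (graft_tree s h1 * x)
       = lin (\<lambda>f. lin (\<lambda>w. (of_bool (a = ?b) * fp C f) * fp {#} w) x) (gl_forest h1 ?D)"
      unfolding lin_graft_times
      by (intro lin_cong) (simp add: fp_singleton tp_Node fp_empty del: tree_pairing.simps)
    then show ?thesis
      by (simp add: mult_lin_real[symmetric] lin_mult_real[symmetric] C)
  qed
  have "lin (fp {#Node a C#}) (gl_forest h g)
      = usum (\<lambda>h1 h2. of_bool (a = ?b) * pair2 (cuts C) h1 ?D * of_bool (h2 = {#} \<and> g' = {#})) h"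
    by (simp add: add lin_gl_forest_add_mset L lin_fp_empty_gl)
  also have "\<dots> = usum (\<lambda>h2 h1. if h2 = {#} then of_bool (a = ?b) * pair2 (cuts C) h1 ?D * of_bool (g' = {#}) else 0) h"
    by (subst usum_commute) (intro usum_cong, simp)
  also have "\<dots> = of_bool (a = ?b) * pair2 (cuts C) h ?D * of_bool (g' = {#})"
    by (simp only: usum_unit)
  also have "\<dots> = pair2 (cuts_tree (Node a C)) h g"
  proof -
    have "pair2 (cuts_tree (Node a C)) h g = lin (\<lambda>(f, k). fp f h * fp {#Node a k#} g) (cuts C)"
      by (simp add: pair2_def lin_add lin_lin case_prod_unfold fp_empty add)
    also have "\<dots> = lin (\<lambda>p. (fp (fst p) h * fp (snd p) ?D) * (of_bool (a = ?b) * of_bool (g' = {#}))) (cuts C)"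
      by (intro lin_cong) (simp add: add fp_singleton tp_Node case_prod_unfold del: tree_pairing.simps)
    also have "\<dots> = of_bool (a = ?b) * pair2 (cuts C) h ?D * of_bool (g' = {#})"
      by (simp add: lin_mult_real[symmetric] pair2_def case_prod_unfold)
    finally show ?thesis by simp
  qed
  finally show ?thesis .
qed

text \<open>
  Both sides are multiplicative in \<open>f\<close>: the right one since cuts of different trees are independent,
  the left one since the product is compatible with splitting.  This leaves single trees.
\<close>

theorem duality: "lin (fp f) (gl_forest h g) = pair2 (cuts f) h g"
proof (induction f arbitrary: h g rule: forest_induct)
  case empty
  show ?case by (simp add: lin_fp_empty_gl pair2_def) (simp add: fp_empty)
next
  case (add a C f)
  have "fp (add_mset (Node a C) f) = cmul (fp {#Node a C#}) (fp f)"
    using fp_union[of "{#Node a C#}" f] by (simp add: fun_eq_iff cmul_def)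
  then show ?case
    using duality_tree[OF add.IH(1), of a] add.IH(2)
    by (simp add: cmul_gl_forest pair2_times del: cuts_tree.simps)
qed

section \<open>Associativity of the Grossman--Larson product\<close>

text \<open>Both sides of coassociativity are multiplicative, so that it suffices to compare them on trees.\<close>

definition cop_left :: "'a forests2 \<Rightarrow> ('a forest \<times> 'a forest \<times> 'a forest) \<Rightarrow>\<^sub>0 real" where
  "cop_left = lin (\<lambda>(f, g). lin (\<lambda>(a, b). basis_vec (a, b, g)) (cuts f))"

definition cop_right :: "'a forests2 \<Rightarrow> ('a forest \<times> 'a forest \<times> 'a forest) \<Rightarrow>\<^sub>0 real" where
  "cop_right = lin (\<lambda>(f, g). lin (\<lambda>(a, b). basis_vec (f, a, b)) (cuts g))"

lemma cop_left_times: "cop_left (x * y) = cop_left x * cop_left y"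
  unfolding cop_left_def
proof (rule lin_times2)
  fix k l :: "'a forest \<times> 'a forest"
  have "lin (\<lambda>(a, b). basis_vec (a, b, snd k + snd l)) (cuts (fst k) * cuts (fst l)) =
     lin (\<lambda>(a, b). basis_vec (a, b, snd k)) (cuts (fst k)) * lin (\<lambda>(a, b). basis_vec (a, b, snd l)) (cuts (fst l))"
    by (rule lin_times2) (simp add: case_prod_unfold mult_single)
  then show "(case k + l of (f, g) \<Rightarrow> lin (\<lambda>(a, b). basis_vec (a, b, g)) (cuts f)) =
    (case k of (f, g) \<Rightarrow> lin (\<lambda>(a, b). basis_vec (a, b, g)) (cuts f)) * (case l of (f, g) \<Rightarrow> lin (\<lambda>(a, b). basis_vec (a, b, g)) (cuts f))"
    by (simp add: case_prod_unfold)
qed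

lemma cop_right_times: "cop_right (x * y) = cop_right x * cop_right y"
  unfolding cop_right_def
proof (rule lin_times2)
  fix k l :: "'a forest \<times> 'a forest"
  have "lin (\<lambda>(a, b). basis_vec (fst k + fst l, a, b)) (cuts (snd k) * cuts (snd l)) =
     lin (\<lambda>(a, b). basis_vec (fst k, a, b)) (cuts (snd k)) * lin (\<lambda>(a, b). basis_vec (fst l, a, b)) (cuts (snd l))"
    by (rule lin_times2) (simp add: case_prod_unfold mult_single)
  then show "(case k + l of (f, g) \<Rightarrow> lin (\<lambda>(a, b). basis_vec (f, a, b)) (cuts g)) =
    (case k of (f, g) \<Rightarrow> lin (\<lambda>(a, b). basis_vec (f, a, b)) (cuts g)) * (case l of (f, g) \<Rightarrow> lin (\<lambda>(a, b). basis_vec (f, a, b)) (cuts g))"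
    by (simp add: case_prod_unfold)
qed

lemma coassoc: "cop_left (cuts f) = cop_right (cuts f)"
proof (induction f rule: forest_induct)
  case empty
  show ?case by (simp add: cop_left_def cop_right_def)
next
  case (add a C f)
  define J where "J = lin (\<lambda>(x, y, z). basis_vec (x :: 'a forest, y :: 'a forest, {#Node a z#}))"
  have "cop_left (cuts_tree (Node a C)) = basis_vec ({#Node a C#}, {#}, {#}) +
      lin (\<lambda>p. basis_vec (fst p, {#Node a (snd p)#}, {#})) (cuts C) + J (cop_left (cuts C))"
    by (simp add: cop_left_def J_def lin_add lin_lin case_prod_unfold)
  moreover have "cop_right (cuts_tree (Node a C)) = basis_vec ({#Node a C#}, {#}, {#}) +
      lin (\<lambda>p. basis_vec (fst p, {#Node a (snd p)#}, {#})) (cuts C) + J (cop_right (cuts C))"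
    by (simp add: cop_right_def J_def lin_add lin_lin case_prod_unfold lin_plus_fun)
  ultimately have "cop_left (cuts_tree (Node a C)) = cop_right (cuts_tree (Node a C))"
    using add.IH(1) by simp
  with add.IH(2) show ?case
    by (simp add: cop_left_times cop_right_times del: cuts_tree.simps)
qed

lemma gl_basis: "basis_vec f \<star> basis_vec g = gl_forest f g"
  by (simp add: gl_product_def)

lemma linear_gl_left: "linear (\<lambda>x. x \<star> y)"
  unfolding gl_product_def by (rule linear_lin)

lemma gl_product_swap: "x \<star> y = lin (\<lambda>g. lin (\<lambda>f. gl_forest f g) x) y"
  unfolding gl_product_def by (rule lin_swap)

lemma linear_gl_right: "linear (\<lambda>y. x \<star> y)"
  unfolding gl_product_swap by (rule linear_lin)

lemma gl_forest_assoc: "gl_forest x y \<star> basis_vec z = basis_vec x \<star> gl_forest y z"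
proof (rule lin_fp_ext)
  fix f
  let ?T = "lin (\<lambda>(a, b, c). fp a x * fp b y * fp c z)"
  have "lin (fp f) (gl_forest x y \<star> basis_vec z) = lin (\<lambda>w. pair2 (cuts f) w z) (gl_forest x y)"
    by (simp add: gl_product_def lin_lin duality)
  also have "\<dots> = lin (\<lambda>p. lin (fp (fst p)) (gl_forest x y) * fp (snd p) z) (cuts f)"
    by (simp add: pair2_def case_prod_unfold lin_mult_real) (rule lin_swap)
  also have "\<dots> = ?T (cop_left (cuts f))"
    by (simp add: duality pair2_def cop_left_def lin_lin case_prod_unfold lin_mult_real)
  finally have 1: "lin (fp f) (gl_forest x y \<star> basis_vec z) = ?T (cop_left (cuts f))" .
  have "lin (fp f) (basis_vec x \<star> gl_forest y z) = lin (\<lambda>w. pair2 (cuts f) x w) (gl_forest y z)"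
    by (simp add: gl_product_def lin_lin duality)
  also have "\<dots> = lin (\<lambda>p. fp (fst p) x * lin (fp (snd p)) (gl_forest y z)) (cuts f)"
    by (simp add: pair2_def case_prod_unfold mult_lin_real) (rule lin_swap)
  also have "\<dots> = ?T (cop_right (cuts f))"
    by (simp add: duality pair2_def cop_right_def lin_lin case_prod_unfold mult_lin_real mult.assoc)
  finally show "lin (fp f) (gl_forest x y \<star> basis_vec z) = lin (fp f) (basis_vec x \<star> gl_forest y z)"
    by (simp add: 1 coassoc)
qed

lemma gl_assoc: "(x \<star> y) \<star> z = x \<star> (y \<star> z)"
proof -
  have "(x \<star> y) \<star> z = lin (\<lambda>c. (x \<star> y) \<star> basis_vec c) z"
    by (rule linear_ext_lin[OF linear_gl_right])
  also have "\<dots> = lin (\<lambda>c. lin (\<lambda>a. lin (\<lambda>b. gl_forest a b \<star> basis_vec c) y) x) z"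
    unfolding gl_product_def[of x y]
    by (simp add: linear_of_lin[OF linear_gl_left])
  also have "\<dots> = lin (\<lambda>a. lin (\<lambda>c. lin (\<lambda>b. basis_vec a \<star> gl_forest b c) y) z) x"
    by (subst lin_swap) (simp add: gl_forest_assoc)
  also have "\<dots> = lin (\<lambda>a. basis_vec a \<star> (y \<star> z)) x"
    unfolding gl_product_swap[of y z]
    by (simp add: linear_of_lin[OF linear_gl_right])
  also have "\<dots> = x \<star> (y \<star> z)"
    by (rule linear_ext_lin[OF linear_gl_left, symmetric])
  finally show ?thesis .
qed

lemma gl_one_right: "x \<star> 1 = x"
  by (simp add: gl_product_def gl_forest_empty_right poly_mapping_decomp[symmetric])

lemma gl_forest_empty_left: "gl_forest {#} g = basis_vec g"
proof (induction g rule: forest_induct)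
  case (add a C g)
  then show ?case
    by (simp add: gl_forest_add_mset graft_tree_Node add_root_def mult_single del: graft_tree.simps)
qed (simp add: gl_forest_empty_right)

lemma gl_one_left: "1 \<star> x = (x :: 'a forests)"
proof -
  have "gl_forest ({#} :: 'a forest) = basis_vec"
    by (rule ext) (rule gl_forest_empty_left)
  then show ?thesis
    by (simp add: gl_product_def poly_mapping_decomp[symmetric])
qed

section \<open>Grading by weight\<close>

lemma weight_empty [simp]: "weight {#} = 0"
  by (simp add: weight_def)

lemma weight_add_mset [simp]: "weight (add_mset t f) = tree_weight t + weight f"
  by (simp add: weight_def)

lemma weight_union [simp]: "weight (f + g) = weight f + weight g"
  by (simp add: weight_def)

lemma tree_weight_Node: "tree_weight (Node a C) = Suc (weight C)"
  by (simp add: weight_def)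

lemma tree_weight_pos: "0 < tree_weight t"
  by (cases t) simp

lemma weight_eq_0 [simp]: "weight f = 0 \<longleftrightarrow> f = {#}"
  using tree_weight_pos by (cases f) auto

lemma size_le_weight: "size f \<le> weight f"
proof (induction f)
  case (add t f)
  then show ?case using tree_weight_pos[of t] by simp
qed simp

lemma finite_forests_weight: "finite {f :: 'a::finite forest. weight f \<le> n}"
proof (induction n)
  case 0
  have "{f :: 'a forest. weight f \<le> 0} = {{#}}" by auto
  then show ?case by simp
next
  case (Suc n)
  let ?T = "(\<lambda>(a, C). Node a C) ` (UNIV \<times> {f :: 'a forest. weight f \<le> n})"
  have fin: "finite ?T" using Suc by simp
  have "{f :: 'a forest. weight f \<le> Suc n} \<subseteq> mset ` {xs. set xs \<subseteq> ?T \<and> length xs \<le> Suc n}"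
  proof
    fix f :: "'a forest" assume "f \<in> {f. weight f \<le> Suc n}"
    then have f: "weight f \<le> Suc n" by simp
    obtain xs where xs: "mset xs = f" by (metis ex_mset)
    have "set xs \<subseteq> ?T"
    proof
      fix t assume "t \<in> set xs"
      then obtain g where g: "f = add_mset t g"
        using xs by (metis multi_member_split set_mset_mset)
      obtain a C where t: "t = Node a C" by (cases t)
      have "weight C \<le> n" using f by (simp add: g t tree_weight_Node del: tree_weight.simps)
      then show "t \<in> ?T" by (auto simp: t)
    qed
    moreover have "length xs \<le> Suc n"
      using f size_le_weight[of f] by (simp flip: xs)
    ultimately show "f \<in> mset ` {xs. set xs \<subseteq> ?T \<and> length xs \<le> Suc n}"
      using xs by blast
  qed
  then show ?case
    using finite_lists_length_le[OF fin] by (meson finite_imageI finite_subset)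
qed

lemma keys_lin: "k \<in> supp (lin \<phi> x) \<Longrightarrow> \<exists>l\<in>supp x. k \<in> supp (\<phi> l)"
proof (rule ccontr)
  assume k: "k \<in> supp (lin \<phi> x)" and "\<not> (\<exists>l\<in>supp x. k \<in> supp (\<phi> l))"
  then have "coef (lin \<phi> x) k = 0"
    by (simp add: lin_def lookup_sum in_keys_iff)
  with k show False by (simp add: in_keys_iff)
qed

definition hom2 :: "nat \<Rightarrow> 'a forests2 \<Rightarrow> bool" where
  "hom2 n z \<longleftrightarrow> (\<forall>k\<in>supp z. weight (fst k) + weight (snd k) = n)"

lemma hom2_times: "hom2 m x \<Longrightarrow> hom2 n y \<Longrightarrow> hom2 (m + n) (x * y)"
  unfolding hom2_def using keys_mult[of x y] by fastforce

lemma hom2_cuts: "hom2 (weight f) (cuts f)"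
proof (induction f rule: forest_induct)
  case empty
  then show ?case by (simp add: hom2_def zero_prod_def)
next
  case (add a C f)
  have "hom2 (tree_weight (Node a C)) (cuts_tree (Node a C))"
    unfolding hom2_def
  proof
    fix k assume "k \<in> supp (cuts_tree (Node a C))"
    then consider "k = ({#Node a C#}, {#})" | "k \<in> supp (lin (\<lambda>(f, g). basis_vec (f, {#Node a g#})) (cuts C))"
      using keys_add[of "basis_vec ({#Node a C#}, {#})" "lin (\<lambda>(f, g). basis_vec (f, {#Node a g#})) (cuts C)"] by auto
    then show "weight (fst k) + weight (snd k) = tree_weight (Node a C)"
    proof cases
      case 2
      from keys_lin[OF this] obtain l where "l \<in> supp (cuts C)" "k = (fst l, {#Node a (snd l)#})"
        by (auto simp: case_prod_unfold)
      with add.IH(1) show ?thesis by (simp add: hom2_def tree_weight_Node del: tree_weight.simps)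
    qed simp
  qed
  from hom2_times[OF this add.IH(2)] show ?case by simp
qed

text \<open>By duality, the grading of the product is inherited from that of the coproduct.\<close>

lemma keys_gl_forest: "k \<in> supp (gl_forest h g) \<Longrightarrow> weight k = weight h + weight g"
proof -
  assume "k \<in> supp (gl_forest h g)"
  then have "lin (fp k) (gl_forest h g) \<noteq> 0"
    using fp_pos[of k] by (simp add: lin_fp in_keys_iff)
  then have "(h, g) \<in> supp (cuts k)"
    by (simp add: duality pair2_lookup in_keys_iff)
  then show ?thesis
    using hom2_cuts[of k] by (auto simp: hom2_def)
qed

lemma keys_gl: "k \<in> supp (x \<star> y) \<Longrightarrow>
  \<exists>f\<in>supp x. \<exists>g\<in>supp y. weight k = weight f + weight g"
proof -
  assume "k \<in> supp (x \<star> y)"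
  then obtain f where f: "f \<in> supp x" "k \<in> supp (lin (gl_forest f) y)"
    unfolding gl_product_def using keys_lin[of k _ x] by blast
  from keys_lin[OF f(2)] obtain g where "g \<in> supp y" "k \<in> supp (gl_forest f g)"
    by blast
  with f(1) show ?thesis using keys_gl_forest[of k f g] by blast
qed

lemma gl_graded: "x \<in> graded a \<Longrightarrow> y \<in> graded b \<Longrightarrow> x \<star> y \<in> graded (a + b)"
  unfolding graded_def by (auto dest!: keys_gl)

lemma subspace_graded: "subspace (graded n)"
  unfolding subspace_def graded_def
proof safe
  fix x y :: "'a forests" and f
  assume "\<forall>f\<in>supp x. weight f = n" "\<forall>f\<in>supp y. weight f = n" "f \<in> supp (x + y)"
  then show "weight f = n" using keys_add[of x y] by auto
qed (auto simp: in_keys_iff)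

lemma graded_basis: "basis_vec f \<in> graded (weight f)"
  by (simp add: graded_def)

lemma graded_one: "1 \<in> graded 0"
  unfolding one_forests using graded_basis[of "{#}"] by simp

lemma graded_nonempty: "x \<in> graded n \<Longrightarrow> 0 < n \<Longrightarrow> x \<in> nonempty_span"
  unfolding graded_def nonempty_span_def using weight_empty by (force simp: in_keys_iff)

definition wproj :: "nat \<Rightarrow> 'a forests \<Rightarrow> 'a forests" where
  "wproj n = lin (\<lambda>f. if weight f = n then basis_vec f else 0)"

lemma wproj_graded: "wproj n x \<in> graded n"
  unfolding graded_def wproj_def
  by (auto dest!: keys_lin split: if_splits)

lemma wproj_sum: "(\<And>f. f \<in> supp x \<Longrightarrow> weight f \<le> M) \<Longrightarrow> x = (\<Sum>n\<le>M. wproj n x)"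
proof -
  assume M: "\<And>f. f \<in> supp x \<Longrightarrow> weight f \<le> M"
  have "(\<Sum>n\<le>M. wproj n x) = lin (\<lambda>f. \<Sum>n\<le>M. if weight f = n then basis_vec f else 0) x"
    unfolding wproj_def by (rule lin_sum_fun[symmetric])
  also have "\<dots> = lin basis_vec x"
    by (rule lin_cong) (simp add: M)
  finally show ?thesis by (simp add: poly_mapping_decomp[symmetric])
qed

lemma wproj_decomp: "\<exists>M. x = (\<Sum>n\<le>M. wproj n x)"
proof -
  obtain M where "\<forall>k\<in>weight ` supp x. k \<le> M"
    using finite_nat_set_iff_bounded_le[of "weight ` supp x"] by auto
  then have "x = (\<Sum>n\<le>M. wproj n x)" by (intro wproj_sum) blast
  then show ?thesis by (rule exI)
qed

lemma wproj_0: "x \<in> nonempty_span \<Longrightarrow> wproj 0 x = 0"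
proof -
  assume x: "x \<in> nonempty_span"
  have "wproj 0 x = lin (\<lambda>f. if f = {#} then basis_vec {#} else 0) x"
    unfolding wproj_def by (rule lin_cong) simp
  with x show ?thesis
    by (simp add: lin_delta nonempty_span_def)
qed

section \<open>The coproduct and natural growth\<close>

lemma lin_tensor: "lin \<phi> (tensor x y) = lin (\<lambda>f. lin (\<lambda>g. \<phi> (f, g)) y) x"
  by (simp add: tensor_def lin_lin)

lemma linear_tensor_left: "linear (\<lambda>x. tensor x y)"
  unfolding tensor_def by (rule linear_lin)

lemma tensor_swap: "tensor x y = lin (\<lambda>g. lin (\<lambda>f. basis_vec (f, g)) x) y"
  unfolding tensor_def by (rule lin_swap)

lemma linear_tensor_right: "linear (\<lambda>y. tensor x y)"
  unfolding tensor_swap by (rule linear_lin)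

lemma tensor_basis: "tensor (basis_vec f) (basis_vec g) = basis_vec (f, g)"
  by (simp add: tensor_def)

lemma tensor_times: "tensor (x * x') (y * y') = tensor x y * tensor x' y'"
proof -
  have "tensor (x * x') (y * y') = lin (\<lambda>k. lin (\<lambda>l. lin (\<lambda>g. lin (\<lambda>h. basis_vec (k, g) * basis_vec (l, h)) y') y) x') x"
    by (simp add: tensor_def lin_times_double mult_single)
  also have "\<dots> = lin (\<lambda>k. lin (\<lambda>g. lin (\<lambda>l. lin (\<lambda>h. basis_vec (k, g) * basis_vec (l, h)) y') x') y) x"
    by (subst lin_swap) (rule refl)
  also have "\<dots> = lin (\<lambda>k. lin (\<lambda>g. basis_vec (k, g) * tensor x' y') y) x"
    unfolding tensor_def times_lin ..
  also have "\<dots> = tensor x y * tensor x' y'"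
    unfolding tensor_def[of x y] lin_times ..
  finally show ?thesis .
qed

lemma coproduct_CK_basis: "coproduct_CK (basis_vec f) = cuts f"
  by (simp add: coproduct_CK_def)

lemma linear_coproduct_CK: "linear coproduct_CK"
  unfolding coproduct_CK_def by (rule linear_lin)

lemma coproduct_CK_times: "coproduct_CK (x * y) = coproduct_CK x * coproduct_CK y"
  unfolding coproduct_CK_def by (rule lin_times2) simp

lemma add_root_basis: "add_root a (basis_vec f) = basis_vec {#Node a f#}"
  by (simp add: add_root_def)

lemma linear_add_root: "linear (add_root a)"
  unfolding add_root_def by (rule linear_lin)

definition right_root :: "'a \<Rightarrow> 'a forests2 \<Rightarrow> 'a forests2" where
  "right_root a = lin (\<lambda>(f, g). basis_vec (f, {#Node a g#}))"

lemma linear_right_root: "linear (right_root a)"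
  unfolding right_root_def by (rule linear_lin)

lemma right_root_tensor: "right_root a (tensor x y) = tensor x (add_root a y)"
  by (simp add: right_root_def tensor_def add_root_def lin_lin)

lemma coproduct_add_root:
  "coproduct_CK (add_root a x) = tensor (add_root a x) 1 + right_root a (coproduct_CK x)"
proof -
  have "coproduct_CK (add_root a x) = lin (\<lambda>f. basis_vec ({#Node a f#}, {#}) + right_root a (cuts f)) x"
    by (simp add: coproduct_CK_def add_root_def lin_lin right_root_def)
  then show ?thesis
    by (simp add: lin_plus_fun tensor_def add_root_def lin_lin coproduct_CK_def linear_of_lin[OF linear_right_root])
qed

lemma graft_all_tree_Node:
  "graft_all_tree f (Node a C) = add_root a (basis_vec (f + C) + graft_all f C)"
  by (simp add: graft_all_def linear_add[OF linear_add_root] add_root_basis)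

lemma graft_all_empty: "graft_all f {#} = 0"
  by (simp add: graft_all_def)

lemma graft_all_add_mset:
  "graft_all f (add_mset t g) = graft_all_tree f t * basis_vec g + basis_vec {#t#} * graft_all f g"
proof -
  have "(\<Sum>s\<in>#g. graft_all_tree f s * basis_vec (add_mset t g - {#s#}))
     = (\<Sum>s\<in>#g. basis_vec {#t#} * (graft_all_tree f s * basis_vec (g - {#s#})))"
  proof (intro sum_mset_cong)
    fix s assume "s \<in># g"
    then obtain h where h: "g = add_mset s h" by (metis multi_member_split)
    have "add_mset t g - {#s#} = {#t#} + (g - {#s#})"
      by (simp add: h add_mset_commute[of t])
    then have "basis_vec (add_mset t g - {#s#}) = (basis_vec {#t#} * basis_vec (g - {#s#}) :: 'a forests)"
      by (simp only: mult_single) simp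
    then show "graft_all_tree f s * basis_vec (add_mset t g - {#s#}) = basis_vec {#t#} * (graft_all_tree f s * basis_vec (g - {#s#}))"
      by (simp add: mult.left_commute)
  qed
  then show ?thesis
    by (simp add: graft_all_def sum_mset_distrib_left)
qed

lemma graft_all_single: "graft_all f {#t#} = graft_all_tree f t"
  unfolding graft_all_add_mset by (simp add: graft_all_empty)

lemma graft_all_union: "graft_all f (g + h) = graft_all f g * basis_vec h + basis_vec g * graft_all f h"
proof (induction g)
  case empty
  then show ?case by (simp add: graft_all_empty)
next
  case (add t g)
  have 1: "basis_vec (g + h) = (basis_vec g * basis_vec h :: 'a forests)"
    by (simp add: mult_single)
  have 2: "basis_vec (add_mset t g) = (basis_vec {#t#} * basis_vec g :: 'a forests)"
    by (simp add: mult_single)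
  have "graft_all f (add_mset t g + h) = graft_all_tree f t * basis_vec (g + h) + basis_vec {#t#} * graft_all f (g + h)"
    by (simp add: graft_all_add_mset)
  then show ?case
    by (simp only: add.IH 1 2 graft_all_add_mset) (simp add: algebra_simps)
qed

text \<open>
  For fixed \<open>f\<close>, the map \<open>graft_all f\<close> is a derivation of the algebra of forests.  Cutting a forest
  after \<open>f\<close> has been grafted onto one of its vertices, there are two cases: if the vertex is cut
  off, all of \<open>f\<close> is cut off with it, and otherwise an independent cut of \<open>f\<close> leaves its lower part
  grafted onto the lower part of the forest.  The sum of both is a derivation of the tensor square,
  so that the resulting formula \<open>coproduct_graft_all\<close> follows from its case of a single tree.
\<close>

definition coderiv :: "'a forest \<Rightarrow> ('a forest \<times> 'a forest) \<Rightarrow> 'a forests2" where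
  "coderiv f p = tensor (graft_all f (fst p)) (basis_vec (snd p)) +
     lin (\<lambda>k. tensor (basis_vec (fst k + fst p)) (graft_all (snd k) (snd p))) (cuts f)"

lemma coderiv_plus: "coderiv f (p + q) = coderiv f p * basis_vec q + basis_vec p * coderiv f q"
proof -
  have A: "tensor (graft_all f (fst (p + q))) (basis_vec (snd (p + q)))
     = tensor (graft_all f (fst p)) (basis_vec (snd p)) * basis_vec q + basis_vec p * tensor (graft_all f (fst q)) (basis_vec (snd q))"
  proof -
    have "tensor (graft_all f (fst (p + q))) (basis_vec (snd (p + q)))
       = tensor (graft_all f (fst p) * basis_vec (fst q)) (basis_vec (snd p) * basis_vec (snd q))
       + tensor (basis_vec (fst p) * graft_all f (fst q)) (basis_vec (snd p) * basis_vec (snd q))"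
      by (simp add: graft_all_union linear_add[OF linear_tensor_left] mult_single)
    then show ?thesis
      by (simp add: tensor_times tensor_basis)
  qed
  have B: "tensor (basis_vec (fst k + fst (p + q))) (graft_all (snd k) (snd (p + q)))
     = tensor (basis_vec (fst k + fst p)) (graft_all (snd k) (snd p)) * basis_vec q
     + basis_vec p * tensor (basis_vec (fst k + fst q)) (graft_all (snd k) (snd q))" for k :: "'a forest \<times> 'a forest"
  proof -
    have "tensor (basis_vec (fst k + fst (p + q))) (graft_all (snd k) (snd (p + q)))
       = tensor (basis_vec (fst k + fst p) * basis_vec (fst q)) (graft_all (snd k) (snd p) * basis_vec (snd q))
       + tensor (basis_vec (fst p) * basis_vec (fst k + fst q)) (basis_vec (snd p) * graft_all (snd k) (snd q))"
      by (simp add: graft_all_union linear_add[OF linear_tensor_right] mult_single add_ac)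
    then show ?thesis
      by (simp add: tensor_times tensor_basis)
  qed
  show ?thesis
    unfolding coderiv_def A B lin_plus_fun lin_times[symmetric] times_lin[symmetric]
    by (simp add: distrib_left distrib_right)
qed

lemma coderiv_times: "lin (coderiv f) (x * y) = lin (coderiv f) x * y + x * lin (coderiv f) y"
proof -
  have 1: "lin (\<lambda>k. lin (\<lambda>l. coderiv f k * basis_vec l) y) x = lin (coderiv f) x * y"
    unfolding lin_times by (simp only: linear_ext_lin[OF linear_times_right, symmetric])
  have 2: "lin (\<lambda>k. lin (\<lambda>l. basis_vec k * coderiv f l) y) x = x * lin (coderiv f) y"
    unfolding times_lin[symmetric] by (rule linear_ext_lin[OF linear_times_left, symmetric])
  show ?thesis
    by (simp add: lin_times_double coderiv_plus lin_plus_fun 1 2)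
qed

theorem coproduct_graft_all: "coproduct_CK (graft_all f g) = lin (coderiv f) (cuts g)"
proof (induction g rule: forest_induct)
  case empty
  have "tensor 0 x = 0" "tensor x 0 = 0" for x :: "'a forests"
    by (rule linear_0[OF linear_tensor_left] linear_0[OF linear_tensor_right])+
  then show ?case
    by (simp add: graft_all_empty coderiv_def linear_0[OF linear_coproduct_CK])
next
  case (add a C g)
  have zero: "tensor x 0 = 0" for x :: "'a forests"
    by (rule linear_0[OF linear_tensor_right])
  have "coproduct_CK (graft_all_tree f (Node a C))
     = tensor (graft_all_tree f (Node a C)) 1 + right_root a (cuts f * cuts C + lin (coderiv f) (cuts C))"
    unfolding graft_all_tree_Node coproduct_add_root
    by (simp add: linear_add[OF linear_coproduct_CK] add.IH(1) coproduct_CK_basis)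
  also have "right_root a (cuts f * cuts C + lin (coderiv f) (cuts C)) =
     lin (\<lambda>p. lin (\<lambda>k. basis_vec (fst k + fst p, {#Node a (snd k + snd p)#})) (cuts f) + right_root a (coderiv f p)) (cuts C)"
  proof -
    have "right_root a (cuts f * cuts C) = lin (\<lambda>p. lin (\<lambda>k. basis_vec (fst k + fst p, {#Node a (snd k + snd p)#})) (cuts f)) (cuts C)"
      unfolding right_root_def lin_times_double by (subst lin_swap) (simp add: case_prod_unfold)
    then show ?thesis
      by (simp add: linear_add[OF linear_right_root] lin_plus_fun linear_of_lin[OF linear_right_root])
  qed
  also have "\<dots> = lin (\<lambda>p. coderiv f (fst p, {#Node a (snd p)#})) (cuts C)"
  proof (rule arg_cong[where f = "\<lambda>\<phi>. lin \<phi> (cuts C)"], rule ext)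
    fix p :: "'a forest \<times> 'a forest"
    have "coderiv f (fst p, {#Node a (snd p)#}) = tensor (graft_all f (fst p)) (add_root a (basis_vec (snd p))) +
       lin (\<lambda>k. tensor (basis_vec (fst k + fst p)) (add_root a (basis_vec (snd k + snd p) + graft_all (snd k) (snd p)))) (cuts f)"
      by (simp add: coderiv_def graft_all_single graft_all_tree_Node add_root_basis del: graft_all_tree.simps)
    also have "\<dots> = lin (\<lambda>k. basis_vec (fst k + fst p, {#Node a (snd k + snd p)#})) (cuts f) + right_root a (coderiv f p)"
      by (simp add: coderiv_def linear_add[OF linear_right_root] linear_of_lin[OF linear_right_root]
          right_root_tensor linear_add[OF linear_add_root] linear_add[OF linear_tensor_right] lin_plus_fun add_root_basis tensor_basis)
    finally show "lin (\<lambda>k. basis_vec (fst k + fst p, {#Node a (snd k + snd p)#})) (cuts f) + right_root a (coderiv f p)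
       = coderiv f (fst p, {#Node a (snd p)#})" by simp
  qed
  also have "tensor (graft_all_tree f (Node a C)) 1 = coderiv f ({#Node a C#}, {#})"
    by (simp add: coderiv_def graft_all_single graft_all_empty zero del: graft_all_tree.simps)
  finally have tree: "coproduct_CK (graft_all_tree f (Node a C)) = lin (coderiv f) (cuts_tree (Node a C))"
    by (simp add: lin_add lin_lin case_prod_unfold)
  have "coproduct_CK (basis_vec {#Node a C#}) = cuts_tree (Node a C)"
    unfolding coproduct_CK_basis by (simp del: cuts_tree.simps)
  with tree add.IH(2) show ?case
    by (simp add: graft_all_add_mset linear_add[OF linear_coproduct_CK] coproduct_CK_times coderiv_times coproduct_CK_basis
        del: cuts_tree.simps graft_all_tree.simps)
qed

section \<open>Growth of primitive elements\<close>

lemma graft_all_empty_left: "graft_all {#} g = real (weight g) *\<^sub>R basis_vec g"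
proof (induction g rule: forest_induct)
  case empty
  then show ?case by (simp add: graft_all_empty)
next
  case (add a C g)
  have "graft_all_tree {#} (Node a C) = real (tree_weight (Node a C)) *\<^sub>R basis_vec {#Node a C#}"
    by (simp add: graft_all_tree_Node tree_weight_Node add.IH(1) linear_add[OF linear_add_root]
        linear_cmul[OF linear_add_root] add_root_basis scaleR_left_distrib
        del: graft_all_tree.simps tree_weight.simps)
  moreover have "basis_vec {#Node a C#} * basis_vec g = (basis_vec (add_mset (Node a C) g) :: 'a forests)"
    by (simp add: mult_single)
  ultimately show ?case
    by (simp add: graft_all_add_mset add.IH(2) forests_scaleR_left forests_scaleR_right scaleR_left_distrib
        del: graft_all_tree.simps tree_weight.simps)
qed

text \<open>
  Natural growth divides by the weight of the right factor.  Moving this division into the right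
  factor expresses it by the derivations \<open>graft_all f\<close>.
\<close>

definition wdiv :: "'a forests \<Rightarrow> 'a forests" where
  "wdiv = lin (\<lambda>g. (1 / real (weight g)) *\<^sub>R basis_vec g)"

lemma linear_ng_left: "linear (\<lambda>x. natural_growth x y)"
  unfolding natural_growth_def by (rule linear_lin)

lemma natural_growth_swap:
  "natural_growth x y = lin (\<lambda>g. lin (\<lambda>f. natural_growth (basis_vec f) (basis_vec g)) x) y"
  unfolding natural_growth_def by (subst lin_swap) simp

lemma linear_ng_right: "linear (\<lambda>y. natural_growth x y)"
  unfolding natural_growth_swap[of x] by (rule linear_lin)

lemma natural_growth_graft:
  assumes "y \<in> nonempty_span"
  shows "natural_growth x y = lin (\<lambda>f. lin (graft_all f) (wdiv y)) x"
proof -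
  have ne: "g \<noteq> {#}" if "g \<in> supp y" for g
    using assms that by (auto simp: nonempty_span_def in_keys_iff)
  have "lin (\<lambda>g. if f = {#} then basis_vec g else if g = {#} then basis_vec f
     else (1 / real (weight g)) *\<^sub>R graft_all f g) y = lin (graft_all f) (wdiv y)" for f
    unfolding wdiv_def lin_lin
    by (intro lin_cong) (use ne in \<open>auto simp: lin_scaleR graft_all_empty_left\<close>)
  then show ?thesis
    by (simp add: natural_growth_def)
qed

lemma natural_growth_one_left: "natural_growth 1 y = y"
  by (simp add: natural_growth_def flip: poly_mapping_decomp)

lemma lin_cuts_weight:
  "lin (\<lambda>k. c (weight (fst k) + weight (snd k)) *\<^sub>R basis_vec k) (cuts f) = c (weight f) *\<^sub>R cuts f"
proof -
  have "lin (\<lambda>k. c (weight (fst k) + weight (snd k)) *\<^sub>R basis_vec k) (cuts f) = lin (\<lambda>k. c (weight f) *\<^sub>R basis_vec k) (cuts f)"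
    using hom2_cuts[of f] by (intro lin_cong) (simp add: hom2_def)
  then show ?thesis
    by (simp add: lin_scaleR_fun flip: poly_mapping_decomp)
qed

text \<open>The coproduct is graded, so operators that depend on the weight alone preserve primitivity.\<close>

lemma primitive_weight_scale:
  assumes p: "p \<in> primitives"
  shows "lin (\<lambda>f. c (weight f) *\<^sub>R basis_vec f) p \<in> primitives"
proof -
  let ?S = "lin (\<lambda>f. c (weight f) *\<^sub>R basis_vec f) :: 'a forests \<Rightarrow> 'a forests"
  let ?S2 = "lin (\<lambda>k. c (weight (fst k) + weight (snd k)) *\<^sub>R basis_vec k) :: 'a forests2 \<Rightarrow> 'a forests2"
  have cp: "coproduct_CK p = tensor p 1 + tensor 1 p" and ne: "coef p {#} = 0"
    using p by (auto simp: primitives_def nonempty_span_def)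
  have "coproduct_CK (?S p) = lin (\<lambda>f. c (weight f) *\<^sub>R cuts f) p"
    by (simp add: linear_of_lin[OF linear_coproduct_CK] linear_cmul[OF linear_coproduct_CK] coproduct_CK_basis)
  also have "\<dots> = ?S2 (coproduct_CK p)"
    by (simp add: coproduct_CK_def lin_lin lin_cuts_weight)
  also have "\<dots> = tensor (?S p) 1 + tensor 1 (?S p)"
  proof -
    have "?S2 (tensor p 1) = lin (\<lambda>f. c (weight f) *\<^sub>R tensor (basis_vec f) 1) p"
      by (simp add: lin_tensor) (simp add: tensor_def)
    then have 1: "?S2 (tensor p 1) = tensor (?S p) 1"
      by (simp add: linear_of_lin[OF linear_tensor_left] linear_cmul[OF linear_tensor_left])
    have "?S2 (tensor 1 p) = lin (\<lambda>f. c (weight f) *\<^sub>R tensor 1 (basis_vec f)) p"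
      by (simp add: lin_tensor) (simp add: tensor_def)
    then have 2: "?S2 (tensor 1 p) = tensor 1 (?S p)"
      by (simp add: linear_of_lin[OF linear_tensor_right] linear_cmul[OF linear_tensor_right])
    show ?thesis by (simp add: cp lin_add 1 2)
  qed
  finally have "coproduct_CK (?S p) = tensor (?S p) 1 + tensor 1 (?S p)" .
  moreover have "coef (?S p) {#} = 0"
  proof (rule ccontr)
    assume "coef (?S p) {#} \<noteq> 0"
    then have "{#} \<in> supp (?S p)" by (simp add: in_keys_iff)
    then obtain f where f: "f \<in> supp p" "{#} \<in> supp (c (weight f) *\<^sub>R basis_vec f :: 'a forests)"
      by (auto dest!: keys_lin)
    then have "f = {#}" by (auto simp: in_keys_iff lookup_single when_def split: if_splits)
    with f ne show False by (simp add: in_keys_iff)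
  qed
  ultimately show ?thesis by (simp add: primitives_def nonempty_span_def)
qed

lemma wproj_primitive: "p \<in> primitives \<Longrightarrow> wproj n p \<in> primitives"
proof -
  assume "p \<in> primitives"
  from primitive_weight_scale[OF this, of "\<lambda>m. if m = n then 1 else 0"]
  have "lin (\<lambda>f. (if weight f = n then 1 else 0) *\<^sub>R basis_vec f) p \<in> primitives" .
  also have "lin (\<lambda>f. (if weight f = n then 1 else 0) *\<^sub>R basis_vec f) p = wproj n p"
    unfolding wproj_def by (rule lin_cong) simp
  finally show ?thesis .
qed

lemma wdiv_primitive: "p \<in> primitives \<Longrightarrow> wdiv p \<in> primitives"
  unfolding wdiv_def by (rule primitive_weight_scale[of p "\<lambda>n. 1 / real n"])

text \<open>
  If \<open>p\<close> is primitive, the cuts of \<open>u \<top> p\<close> that cut \<open>p\<close> properly cancel.  The others cut off everything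
  or cut only \<open>u\<close>.  Hence iterated growth of primitive elements has the deconcatenation coproduct.
\<close>

theorem coproduct_natural_growth:
  assumes p: "p \<in> primitives"
  shows "coproduct_CK (natural_growth u p) = tensor (natural_growth u p) 1 +
     lin (\<lambda>k. tensor (basis_vec (fst k)) (natural_growth (basis_vec (snd k)) p)) (coproduct_CK u)"
proof -
  let ?p = "wdiv p"
  have ne: "p \<in> nonempty_span" using p by (simp add: primitives_def)
  have cp: "coproduct_CK ?p = tensor ?p 1 + tensor 1 ?p"
    using wdiv_primitive[OF p] by (simp add: primitives_def)
  have ng: "natural_growth (basis_vec d) p = lin (graft_all d) ?p" for d
    by (simp add: natural_growth_graft[OF ne])
  have zero: "tensor x 0 = 0" for x :: "'a forests"
    by (rule linear_0[OF linear_tensor_right])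
  have A: "coproduct_CK (natural_growth (basis_vec f) p) =
     tensor (natural_growth (basis_vec f) p) 1 +
     lin (\<lambda>k. tensor (basis_vec (fst k)) (natural_growth (basis_vec (snd k)) p)) (cuts f)" for f
  proof -
    have "coproduct_CK (natural_growth (basis_vec f) p) = lin (\<lambda>g. lin (coderiv f) (cuts g)) ?p"
      by (simp add: ng linear_of_lin[OF linear_coproduct_CK] coproduct_graft_all)
    also have "\<dots> = lin (coderiv f) (coproduct_CK ?p)"
      by (simp add: coproduct_CK_def lin_lin)
    also have "\<dots> = lin (\<lambda>g. coderiv f (g, {#})) ?p + lin (\<lambda>g. coderiv f ({#}, g)) ?p"
      by (simp add: cp lin_add lin_tensor)
    also have "lin (\<lambda>g. coderiv f (g, {#})) ?p = tensor (natural_growth (basis_vec f) p) 1"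
      by (simp add: coderiv_def graft_all_empty zero ng linear_of_lin[OF linear_tensor_left])
    also have "lin (\<lambda>g. coderiv f ({#}, g)) ?p =
       lin (\<lambda>g. tensor (graft_all f {#}) (basis_vec g)) ?p +
       lin (\<lambda>g. lin (\<lambda>k. tensor (basis_vec (fst k)) (graft_all (snd k) g)) (cuts f)) ?p"
      by (simp add: coderiv_def lin_plus_fun)
    also have "lin (\<lambda>g. lin (\<lambda>k. tensor (basis_vec (fst k)) (graft_all (snd k) g)) (cuts f)) ?p
       = lin (\<lambda>k. tensor (basis_vec (fst k)) (natural_growth (basis_vec (snd k)) p)) (cuts f)"
      by (subst lin_swap) (simp add: ng linear_of_lin[OF linear_tensor_right])
    also have "lin (\<lambda>g. tensor (graft_all f {#}) (basis_vec g)) ?p = 0"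
      by (simp add: graft_all_empty linear_0[OF linear_tensor_left])
    finally show ?thesis by simp
  qed
  have "coproduct_CK (natural_growth u p) = lin (\<lambda>f. coproduct_CK (natural_growth (basis_vec f) p)) u"
    by (subst linear_ext_lin[OF linear_ng_left]) (rule linear_of_lin[OF linear_coproduct_CK])
  also have "\<dots> = lin (\<lambda>f. tensor (natural_growth (basis_vec f) p) 1) u +
     lin (\<lambda>f. lin (\<lambda>k. tensor (basis_vec (fst k)) (natural_growth (basis_vec (snd k)) p)) (cuts f)) u"
    by (simp add: A lin_plus_fun)
  also have "lin (\<lambda>f. tensor (natural_growth (basis_vec f) p) 1) u = tensor (natural_growth u p) 1"
    by (subst (2) linear_ext_lin[OF linear_ng_left]) (rule linear_of_lin[OF linear_tensor_left, symmetric])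
  also have "lin (\<lambda>f. lin (\<lambda>k. tensor (basis_vec (fst k)) (natural_growth (basis_vec (snd k)) p)) (cuts f)) u
     = lin (\<lambda>k. tensor (basis_vec (fst k)) (natural_growth (basis_vec (snd k)) p)) (coproduct_CK u)"
    by (simp add: coproduct_CK_def lin_lin)
  finally show ?thesis .
qed

text \<open>
  The component of the reduced coproduct of \<open>u \<top> p\<close> of highest left weight is \<open>u \<otimes> p\<close>, and this
  tensor determines \<open>u \<top> p\<close>.  In a primitive combination of elements \<open>u \<top> p\<close> those with \<open>u\<close> of
  highest weight therefore cancel; peeling them off weight by weight leaves \<open>0\<close>.
\<close>

definition lproj :: "nat \<Rightarrow> 'a forests2 \<Rightarrow> 'a forests2" where
  "lproj m = lin (\<lambda>k. if weight (fst k) = m then basis_vec k else 0)"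

lemma linear_lproj: "linear (lproj m)"
  unfolding lproj_def by (rule linear_lin)

lemma lproj_tensor_basis: "lproj m (tensor (basis_vec f) y) = (if weight f = m then tensor (basis_vec f) y else 0)"
  by (simp add: lproj_def lin_tensor) (simp add: tensor_def)

lemma cuts_empty_right: "coef (cuts f) (c, {#}) = (if c = f then 1 else 0)"
proof -
  have "pair2 (cuts f) c {#} = fp f c"
    by (simp flip: duality add: gl_forest_empty_right)
  then show ?thesis
    using fp_orthogonal[of f c] fp_pos[of c] by (auto simp: pair2_lookup fp_empty split: if_splits)
qed

lemma lproj_growth:
  assumes u: "u \<in> graded i" and i: "i \<le> m"
  shows "lproj m (lin (\<lambda>k. tensor (basis_vec (fst k)) (natural_growth (basis_vec (snd k)) p)) (coproduct_CK u))
     = (if i = m then tensor u p else 0)"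
proof -
  have A: "lin (\<lambda>k. lproj m (tensor (basis_vec (fst k)) (natural_growth (basis_vec (snd k)) p))) (cuts f)
     = (if i = m then tensor (basis_vec f) p else 0)" if f: "weight f = i" for f
  proof -
    have "lin (\<lambda>k. lproj m (tensor (basis_vec (fst k)) (natural_growth (basis_vec (snd k)) p))) (cuts f)
      = lin (\<lambda>k. if k = (f, {#}) then (if i = m then tensor (basis_vec f) p else 0) else 0) (cuts f)"
    proof (rule lin_cong)
      fix k assume k: "k \<in> supp (cuts f)"
      then have w: "weight (fst k) + weight (snd k) = i"
        using hom2_cuts[of f] f by (simp add: hom2_def)
      show "lproj m (tensor (basis_vec (fst k)) (natural_growth (basis_vec (snd k)) p))
        = (if k = (f, {#}) then (if i = m then tensor (basis_vec f) p else 0) else 0)"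
      proof (cases "snd k = {#}")
        case True
        then have "fst k = f"
          using k cuts_empty_right[of f "fst k"] by (cases k) (auto simp: in_keys_iff split: if_splits)
        with True w show ?thesis
          by (cases k) (auto simp: lproj_tensor_basis natural_growth_one_left)
      next
        case False
        then have "weight (snd k) > 0" by (metis gr0I weight_eq_0)
        then have "weight (fst k) \<noteq> m" using w i by linarith
        with False show ?thesis by (cases k) (auto simp: lproj_tensor_basis)
      qed
    qed
    then show ?thesis
      by (simp add: lin_delta cuts_empty_right)
  qed
  have "lproj m (lin (\<lambda>k. tensor (basis_vec (fst k)) (natural_growth (basis_vec (snd k)) p)) (coproduct_CK u))
     = lin (\<lambda>f. lin (\<lambda>k. lproj m (tensor (basis_vec (fst k)) (natural_growth (basis_vec (snd k)) p))) (cuts f)) u"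
    by (simp add: coproduct_CK_def lin_lin linear_of_lin[OF linear_lproj])
  also have "\<dots> = lin (\<lambda>f. if i = m then tensor (basis_vec f) p else 0) u"
    using u by (intro lin_cong) (simp add: A graded_def)
  also have "\<dots> = (if i = m then tensor u p else 0)"
    by (simp add: linear_ext_lin[OF linear_tensor_left, of u p])
  finally show ?thesis .
qed

definition growths :: "nat \<Rightarrow> 'a forests set" where
  "growths m = span {natural_growth u p | u p i. u \<in> graded i \<and> 1 \<le> i \<and> i \<le> m \<and> p \<in> primitives}"

lemma growths_peel:
  fixes x :: "'a forests"
  assumes "x \<in> growths (Suc m)" and x: "x \<in> primitives"
  shows "x \<in> growths m"
proof -
  (* T recovers u \<top> p from the tensor of u and p. *)
  define T where "T = lin (\<lambda>k. natural_growth (basis_vec (fst k)) (basis_vec (snd k) :: 'a forests))"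
  define R where "R x = lproj (Suc m) (coproduct_CK x - tensor x 1)" for x :: "'a forests"
  have T: "T (tensor u p) = natural_growth u p" for u p
  proof -
    have "T (tensor u p) = lin (\<lambda>f. natural_growth (basis_vec f) p) u"
      by (simp add: T_def lin_tensor flip: linear_ext_lin[OF linear_ng_right])
    then show ?thesis by (simp flip: linear_ext_lin[OF linear_ng_left])
  qed
  have linR: "linear R"
    unfolding R_def using linear_compose[OF linear_compose_sub[OF linear_coproduct_CK linear_tensor_left] linear_lproj]
    by (simp add: o_def)
  have linT: "linear T" unfolding T_def by (rule linear_lin)
  have lin: "linear (\<lambda>x. x - T (R x))"
    using linear_compose_sub[OF linear_id linear_compose[OF linR linT]] by (simp add: o_def id_def)
  have "x - T (R x) \<in> growths m"
    using assms(1)[unfolded growths_def]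
  proof (induction rule: span_induct_alt)
    case base
    then show ?case
      by (simp add: linear_0[OF linR] linear_0[OF linT] growths_def span_zero)
  next
    case (step c y z)
    then obtain u p i where y: "y = natural_growth u p" "u \<in> graded i" "1 \<le> i" "i \<le> Suc m" "p \<in> primitives"
      by auto
    have Ry: "R y = (if i = Suc m then tensor u p else 0)"
      using y by (simp add: R_def coproduct_natural_growth lproj_growth)
    have "y - T (R y) \<in> growths m"
    proof (cases "i = Suc m")
      case True
      then have "y - T (R y) = 0"
        unfolding Ry by (simp add: T y(1))
      then show ?thesis by (simp only: growths_def span_zero)
    next
      case False
      then have "y \<in> growths m"
        unfolding growths_def using y False
          by (intro span_base CollectI exI[of _ u] exI[of _ p] exI[of _ i]) auto
      with False show ?thesis by (simp add: Ry linear_0[OF linT])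
    qed
    then have "c *\<^sub>R (y - T (R y)) + (z - T (R z)) \<in> growths m"
      using step by (auto simp: growths_def intro: span_add span_scale)
    then show ?case
      by (simp only: linear_add[OF lin, of "c *\<^sub>R y" z] linear_cmul[OF lin, of c y])
  qed
  moreover have "R x = 0"
  proof -
    have "coproduct_CK x - tensor x 1 = tensor (basis_vec {#}) x"
      using x by (simp add: primitives_def)
    then show ?thesis
      unfolding R_def by (simp only: lproj_tensor_basis) simp
  qed
  ultimately show ?thesis by (simp add: linear_0[OF linT])
qed

lemma growths_primitive: "x \<in> growths m \<Longrightarrow> x \<in> primitives \<Longrightarrow> x = 0"
proof (induction m)
  case 0
  have "{natural_growth u p | u p i. u \<in> graded i \<and> 1 \<le> i \<and> i \<le> 0 \<and> p \<in> primitives} = ({} :: 'a forests set)"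
    by auto
  then show ?case
    using 0 unfolding growths_def by (simp only: span_empty) simp
next
  case (Suc m)
  then show ?case by (simp add: growths_peel)
qed

section \<open>Generation of the Grossman--Larson algebra\<close>

lemma separating_functional:
  fixes x :: "'e::real_vector"
  assumes "x \<notin> span S"
  shows "\<exists>L :: 'e \<Rightarrow> real. linear L \<and> (\<forall>y\<in>S. L y = 0) \<and> L x = 1"
proof -
  obtain B where B: "B \<subseteq> S" "independent B" "S \<subseteq> span B"
    by (rule maximal_independent_subset)
  have xB: "x \<notin> span B"
    using assms span_mono[OF B(1)] by auto
  then have ind: "independent (insert x B)"
    using B(2) by (simp add: independent_insertI)
  define f where "f y = (if y = x then 1 else 0 :: real)" for y
  from linear_independent_extend[OF ind, of f] obtain L where
    L: "linear L" and Lf: "\<forall>y\<in>insert x B. L y = f y"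
    by (elim exE conjE)
  have "x \<notin> B" using xB span_base[of x B] by auto
  then have "L y = 0" if "y \<in> B" for y
    using Lf that by (auto simp: f_def)
  then have "L y = 0" if "y \<in> span B" for y
    by (rule linear_eq_0_on_span[OF L _ that])
  then have "\<forall>y\<in>S. L y = 0" using B(3) by (simp add: subset_iff)
  moreover have "L x = 1" using Lf by (simp add: f_def)
  ultimately show ?thesis using L by (intro exI[of _ L] conjI)
qed

lemma pairing_sym: "pairing x y = pairing y x"
proof -
  define S where "S = supp x \<union> supp y"
  have S: "finite S" "supp x \<subseteq> S" "supp y \<subseteq> S"
    by (auto simp: S_def)
  have "pairing x y = (\<Sum>f\<in>S. coef x f *\<^sub>R (coef y f * fp f f))"
    unfolding pairing_lin by (rule lin_alt[OF S(1,2)])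
  also have "\<dots> = (\<Sum>f\<in>S. coef y f *\<^sub>R (coef x f * fp f f))"
    by (intro sum.cong) simp_all
  also have "\<dots> = pairing y x"
    unfolding pairing_lin by (rule lin_alt[OF S(1,3), symmetric])
  finally show ?thesis .
qed

lemma linear_pairing_left: "linear (\<lambda>x. pairing x y)"
  unfolding pairing_lin by (rule linear_lin)

lemma pairing_graded: "x \<in> graded a \<Longrightarrow> y \<in> graded b \<Longrightarrow> a \<noteq> b \<Longrightarrow> pairing x y = 0"
proof -
  assume *: "x \<in> graded a" "y \<in> graded b" "a \<noteq> b"
  have "pairing x y = lin (\<lambda>f. 0) x"
    unfolding pairing_lin
  proof (rule lin_cong)
    fix f assume "f \<in> supp x"
    with * have "f \<notin> supp y" by (auto simp: graded_def)
    then show "coef y f * fp f f = 0" by (simp add: in_keys_iff)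
  qed
  then show ?thesis by simp
qed

lemma pairing_gl: "pairing w (basis_vec h \<star> basis_vec g) = pair2 (coproduct_CK w) h g"
proof -
  have "pairing w (basis_vec h \<star> basis_vec g) = lin (\<lambda>f. pairing (basis_vec f) (gl_forest h g)) w"
    by (subst linear_ext_lin[OF linear_pairing_left]) (simp add: gl_basis)
  also have "\<dots> = lin (\<lambda>f. pair2 (cuts f) h g) w"
    by (simp add: pairing_basis lin_fp flip: duality)
  also have "\<dots> = pair2 (coproduct_CK w) h g"
    by (simp add: pair2_def coproduct_CK_def lin_lin)
  finally show ?thesis .
qed

text \<open>Forests with labels in a finite set span a finite-dimensional space in each weight.\<close>

lemma represent_functional:
  fixes L :: "'a::finite forests \<Rightarrow> real"
  assumes L: "linear L"
  shows "\<exists>w\<in>graded n. \<forall>x\<in>graded n. pairing w x = L x"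
proof -
  define A where "A = {f :: 'a forest. weight f = n}"
  have fin: "finite A"
    unfolding A_def by (rule finite_subset[OF _ finite_forests_weight[of n]]) auto
  define w where "w = (\<Sum>f\<in>A. (L (basis_vec f) / fp f f) *\<^sub>R basis_vec f)"
  have "w \<in> graded n"
    unfolding w_def using subspace_graded[of n]
    by (intro subspace_sum subspace_scale) (auto simp: A_def graded_def)
  moreover have "pairing w x = L x" if x: "x \<in> graded n" for x
  proof -
    have *: "coef w f * fp f f = L (basis_vec f)" if "f \<in> A" for f
    proof -
      have "coef w f = (\<Sum>g\<in>A. if g = f then L (basis_vec f) / fp f f else 0)"
        unfolding w_def lookup_sum by (intro sum.cong) (auto simp: lookup_single when_def)
      then show ?thesis using that fin fp_pos[of f] by simp
    qed
    have "pairing w x = lin (\<lambda>f. coef w f * fp f f) x"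
      by (subst pairing_sym) (rule pairing_lin)
    also have "\<dots> = lin (\<lambda>f. L (basis_vec f)) x"
      using x by (intro lin_cong) (simp add: * A_def graded_def)
    also have "\<dots> = L x"
      by (rule linear_ext_lin[OF L, symmetric])
    finally show ?thesis .
  qed
  ultimately show ?thesis by blast
qed

lemma graded_times: "x \<in> graded a \<Longrightarrow> y \<in> graded b \<Longrightarrow> x * y \<in> graded (a + b)"
  unfolding graded_def using keys_mult[of x y] by fastforce

lemma graded_add_root: "x \<in> graded n \<Longrightarrow> add_root a x \<in> graded (Suc n)"
  unfolding graded_def add_root_def
  by (auto dest!: keys_lin simp: tree_weight_Node simp del: tree_weight.simps)

lemma lin_in_subspace: "subspace S \<Longrightarrow> (\<And>k. k \<in> supp x \<Longrightarrow> \<phi> k \<in> S) \<Longrightarrow> lin \<phi> x \<in> S"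
  unfolding lin_def by (intro subspace_sum subspace_scale)

lemma graft_all_graded: "graft_all f g \<in> graded (weight f + weight g)"
proof (induction g rule: forest_induct)
  case empty
  then show ?case by (simp add: graft_all_empty subspace_0[OF subspace_graded])
next
  case (add a C g)
  let ?t = "Node a C"
  have "basis_vec (f + C) + graft_all f C \<in> graded (weight f + weight C)"
    using graded_basis[of "f + C"] add.IH(1) by (intro subspace_add[OF subspace_graded]) auto
  from graded_add_root[OF this] have "graft_all_tree f ?t \<in> graded (weight f + tree_weight ?t)"
    by (simp add: graft_all_tree_Node tree_weight_Node del: graft_all_tree.simps tree_weight.simps)
  then have "graft_all_tree f ?t * basis_vec g \<in> graded ((weight f + tree_weight ?t) + weight g)"
    by (intro graded_times graded_basis)
  moreover have "basis_vec {#?t#} * graft_all f g \<in> graded (weight {#?t#} + (weight f + weight g))"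
    using add.IH(2) by (intro graded_times graded_basis)
  ultimately show ?case
    by (simp add: graft_all_add_mset add_ac subspace_add[OF subspace_graded] del: graft_all_tree.simps tree_weight.simps)
qed

lemma natural_growth_basis_graded: "natural_growth (basis_vec f) (basis_vec g) \<in> graded (weight f + weight g)"
  using graded_basis[of f] graded_basis[of g] graft_all_graded[of f g]
  by (auto simp: natural_growth_def subspace_scale[OF subspace_graded])

lemma natural_growth_double:
  "natural_growth x y = lin (\<lambda>f. lin (\<lambda>g. natural_growth (basis_vec f) (basis_vec g)) y) x"
  by (simp flip: linear_ext_lin[OF linear_ng_right] linear_ext_lin[OF linear_ng_left])

lemma natural_growth_graded:
  assumes "x \<in> graded a" "y \<in> graded b"
  shows "natural_growth x y \<in> graded (a + b)"
  unfolding natural_growth_double[of x y]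
  using assms natural_growth_basis_graded
  by (intro lin_in_subspace subspace_graded) (fastforce simp: graded_def)

lemma subspace_nonempty_span: "subspace nonempty_span"
  by (auto simp: subspace_def nonempty_span_def lookup_add)

lemma natural_growth_nonempty:
  fixes x y :: "'a forests"
  assumes "y \<in> nonempty_span"
  shows "natural_growth x y \<in> nonempty_span"
  unfolding natural_growth_double[of x y]
proof (intro lin_in_subspace subspace_nonempty_span)
  fix f g :: "'a forest" assume "g \<in> supp y"
  then have "g \<noteq> {#}" using assms by (auto simp: nonempty_span_def in_keys_iff)
  then have "0 < weight f + weight g" by (metis add_gr_0 gr0I weight_eq_0)
  then show "natural_growth (basis_vec f) (basis_vec g) \<in> nonempty_span"
    by (rule graded_nonempty[OF natural_growth_basis_graded])
qed

text \<open>
  A word \<open>p\<^sub>1 \<top> \<cdots> \<top> p\<^sub>n\<close> is \<open>u \<top> p\<^sub>n\<close>, where \<open>u\<close> has zero constant term; so the orthogonality that defines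
  the generators holds if it holds for all homogeneous \<open>u \<top> p\<close> of the right weight.
\<close>

lemma gl_generators_criterion:
  assumes q: "q \<in> graded b" "0 < b"
    and gr: "\<And>u p i j. u \<in> graded i \<Longrightarrow> p \<in> graded j \<Longrightarrow> p \<in> primitives \<Longrightarrow> 1 \<le> i \<Longrightarrow> i + j = b \<Longrightarrow>
      pairing (natural_growth u p) q = 0"
  shows "q \<in> gl_generators"
proof -
  have growth: "pairing (natural_growth u p) q = 0" if u: "u \<in> nonempty_span" and p: "p \<in> primitives" for u p
  proof -
    obtain M where M: "u = (\<Sum>i\<le>M. wproj i u)" using wproj_decomp by blast
    obtain M' where M': "p = (\<Sum>j\<le>M'. wproj j p)" using wproj_decomp by blast
    have z: "pairing (natural_growth (wproj i u) (wproj j p)) q = 0" for i j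
    proof (cases "i = 0 \<or> i + j \<noteq> b")
      case True
      then show ?thesis
      proof
        assume "i = 0"
        then show ?thesis
          by (simp add: wproj_0[OF u] linear_0[OF linear_ng_left] linear_0[OF linear_pairing_left])
      next
        assume "i + j \<noteq> b"
        then show ?thesis
          by (rule pairing_graded[OF natural_growth_graded[OF wproj_graded wproj_graded] q(1)])
      qed
    next
      case False
      then show ?thesis
        using wproj_graded[of i u] wproj_graded[of j p] wproj_primitive[OF p, of j] by (intro gr) auto
    qed
    have "natural_growth u p = (\<Sum>i\<le>M. \<Sum>j\<le>M'. natural_growth (wproj i u) (wproj j p))"
      by (subst M, subst M')
        (simp add: linear_sum[OF linear_ng_left] linear_sum[OF linear_ng_right], rule sum.swap)
    then show ?thesis
      by (simp add: linear_sum[OF linear_pairing_left] z)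
  qed
  have word: "foldl natural_growth p ps \<in> nonempty_span" if "p \<in> primitives" "set ps \<subseteq> primitives" for p :: "'a forests" and ps
    using that(2)
  proof (induction ps rule: rev_induct)
    case Nil
    then show ?case using that(1) by (simp add: primitives_def)
  next
    case (snoc r ps)
    then show ?case by (simp add: natural_growth_nonempty primitives_def)
  qed
  have "pairing (foldl natural_growth p ps) q = 0" if "p \<in> primitives" "ps \<noteq> []" "set ps \<subseteq> primitives" for p ps
  proof -
    obtain rs r where ps: "ps = rs @ [r]" using \<open>ps \<noteq> []\<close> by (metis rev_exhaust)
    show ?thesis
      using that(3) by (simp add: ps) (rule growth[OF word[OF that(1)]], auto)
  qed
  moreover have "pairing 1 q = 0"
    using pairing_graded[OF graded_one q(1)] q(2) by simp
  ultimately show ?thesis by (simp add: gl_generators_def)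
qed

lemma primitive_criterion:
  assumes w: "w \<in> nonempty_span"
    and van: "\<And>h g. h \<noteq> {#} \<Longrightarrow> g \<noteq> {#} \<Longrightarrow> pairing w (basis_vec h \<star> basis_vec g) = 0"
  shows "w \<in> primitives"
proof -
  have "coproduct_CK w = tensor w 1 + tensor 1 w"
  proof (rule pair2_ext)
    fix h g :: "'a forest"
    have *: "pair2 (tensor x y) h g = pairing x (basis_vec h) * pairing y (basis_vec g)" for x y
      by (simp add: pair2_def lin_tensor pairing_def lin_prod_real)
    have R: "pair2 (tensor w 1 + tensor 1 w) h g =
       pairing w (basis_vec h) * of_bool (g = {#}) + of_bool (h = {#}) * pairing w (basis_vec g)"
      unfolding pair2_def lin_add by (fold pair2_def) (simp add: * pairing_def fp_empty)
    have e: "pairing w (basis_vec {#}) = 0"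
      using w unfolding pairing_sym[of w] pairing_basis by (simp add: nonempty_span_def)
    show "pair2 (coproduct_CK w) h g = pair2 (tensor w 1 + tensor 1 w) h g"
      unfolding R pairing_gl[symmetric]
    proof (cases "h = {#} \<or> g = {#}")
      case True
      then show "pairing w (basis_vec h \<star> basis_vec g) =
        pairing w (basis_vec h) * of_bool (g = {#}) + of_bool (h = {#}) * pairing w (basis_vec g)"
        using e by (auto simp: gl_one_left gl_one_right)
    qed (simp add: van)
  qed
  with w show ?thesis by (simp add: primitives_def)
qed

text \<open>
  In finite dimension a functional that vanishes on the annihilator of a subspace belongs to this
  subspace.  An element annihilating the generators is thus a combination of growths \<open>u \<top> p\<close>, and
  such a combination is primitive only if it is \<open>0\<close>.
\<close>

lemma primitive_annihilating_generators:
  fixes w :: "'a::finite forests"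
  assumes w: "w \<in> graded b" "0 < b" "w \<in> primitives"
    and ann: "\<And>q. q \<in> gl_generators \<Longrightarrow> q \<in> graded b \<Longrightarrow> pairing w q = 0"
  shows "w = 0"
proof -
  let ?S = "{natural_growth u p | u p i. u \<in> graded i \<and> 1 \<le> i \<and> i \<le> b \<and> p \<in> primitives} \<inter> graded b"
  have "w \<in> span ?S"
  proof (rule ccontr)
    assume "w \<notin> span ?S"
    from separating_functional[OF this]
    obtain L where L: "linear L" "\<forall>y\<in>?S. L y = 0" "L w = (1::real)"
      by (elim exE conjE)
    obtain q where q: "q \<in> graded b" "\<forall>x\<in>graded b. pairing q x = L x"
      using represent_functional[OF L(1)] by blast
    have "q \<in> gl_generators"
    proof (rule gl_generators_criterion[OF q(1) w(2)])
      fix u p :: "'a forests" and i j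
      assume *: "u \<in> graded i" "p \<in> graded j" "p \<in> primitives" "1 \<le> i" "i + j = b"
      have g: "natural_growth u p \<in> graded b"
        using natural_growth_graded[OF *(1,2)] *(5) by simp
      have "i \<le> b" using * by simp
      with * g have "natural_growth u p \<in> ?S"
        by (intro IntI CollectI exI[of _ u] exI[of _ p] exI[of _ i] conjI refl)
      then have "L (natural_growth u p) = 0" by (rule bspec[OF L(2)])
      moreover have "pairing q (natural_growth u p) = L (natural_growth u p)"
        by (rule bspec[OF q(2) g])
      ultimately show "pairing (natural_growth u p) q = 0"
        by (subst pairing_sym) simp
    qed
    then have "pairing w q = 0" by (rule ann) (rule q(1))
    moreover have "pairing q w = 1"
      using bspec[OF q(2) w(1)] L(3) by simp
    then have "pairing w q = 1"
      by (subst pairing_sym)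
    ultimately show False by simp
  qed
  then have "w \<in> growths b"
    unfolding growths_def by (rule subsetD[OF span_mono[OF Int_lower1]])
  then show ?thesis by (rule growths_primitive) (rule w(3))
qed

text \<open>
  Otherwise some functional \<open>L\<close> kills all products \<open>h \<star> q\<close> but not \<open>x\<close>.  Choose \<open>h\<close> of maximal
  weight \<open>a < n\<close> such that \<open>L (h \<star> -)\<close> is nonzero on the elements of weight \<open>n - a\<close>; this is
  possible since \<open>h = 1\<close> is a candidate.  By maximality and associativity \<open>L (h \<star> -)\<close> vanishes on
  products of two elements of positive weight, so it is represented by a primitive element, and it
  vanishes on the generators.  Hence it is \<open>0\<close>, a contradiction.
\<close>

theorem gl_generated:
  fixes x :: "'a::finite forests"
  assumes "0 < n" "x \<in> graded n"
  shows "x \<in> span {h \<star> q | h q a b. h \<in> graded a \<and> q \<in> gl_generators \<and> q \<in> graded b \<and> a + b = n \<and> 0 < b}"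
    (is "x \<in> span ?S")
proof (rule ccontr)
  assume "x \<notin> span ?S"
  from separating_functional[OF this]
  obtain L where L: "linear L" "\<forall>y\<in>?S. L y = 0" "L x = (1::real)"
    by (elim exE conjE)
  define P where "P a \<longleftrightarrow> a < n \<and> (\<exists>h\<in>graded a. \<exists>x\<in>graded (n - a). L (h \<star> x) \<noteq> 0)" for a
  have "P 0"
  proof -
    have "L (1 \<star> x) \<noteq> 0" using L(3) by (simp add: gl_one_left)
    moreover have "x \<in> graded (n - 0)" using assms by simp
    ultimately show ?thesis unfolding P_def using graded_one assms(1) by blast
  qed
  moreover have bound: "\<And>a. P a \<Longrightarrow> a \<le> n" by (simp add: P_def)
  ultimately have "P (Greatest P)"
    by (rule GreatestI_nat)
  have max: "\<And>a. P a \<Longrightarrow> a \<le> Greatest P"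
    by (rule Greatest_le_nat[OF _ bound])
  from \<open>P (Greatest P)\<close> obtain h z where a: "Greatest P < n" "h \<in> graded (Greatest P)" "z \<in> graded (n - Greatest P)" "L (h \<star> z) \<noteq> 0"
    unfolding P_def by blast
  define a where "a = Greatest P"
  note a = a[folded a_def] and max = max[folded a_def]
  have linL: "linear (\<lambda>y. L (h \<star> y))"
    using linear_compose[OF linear_gl_right L(1)] by (simp add: o_def)
  obtain w where w: "w \<in> graded (n - a)" "\<forall>y\<in>graded (n - a). pairing w y = L (h \<star> y)"
    using represent_functional[OF linL] by blast
  have "w \<in> primitives"
  proof (rule primitive_criterion)
    show "w \<in> nonempty_span" using graded_nonempty[OF w(1)] a by simp
  next
    fix f g :: "'a forest" assume fg: "f \<noteq> {#}" "g \<noteq> {#}"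
    have gr: "basis_vec f \<star> basis_vec g \<in> graded (weight f + weight g)"
      by (intro gl_graded graded_basis)
    have pos: "0 < weight f" "0 < weight g" using fg by (metis gr0I weight_eq_0)+
    show "pairing w (basis_vec f \<star> basis_vec g) = 0"
    proof (cases "weight f + weight g = n - a")
      case True
      have "\<not> P (a + weight f)" using max[of "a + weight f"] pos by auto
      moreover have "a + weight f < n" "n - (a + weight f) = weight g" using True pos by auto
      ultimately have "L ((h \<star> basis_vec f) \<star> basis_vec g) = 0"
        unfolding P_def using gl_graded[OF a(2) graded_basis[of f]] graded_basis[of g] by auto
      then show ?thesis
        using w(2) gr True by (simp add: gl_assoc)
    next
      case False
      then show ?thesis using pairing_graded[OF w(1) gr] by simp
    qed
  qed
  moreover have "pairing w q = 0" if "q \<in> gl_generators" "q \<in> graded (n - a)" for q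
  proof -
    have "h \<star> q \<in> ?S" using that a
      by (intro CollectI exI[of _ h] exI[of _ q] exI[of _ a] exI[of _ "n - a"] conjI refl) simp_all
    then have "L (h \<star> q) = 0" by (rule bspec[OF L(2)])
    then show ?thesis using w(2) that(2) by simp
  qed
  ultimately have "w = 0"
    using primitive_annihilating_generators[OF w(1)] a by simp
  then show False
    using w(2) a by (simp add: linear_0[OF linear_pairing_left])
qed

section \<open>Multilinearity of higher derivatives and Taylor expansion\<close>

lemma C_k_differentiable: "C_k (Suc k) f \<Longrightarrow> f differentiable (at x)"
  by simp

lemma C_k_continuous: "C_k k f \<Longrightarrow> continuous_on UNIV f"
proof (cases k)
  case (Suc n)
  assume "C_k k f"
  then have "\<forall>x. f differentiable (at x)" by (simp add: Suc)
  then show ?thesis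
    by (intro continuous_at_imp_continuous_on ballI differentiable_imp_continuous_within) simp
qed simp

lemma C_k_Suc: "C_k (Suc k) f \<Longrightarrow> C_k k f"
proof (induction k arbitrary: f)
  case 0
  from C_k_continuous[OF this] show ?case by simp
next
  case (Suc k)
  show ?case
    unfolding C_k.simps(2)
  proof (intro conjI allI)
    show "f differentiable (at x)" for x using Suc.prems by (rule C_k_differentiable)
    show "C_k k (\<lambda>x. frechet_derivative f (at x) v)" for v
      using Suc.prems by (intro Suc.IH) (simp del: C_k.simps add: C_k.simps(2)[of "Suc k" f])
  qed
qed

lemma derivs_snoc: "derivs f (vs @ [v]) = derivs (\<lambda>x. frechet_derivative f (at x) v) vs"
  by (induction vs) simp_all

lemma C_k_derivs: "C_k (k + length vs) f \<Longrightarrow> C_k k (derivs f vs)"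
proof (induction vs arbitrary: f rule: rev_induct)
  case (snoc v vs)
  then have "C_k (k + length vs) (\<lambda>x. frechet_derivative f (at x) v)" by simp
  then show ?case unfolding derivs_snoc by (rule snoc.IH)
qed simp

lemma C_k_le: "C_k n f \<Longrightarrow> m \<le> n \<Longrightarrow> C_k m f"
  by (induction n) (auto simp: le_Suc_eq simp del: C_k.simps dest: C_k_Suc)

lemma derivs_differentiable:
  assumes "C_k n f" "length vs < n"
  shows "derivs f vs differentiable (at x)"
proof -
  have "C_k (Suc 0 + length vs) f" using assms by (intro C_k_le[OF assms(1)]) simp
  from C_k_derivs[OF this] show ?thesis by simp
qed

lemma derivs_continuous:
  assumes "C_k n f" "length vs \<le> n"
  shows "continuous_on UNIV (derivs f vs)"
proof -
  have "C_k (0 + length vs) f" using assms by (intro C_k_le[OF assms(1)]) simp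
  from C_k_derivs[OF this] show ?thesis by simp
qed

definition words :: "'j set \<Rightarrow> nat \<Rightarrow> 'j list set" where
  "words J n = {js. set js \<subseteq> J \<and> length js = n}"

lemma words_0: "words J 0 = {[]}"
  by (auto simp: words_def)

lemma finite_words: "finite J \<Longrightarrow> finite (words J n)"
  by (simp add: words_def finite_lists_length_eq)

lemma sum_words_Suc: "(\<Sum>js\<in>words J (Suc n). h js) = (\<Sum>j\<in>J. \<Sum>js\<in>words J n. h (j # js))"
proof -
  have "words J (Suc n) = (\<lambda>(j, js). j # js) ` (J \<times> words J n)"
    by (auto simp: words_def length_Suc_conv image_iff)
  moreover have "inj_on (\<lambda>(j, js). j # js) (J \<times> words J n)"
    by (auto simp: inj_on_def)
  ultimately show ?thesis
    by (simp add: sum.reindex sum.cartesian_product case_prod_unfold)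
qed

lemma derivs_multilinear:
  fixes f :: "'a::real_normed_vector \<Rightarrow> 'b::real_normed_vector"
  assumes f: "C_k n f" and J: "finite J"
  shows "length cs \<le> n \<Longrightarrow> derivs f (map (\<lambda>c. \<Sum>j\<in>J. c j *\<^sub>R a j) cs) x =
    (\<Sum>js\<in>words J (length cs). prod_list (map2 (\<lambda>c j. c j) cs js) *\<^sub>R derivs f (map a js) x)"
proof (induction cs arbitrary: x)
  case Nil
  show ?case by (simp add: words_0)
next
  case (Cons c cs)
  let ?W = "words J (length cs)"
  let ?P = "\<lambda>js. prod_list (map2 (\<lambda>c j. c j) cs js)"
  have eq: "derivs f (map (\<lambda>c. \<Sum>j\<in>J. c j *\<^sub>R a j) cs) = (\<lambda>x. \<Sum>js\<in>?W. ?P js *\<^sub>R derivs f (map a js) x)"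
    using Cons by (intro ext Cons.IH) simp
  have diff: "derivs f (map a js) differentiable (at x)" if "js \<in> ?W" for js
    using that Cons.prems by (intro derivs_differentiable[OF f]) (simp add: words_def)
  then have hd: "(derivs f (map a js) has_derivative frechet_derivative (derivs f (map a js)) (at x)) (at x)" if "js \<in> ?W" for js
    using that frechet_derivative_works by blast
  have "((\<lambda>x. \<Sum>js\<in>?W. ?P js *\<^sub>R derivs f (map a js) x) has_derivative
      (\<lambda>v. \<Sum>js\<in>?W. ?P js *\<^sub>R frechet_derivative (derivs f (map a js)) (at x) v)) (at x)"
    by (intro has_derivative_sum has_derivative_scaleR_right hd)
  from frechet_derivative_at[OF this, symmetric]
  have "derivs f (map (\<lambda>c. \<Sum>j\<in>J. c j *\<^sub>R a j) (c # cs)) x =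
    (\<Sum>js\<in>?W. ?P js *\<^sub>R frechet_derivative (derivs f (map a js)) (at x) (\<Sum>j\<in>J. c j *\<^sub>R a j))"
    by (simp add: eq)
  also have "\<dots> = (\<Sum>js\<in>?W. \<Sum>j\<in>J. (c j * ?P js) *\<^sub>R derivs f (map a (j # js)) x)"
  proof (intro sum.cong refl)
    fix js assume js: "js \<in> ?W"
    have "linear (frechet_derivative (derivs f (map a js)) (at x))"
      using hd[OF js] by (rule has_derivative_linear)
    then show "?P js *\<^sub>R frechet_derivative (derivs f (map a js)) (at x) (\<Sum>j\<in>J. c j *\<^sub>R a j)
       = (\<Sum>j\<in>J. (c j * ?P js) *\<^sub>R derivs f (map a (j # js)) x)"
      by (simp add: linear_sum linear_cmul scaleR_sum_right mult.commute)
  qed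
  also have "\<dots> = (\<Sum>j\<in>J. \<Sum>js\<in>?W. (c j * ?P js) *\<^sub>R derivs f (map a (j # js)) x)"
    by (rule sum.swap)
  also have "\<dots> = (\<Sum>js\<in>words J (length (c # cs)). prod_list (map2 (\<lambda>c j. c j) (c # cs) js) *\<^sub>R derivs f (map a js) x)"
    by (simp add: sum_words_Suc)
  finally show ?case .
qed

lemma map2_replicate: "length js = n \<Longrightarrow> map2 h (replicate n c) js = map (h c) js"
  by (induction js arbitrary: n) auto

lemma derivs_power_expand:
  fixes f :: "'a::real_normed_vector \<Rightarrow> 'b::real_normed_vector"
  assumes f: "C_k m f" and J: "finite J" and n: "n \<le> m"
  shows "derivs f (replicate n (\<Sum>j\<in>J. c j *\<^sub>R a j)) x =
    (\<Sum>js\<in>words J n. prod_list (map c js) *\<^sub>R derivs f (map a js) x)"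
proof -
  have "derivs f (replicate n (\<Sum>j\<in>J. c j *\<^sub>R a j)) x = (\<Sum>js\<in>words J n. prod_list (map2 (\<lambda>c j. c j) (replicate n c) js) *\<^sub>R derivs f (map a js) x)"
    using derivs_multilinear[OF f J, of "replicate n c" a x] n by simp
  also have "\<dots> = (\<Sum>js\<in>words J n. prod_list (map c js) *\<^sub>R derivs f (map a js) x)"
    by (intro sum.cong refl) (simp add: words_def map2_replicate)
  finally show ?thesis .
qed

lemma prod_list_inner_bound:
  "length js = length vs \<Longrightarrow> set js \<subseteq> Basis \<Longrightarrow>
     \<bar>prod_list (map2 (\<lambda>c j. c j) (map (\<lambda>v j. v \<bullet> j) vs) js)\<bar> \<le> prod_list (map norm vs)"
proof (induction vs js rule: list_induct2')
  case (4 v vs j js)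
  then show ?case
    by (auto simp: abs_mult intro!: mult_mono Basis_le_norm)
qed auto

text \<open>
  Expanding all arguments in the basis reduces the bound, which is uniform in the directions, to
  the continuity of finitely many partial derivatives.
\<close>

lemma derivs_bounded:
  fixes f :: "'a::euclidean_space \<Rightarrow> 'b::real_normed_vector"
  assumes f: "C_k m f" and n: "n \<le> m" and K: "compact K"
  shows "\<exists>C\<ge>0. \<forall>x\<in>K. \<forall>vs. length vs = n \<longrightarrow> norm (derivs f vs x) \<le> C * prod_list (map norm vs)"
proof -
  have "\<exists>B. \<forall>x\<in>K. norm (derivs f js x) \<le> B" if "js \<in> words Basis n" for js
  proof -
    have "continuous_on K (derivs f js)"
      using that n by (intro continuous_on_subset[OF derivs_continuous[OF f]]) (auto simp: words_def)
    then have "compact (derivs f js ` K)" using K by (rule compact_continuous_image)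
    from compact_imp_bounded[OF this] show ?thesis
      by (auto simp: bounded_iff)
  qed
  then obtain B where B: "\<And>js x. js \<in> words Basis n \<Longrightarrow> x \<in> K \<Longrightarrow> norm (derivs f js x) \<le> B js"
    by metis
  define C where "C = (\<Sum>js\<in>words (Basis :: 'a set) n. \<bar>B js\<bar>)"
  have "norm (derivs f vs x) \<le> C * prod_list (map norm vs)" if x: "x \<in> K" and vs: "length vs = n" for x vs
  proof -
    let ?cs = "map (\<lambda>v j. v \<bullet> j) vs"
    let ?P = "\<lambda>js. prod_list (map2 (\<lambda>c j. c j) ?cs js)"
    have "derivs f vs x = derivs f (map (\<lambda>c. \<Sum>j\<in>Basis. c j *\<^sub>R j) ?cs) x"
      by (simp add: euclidean_representation o_def)
    also have "\<dots> = (\<Sum>js\<in>words Basis (length ?cs). ?P js *\<^sub>R derivs f (map (\<lambda>j. j) js) x)"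
      using n vs by (intro derivs_multilinear[OF f finite_Basis]) simp
    also have "\<dots> = (\<Sum>js\<in>words Basis n. ?P js *\<^sub>R derivs f js x)"
      using vs by simp
    also have "norm \<dots> \<le> (\<Sum>js\<in>words Basis n. prod_list (map norm vs) * \<bar>B js\<bar>)"
    proof (rule order_trans[OF norm_sum], rule sum_mono)
      fix js assume js: "js \<in> words (Basis :: 'a set) n"
      have P: "\<bar>?P js\<bar> \<le> prod_list (map norm vs)"
        using js vs by (intro prod_list_inner_bound) (auto simp: words_def)
      have "norm (derivs f js x) \<le> \<bar>B js\<bar>"
        using B[OF js x] by linarith
      from mult_mono[OF P this _ norm_ge_zero] show "norm (?P js *\<^sub>R derivs f js x) \<le> prod_list (map norm vs) * \<bar>B js\<bar>"
        using P by (simp add: order_trans[OF abs_ge_zero])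
    qed
    also have "\<dots> = C * prod_list (map norm vs)"
      unfolding C_def sum_distrib_right by (simp add: mult.commute)
    finally show ?thesis .
  qed
  moreover have "C \<ge> 0" by (simp add: C_def sum_nonneg)
  ultimately show ?thesis by blast
qed

text \<open>Taylor's formula with integral remainder on the segment from \<open>y\<close> to \<open>z\<close>.\<close>

lemma taylor_bound:
  fixes f :: "'a::euclidean_space \<Rightarrow> 'b::banach"
  assumes f: "C_k (Suc N) f" and K: "compact K" "convex K"
  shows "\<exists>C\<ge>0. \<forall>y\<in>K. \<forall>z\<in>K.
    norm (f z - (\<Sum>n\<le>N. (1 / fact n) *\<^sub>R derivs f (replicate n (z - y)) y)) \<le> C * norm (z - y) ^ Suc N"
proof -
  obtain C where C: "C \<ge> 0" and
    bound: "\<forall>x\<in>K. \<forall>vs. length vs = Suc N \<longrightarrow> norm (derivs f vs x) \<le> C * prod_list (map norm vs)"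
    using derivs_bounded[OF f le_refl K(1)] by (elim exE conjE)
  have C2: "norm (derivs f (replicate (Suc N) v) x) \<le> C * norm v ^ Suc N" if "x \<in> K" for x v
    using bound[THEN bspec, OF that, THEN spec, of "replicate (Suc N) v"] by (simp del: replicate_Suc)
  have "norm (f z - (\<Sum>n\<le>N. (1 / fact n) *\<^sub>R derivs f (replicate n (z - y)) y)) \<le> C * norm (z - y) ^ Suc N"
    if y: "y \<in> K" and z: "z \<in> K" for y z
  proof -
    define v where "v = z - y"
    define Df where "Df m t = derivs f (replicate m v) (y + t *\<^sub>R v)" for m :: nat and t :: real
    have inK: "y + t *\<^sub>R v \<in> K" if "t \<in> {0..1}" for t
    proof -
      have "y + t *\<^sub>R v = (1 - t) *\<^sub>R y + t *\<^sub>R z" by (simp add: v_def algebra_simps)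
      then show ?thesis using K(2) y z that by (simp add: convex_alt)
    qed
    have "((\<lambda>x. ((1 - x) ^ (Suc N - 1) / fact (Suc N - 1)) *\<^sub>R Df (Suc N) x) has_integral
       (f (y + 1 *\<^sub>R v) - (\<Sum>i<Suc N. ((1 - 0) ^ i / fact i) *\<^sub>R Df i 0))) {0..1}"
    proof (rule Taylor_has_integral[where f = "\<lambda>t. f (y + t *\<^sub>R v)" and Df = Df])
      show "Df 0 = (\<lambda>t. f (y + t *\<^sub>R v))" by (rule ext) (simp add: Df_def)
      fix m t assume m: "m < Suc N" "(0::real) \<le> t" "t \<le> 1"
      have "derivs f (replicate m v) differentiable (at (y + t *\<^sub>R v))"
        using m by (intro derivs_differentiable[OF f]) simp
      then have d: "(derivs f (replicate m v) has_derivative frechet_derivative (derivs f (replicate m v)) (at (y + t *\<^sub>R v))) (at (y + t *\<^sub>R v))"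
        using frechet_derivative_works by blast
      have e: "((\<lambda>t. y + t *\<^sub>R v) has_derivative (\<lambda>h. h *\<^sub>R v)) (at t within {0..1})"
        by (auto intro!: derivative_eq_intros)
      have "((\<lambda>t. derivs f (replicate m v) (y + t *\<^sub>R v)) has_derivative
          (\<lambda>h. frechet_derivative (derivs f (replicate m v)) (at (y + t *\<^sub>R v)) (h *\<^sub>R v))) (at t within {0..1})"
        by (rule has_derivative_compose[OF e d])
      then show "(Df m has_vector_derivative Df (Suc m) t) (at t within {0..1})"
        unfolding Df_def has_vector_derivative_def
        by (simp add: linear_cmul[OF has_derivative_linear[OF d]])
    qed simp_all
    then have I: "((\<lambda>x. ((1 - x) ^ N / fact N) *\<^sub>R Df (Suc N) x) has_integral
       (f z - (\<Sum>n\<le>N. (1 / fact n) *\<^sub>R derivs f (replicate n v) y))) (cbox 0 1)"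
      by (simp add: v_def Df_def lessThan_Suc_atMost)
    have "norm (f z - (\<Sum>n\<le>N. (1 / fact n) *\<^sub>R derivs f (replicate n v) y)) \<le> (C * norm v ^ Suc N) * measure lborel (cbox 0 (1::real))"
    proof (rule has_integral_bound[OF _ I])
      show "0 \<le> C * norm v ^ Suc N" using C by simp
      fix x :: real assume x: "x \<in> cbox 0 1"
      have "(1 - x) ^ N \<le> 1 ^ N" using x by (intro power_mono) auto
      then have "(1 - x) ^ N / fact N \<le> 1"
        by (simp add: divide_le_eq order_trans[OF _ fact_ge_1])
      moreover have "0 \<le> (1 - x) ^ N / fact N" "0 \<le> (1 - x) ^ N" using x by simp_all
      moreover have "norm (Df (Suc N) x) \<le> C * norm v ^ Suc N"
        unfolding Df_def using x by (intro C2 inK) simp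
      ultimately show "norm (((1 - x) ^ N / fact N) *\<^sub>R Df (Suc N) x) \<le> C * norm v ^ Suc N"
        using mult_mono[of "(1 - x) ^ N / fact N" 1 "norm (Df (Suc N) x)" "C * norm v ^ Suc N"] by simp
    qed
    then show ?thesis by (simp add: v_def)
  qed
  with C show ?thesis by blast
qed

section \<open>Sewing\<close>

abbreviation riemann_sum ::
  "(real \<Rightarrow> real \<Rightarrow> 'v::euclidean_space hopf) \<Rightarrow> (real \<Rightarrow> 'v hopf \<Rightarrow> 'e::real_normed_vector) \<Rightarrow> nat \<Rightarrow> (nat \<Rightarrow> real) \<Rightarrow> 'e" where
  "riemann_sum X L n \<tau> \<equiv> \<Sum>i<n. L (\<tau> i) (positive_part (X (\<tau> i) (\<tau> (Suc i))))"

abbreviation partition :: "real \<Rightarrow> real \<Rightarrow> real \<Rightarrow> nat \<Rightarrow> (nat \<Rightarrow> real) \<Rightarrow> bool" where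
  "partition s t \<delta> n \<tau> \<equiv> \<tau> 0 = s \<and> \<tau> n = t \<and> (\<forall>i<n. \<tau> i < \<tau> (Suc i) \<and> \<tau> (Suc i) - \<tau> i < \<delta>)"

locale regular_control =
  fixes T :: real and \<omega> :: "real \<Rightarrow> real \<Rightarrow> real"
  assumes \<omega>: "control T \<omega>"
begin

lemma control_nonneg: "0 \<le> s \<Longrightarrow> s \<le> t \<Longrightarrow> t \<le> T \<Longrightarrow> 0 \<le> \<omega> s t"
  using \<omega> by (simp add: control_def)

lemma control_superadd: "0 \<le> s \<Longrightarrow> s \<le> u \<Longrightarrow> u \<le> t \<Longrightarrow> t \<le> T \<Longrightarrow> \<omega> s u + \<omega> u t \<le> \<omega> s t"
  using \<omega> by (simp add: control_def)

lemma control_diag: "0 \<le> t \<Longrightarrow> t \<le> T \<Longrightarrow> \<omega> t t = 0"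
  using \<omega> by (simp add: control_def)

lemma control_mono:
  assumes "0 \<le> s'" "s' \<le> s" "s \<le> t" "t \<le> t'" "t' \<le> T"
  shows "\<omega> s t \<le> \<omega> s' t'"
  using control_superadd[of s' s t] control_superadd[of s' t t']
    control_nonneg[of s' s] control_nonneg[of t t'] assms by linarith

text \<open>
  The partition is split at the interval that contains the point where the control reaches half of
  its total value \<open>w\<close>.  Both remaining parts have control at most \<open>w / 2\<close>, so by induction their
  errors add up to at most \<open>2 C (w / 2)\<^sup>\<theta>\<close>, and joining the three parts costs \<open>2 K w\<^sup>\<theta>\<close>.  The constant
  is the solution of \<open>C 2\<^sup>1\<^sup>-\<^sup>\<theta> + 2 K = C\<close>.
\<close>

lemma sewing_sum_bound:
  fixes A :: "real \<Rightarrow> real \<Rightarrow> 'e::real_normed_vector"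
  assumes \<theta>: "1 < \<theta>" and K: "0 \<le> K"
    and diag: "\<And>s. A s s = 0"
    and germ: "\<And>s u t. 0 \<le> s \<Longrightarrow> s \<le> u \<Longrightarrow> u \<le> t \<Longrightarrow> t \<le> T \<Longrightarrow>
      norm (A s t - A s u - A u t) \<le> K * \<omega> s t powr \<theta>"
    and C: "C = 2 * K / (1 - 2 powr (1 - \<theta>))"
    and \<tau>: "\<And>i j. i \<le> j \<Longrightarrow> \<tau> i \<le> \<tau> j" "\<And>i. \<tau> i \<in> {0..T}"
  shows "norm ((\<Sum>i<n. A (\<tau> (k + i)) (\<tau> (Suc (k + i)))) - A (\<tau> k) (\<tau> (k + n))) \<le> C * \<omega> (\<tau> k) (\<tau> (k + n)) powr \<theta>"
proof (induction n arbitrary: k rule: less_induct)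
  case (less n)
  define S where "S k n = (\<Sum>i<n. A (\<tau> (k + i)) (\<tau> (Suc (k + i))))" for k n
  have p1: "2 powr (1 - \<theta>) < (1::real)"
    using powr_less_mono[of "1 - \<theta>" 0 "2::real"] \<theta> by simp
  have C0: "0 \<le> C" using p1 K by (simp add: C)
  have split: "S k (m + n) = S k m + S (k + m) n" for k m n
    by (induction n) (simp_all add: S_def add_ac)
  show ?case
  proof (cases "n = 0")
    case True
    then show ?thesis using C0 by (simp add: diag)
  next
    case False
    define w where "w = \<omega> (\<tau> k) (\<tau> (k + n))"
    have T: "0 \<le> \<tau> i" "\<tau> i \<le> T" for i using \<tau>(2)[of i] by auto
    have w0: "0 \<le> w" unfolding w_def using \<tau> T by (intro control_nonneg) auto
    define P where "P i \<longleftrightarrow> i < n \<and> \<omega> (\<tau> k) (\<tau> (k + i)) \<le> w / 2" for i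
    have P0: "P 0" using False w0 T control_diag by (simp add: P_def)
    have bound: "\<And>i. P i \<Longrightarrow> i \<le> n" by (simp add: P_def)
    define i where "i = Greatest P"
    have Pi: "P i" unfolding i_def using P0 bound by (rule GreatestI_nat)
    have max: "\<And>j. P j \<Longrightarrow> j \<le> i" unfolding i_def by (rule Greatest_le_nat[OF _ bound])
    define j where "j = Suc i"
    have ij: "i < n" "j \<le> n" "i \<le> j" using Pi by (auto simp: P_def j_def)
    have left: "\<omega> (\<tau> k) (\<tau> (k + i)) \<le> w / 2" using Pi by (simp add: P_def)
    have right: "\<omega> (\<tau> (k + j)) (\<tau> (k + n)) \<le> w / 2"
    proof (cases "j = n")
      case True
      then show ?thesis using w0 T control_diag by simp
    next
      case False
      then have "\<not> P j" using max[of j] by (auto simp: j_def)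
      then have "w / 2 < \<omega> (\<tau> k) (\<tau> (k + j))" using False ij by (simp add: P_def)
      moreover have "\<omega> (\<tau> k) (\<tau> (k + j)) + \<omega> (\<tau> (k + j)) (\<tau> (k + n)) \<le> w"
        unfolding w_def using \<tau>(1) T ij by (intro control_superadd) auto
      ultimately show ?thesis by linarith
    qed
    have half: "norm (S k' m - A (\<tau> k') (\<tau> (k' + m))) \<le> C * (w / 2) powr \<theta>"
      if "m < n" "\<omega> (\<tau> k') (\<tau> (k' + m)) \<le> w / 2" for k' m
    proof -
      have "norm (S k' m - A (\<tau> k') (\<tau> (k' + m))) \<le> C * \<omega> (\<tau> k') (\<tau> (k' + m)) powr \<theta>"
        unfolding S_def by (rule less.IH[OF that(1)])
      also have "\<dots> \<le> C * (w / 2) powr \<theta>"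
        using that(2) \<theta> C0 \<tau>(1) T
        by (intro mult_left_mono powr_mono2) (auto intro!: control_nonneg)
      finally show ?thesis .
    qed
    have l: "norm (S k i - A (\<tau> k) (\<tau> (k + i))) \<le> C * (w / 2) powr \<theta>"
      using ij left by (intro half) auto
    have "k + j + (n - j) = k + n" using ij by simp
    then have r: "norm (S (k + j) (n - j) - A (\<tau> (k + j)) (\<tau> (k + n))) \<le> C * (w / 2) powr \<theta>"
      using half[of "n - j" "k + j"] right ij by (simp add: j_def)
    have g1: "norm (A (\<tau> k) (\<tau> (k + n)) - A (\<tau> k) (\<tau> (k + j)) - A (\<tau> (k + j)) (\<tau> (k + n))) \<le> K * w powr \<theta>"
      unfolding w_def using \<tau>(1) T ij by (intro germ) auto
    have "norm (A (\<tau> k) (\<tau> (k + j)) - A (\<tau> k) (\<tau> (k + i)) - A (\<tau> (k + i)) (\<tau> (k + j)))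
       \<le> K * \<omega> (\<tau> k) (\<tau> (k + j)) powr \<theta>"
      using \<tau>(1) T ij by (intro germ) auto
    also have "\<dots> \<le> K * w powr \<theta>"
      unfolding w_def using \<theta> K \<tau>(1) T ij
      by (intro mult_left_mono powr_mono2 control_mono) (auto intro!: control_nonneg)
    finally have g2: "norm (A (\<tau> k) (\<tau> (k + j)) - A (\<tau> k) (\<tau> (k + i)) - A (\<tau> (k + i)) (\<tau> (k + j))) \<le> K * w powr \<theta>" .
    have "S k n = S k i + A (\<tau> (k + i)) (\<tau> (k + j)) + S (k + j) (n - j)"
      using split[of k j "n - j"] ij by (simp add: S_def j_def)
    then have e: "S k n - A (\<tau> k) (\<tau> (k + n)) =
        (S k i - A (\<tau> k) (\<tau> (k + i))) + (S (k + j) (n - j) - A (\<tau> (k + j)) (\<tau> (k + n)))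
        - (A (\<tau> k) (\<tau> (k + n)) - A (\<tau> k) (\<tau> (k + j)) - A (\<tau> (k + j)) (\<tau> (k + n)))
        - (A (\<tau> k) (\<tau> (k + j)) - A (\<tau> k) (\<tau> (k + i)) - A (\<tau> (k + i)) (\<tau> (k + j)))"
      by (simp add: algebra_simps)
    have tri: "norm (a + b - c - d) \<le> norm a + norm b + norm c + norm d" for a b c d :: 'e
      by norm
    have "norm (S k n - A (\<tau> k) (\<tau> (k + n))) \<le>
       C * (w / 2) powr \<theta> + C * (w / 2) powr \<theta> + K * w powr \<theta> + K * w powr \<theta>"
      unfolding e by (rule order_trans[OF tri]) (intro add_mono l r g1 g2)
    also have "\<dots> = (C * 2 powr (1 - \<theta>) + 2 * K) * w powr \<theta>"
      using w0 by (simp add: powr_divide powr_diff algebra_simps)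
    also have "C * 2 powr (1 - \<theta>) + 2 * K = C"
    proof -
      have "C * (1 - 2 powr (1 - \<theta>)) = 2 * K" using p1 \<theta> by (simp add: C)
      then show ?thesis by (simp add: algebra_simps)
    qed
    finally show ?thesis by (simp add: S_def w_def)
  qed
qed

lemma partition_exists:
  assumes "s \<le> t" "0 < \<delta>"
  shows "\<exists>n (\<tau> :: nat \<Rightarrow> real). partition s t \<delta> n \<tau>"
proof (cases "s = t")
  case True
  then show ?thesis by (intro exI[of _ 0] exI[of _ "\<lambda>_. s"]) simp
next
  case False
  then have st: "s < t" using assms by simp
  obtain n where n: "(t - s) / \<delta> < real n" using reals_Archimedean2 by blast
  then have n0: "0 < n" using st assms by (metis divide_pos_pos diff_gt_0_iff_gt gr0I less_asym of_nat_0)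
  define \<tau> where "\<tau> i = s + (t - s) * real i / real n" for i
  have d: "\<tau> (Suc i) - \<tau> i = (t - s) / real n" for i
  proof -
    have "\<tau> (Suc i) - \<tau> i = ((t - s) * (real i + 1) - (t - s) * real i) / real n"
      by (simp add: \<tau>_def diff_divide_distrib add.commute)
    also have "(t - s) * (real i + 1) - (t - s) * real i = t - s"
      by (simp add: algebra_simps)
    finally show ?thesis .
  qed
  moreover have "(t - s) / real n < \<delta>" using n n0 assms by (simp add: field_simps)
  moreover have "0 < (t - s) / real n" using st n0 by simp
  ultimately have "\<tau> i < \<tau> (Suc i) \<and> \<tau> (Suc i) - \<tau> i < \<delta>" for i
    using d[of i] by linarith
  moreover have "\<tau> 0 = s" "\<tau> n = t" using n0 by (simp_all add: \<tau>_def)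
  ultimately show ?thesis by (intro exI[of _ n] exI[of _ \<tau>]) simp
qed

lemma has_rough_integral_mesh:
  assumes "has_rough_integral X L s t I" "0 < \<epsilon>"
  shows "\<exists>\<delta>>0. \<forall>n. \<forall>\<tau> :: nat \<Rightarrow> real.
        partition s t \<delta> n \<tau> \<longrightarrow> norm (riemann_sum X L n \<tau> - I) < \<epsilon>"
  by (rule mp[OF spec[OF assms(1)[unfolded has_rough_integral_def]] assms(2)])

text \<open>
  If the integrals over all \<open>[0, t]\<close> exist, then partitions of \<open>[0, s]\<close> and of \<open>[s, t]\<close> are joined to one
  of \<open>[0, t]\<close>; the Riemann sum over \<open>[s, t]\<close> is close to the increment of the integral as well as
  to the germ.
\<close>

lemma rough_integral_increment:
  fixes L :: "real \<Rightarrow> 'v::euclidean_space hopf \<Rightarrow> 'e::real_normed_vector"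
  assumes \<theta>: "1 < \<theta>" and K: "0 \<le> K"
    and germ: "\<And>s u t. 0 \<le> s \<Longrightarrow> s < u \<Longrightarrow> u < t \<Longrightarrow> t \<le> T \<Longrightarrow>
      norm (L s (positive_part (X s t)) - L s (positive_part (X s u)) - L u (positive_part (X u t))) \<le> K * \<omega> s t powr \<theta>"
    and int: "\<And>t. t \<in> {0..T} \<Longrightarrow> has_rough_integral X L 0 t (Z t)"
  shows "\<exists>C\<ge>0. \<forall>s t. 0 \<le> s \<and> s < t \<and> t \<le> T \<longrightarrow>
    norm (Z t - Z s - L s (positive_part (X s t))) \<le> C * \<omega> s t powr \<theta>"
proof -
  (* The bound on germs concerns s < u < t; on the diagonal the germ is set to 0, the empty sum. *)
  define A where "A s t = (if s = t then 0 else L s (positive_part (X s t)))" for s t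
  define C where "C = 2 * K / (1 - 2 powr (1 - \<theta>))"
  have p1: "2 powr (1 - \<theta>) < (1::real)"
    using powr_less_mono[of "1 - \<theta>" 0 "2::real"] \<theta> by simp
  have C0: "0 \<le> C" using p1 K by (simp add: C_def)
  have gA: "norm (A s t - A s u - A u t) \<le> K * \<omega> s t powr \<theta>" if "0 \<le> s" "s \<le> u" "u \<le> t" "t \<le> T" for s u t
    using that germ[of s u t] K by (auto simp: A_def order_le_less)
  have "norm (Z t - Z s - L s (positive_part (X s t))) \<le> C * \<omega> s t powr \<theta>" if st: "0 \<le> s" "s < t" "t \<le> T" for s t
  proof (rule field_le_epsilon)
    fix \<epsilon> :: real assume \<epsilon>: "0 < \<epsilon>"
    then have \<epsilon>2: "0 < \<epsilon> / 2" by simp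
    have "s \<in> {0..T}" using st by auto
    from has_rough_integral_mesh[OF int[OF this] \<epsilon>2]
    obtain \<delta>1 where d1: "0 < \<delta>1" "\<forall>n. \<forall>\<tau> :: nat \<Rightarrow> real. partition 0 s \<delta>1 n \<tau> \<longrightarrow>
        norm (riemann_sum X L n \<tau> - Z s) < \<epsilon> / 2"
      by (elim exE conjE)
    note mesh_s = d1(2)[THEN spec, THEN spec, THEN mp]
    have "t \<in> {0..T}" using st by auto
    from has_rough_integral_mesh[OF int[OF this] \<epsilon>2]
    obtain \<delta>2 where d2: "0 < \<delta>2" "\<forall>n. \<forall>\<tau> :: nat \<Rightarrow> real. partition 0 t \<delta>2 n \<tau> \<longrightarrow>
        norm (riemann_sum X L n \<tau> - Z t) < \<epsilon> / 2"
      by (elim exE conjE)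
    note mesh_t = d2(2)[THEN spec, THEN spec, THEN mp]
    define \<delta> where "\<delta> = min \<delta>1 \<delta>2"
    have \<delta>: "0 < \<delta>" using d1 d2 by (simp add: \<delta>_def)
    from partition_exists[OF st(1) \<delta>] obtain n \<tau>1 where n: "\<tau>1 0 = 0" "\<tau>1 n = s" "\<forall>i<n. \<tau>1 i < \<tau>1 (Suc i) \<and> \<tau>1 (Suc i) - \<tau>1 i < \<delta>"
      by (elim exE conjE)
    from partition_exists[OF less_imp_le[OF st(2)] \<delta>] obtain m \<tau>2 where m: "\<tau>2 0 = s" "\<tau>2 m = t" "\<forall>i<m. \<tau>2 i < \<tau>2 (Suc i) \<and> \<tau>2 (Suc i) - \<tau>2 i < \<delta>"
      by (elim exE conjE)
    define \<tau> where "\<tau> i = (if i \<le> n then \<tau>1 i else if i \<le> n + m then \<tau>2 (i - n) else t)" for i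
    have \<tau>n: "\<tau> (n + i) = \<tau>2 i" if "i \<le> m" for i
      using that n m by (cases i) (auto simp: \<tau>_def)
    have step1: "\<tau> i = \<tau>1 i \<and> \<tau> (Suc i) = \<tau>1 (Suc i)" if "i < n" for i
      using that by (simp add: \<tau>_def)
    have step2: "\<tau> (n + i) = \<tau>2 i \<and> \<tau> (Suc (n + i)) = \<tau>2 (Suc i)" if "i < m" for i
      using \<tau>n[of i] \<tau>n[of "Suc i"] that by simp
    have part: "\<tau> i < \<tau> (Suc i) \<and> \<tau> (Suc i) - \<tau> i < \<delta>" if "i < n + m" for i
    proof (cases "i < n")
      case True
      then show ?thesis using n(3) step1[OF True] by simp
    next
      case False
      define j where "j = i - n"
      have j: "i = n + j" "j < m" using that False by (auto simp: j_def)
      show ?thesis using m(3) step2[OF j(2)] j by simp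
    qed
    have last: "\<tau> i = t" if "n + m \<le> i" for i
    proof (cases "i = n + m")
      case True
      then show ?thesis using \<tau>n[of m] m(2) by simp
    next
      case False
      then show ?thesis using that by (simp add: \<tau>_def)
    qed
    have stepmono: "\<tau> i \<le> \<tau> (Suc i)" for i
    proof (cases "i < n + m")
      case True
      then show ?thesis using part[of i] by simp
    next
      case False
      then show ?thesis using last[of i] last[of "Suc i"] by simp
    qed
    have mono: "\<tau> i \<le> \<tau> j" if "i \<le> j" for i j
      using stepmono that by (rule lift_Suc_mono_le)
    have rng: "\<tau> i \<in> {0..T}" for i
    proof -
      have "\<tau> 0 = 0" using n by (simp add: \<tau>_def)
      moreover have "\<tau> i \<le> \<tau> (i + (n + m))" by (rule mono) simp
      moreover have "\<tau> (i + (n + m)) = t"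
        by (rule last) simp
      ultimately show ?thesis using mono[of 0 i] st by simp
    qed
    let ?l = "\<lambda>i. L (\<tau> i) (positive_part (X (\<tau> i) (\<tau> (Suc i))))"
    have s1: "norm ((\<Sum>i<n. ?l i) - Z s) < \<epsilon> / 2"
    proof -
      have "(\<Sum>i<n. ?l i) = (\<Sum>i<n. L (\<tau>1 i) (positive_part (X (\<tau>1 i) (\<tau>1 (Suc i)))))"
        by (intro sum.cong refl) (simp add: step1)
      also have "norm (\<dots> - Z s) < \<epsilon> / 2"
        by (rule mesh_s) (use n in \<open>auto simp: \<delta>_def\<close>)
      finally show ?thesis .
    qed
    have s2: "norm ((\<Sum>i<n + m. ?l i) - Z t) < \<epsilon> / 2"
    proof (rule mesh_t, intro conjI allI impI)
      show "\<tau> 0 = 0" using n by (simp add: \<tau>_def)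
      show "\<tau> (n + m) = t" using \<tau>n[of m] m by simp
      fix i assume "i < n + m"
      from part[OF this] show "\<tau> i < \<tau> (Suc i)" "\<tau> (Suc i) - \<tau> i < \<delta>2" by (auto simp: \<delta>_def)
    qed
    have s3: "norm ((\<Sum>i<m. A (\<tau> (n + i)) (\<tau> (Suc (n + i)))) - A (\<tau> n) (\<tau> (n + m))) \<le> C * \<omega> (\<tau> n) (\<tau> (n + m)) powr \<theta>"
      by (rule sewing_sum_bound[OF \<theta> K _ gA C_def mono rng]) (simp_all add: A_def)
    have e: "\<tau> n = s" "\<tau> (n + m) = t" using \<tau>n[of 0] \<tau>n[of m] m by auto
    have "(\<Sum>i<n + m. ?l i) = (\<Sum>i<n. ?l i) + (\<Sum>i<m. ?l (n + i))"
      by (induction m) (simp_all add: add_ac)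
    moreover have "(\<Sum>i<m. ?l (n + i)) = (\<Sum>i<m. A (\<tau> (n + i)) (\<tau> (Suc (n + i))))"
    proof (intro sum.cong refl)
      fix i assume "i \<in> {..<m}"
      then have "\<tau> (n + i) \<noteq> \<tau> (Suc (n + i))" using part[of "n + i"] by simp
      then show "?l (n + i) = A (\<tau> (n + i)) (\<tau> (Suc (n + i)))" by (simp add: A_def)
    qed
    moreover have "A s t = L s (positive_part (X s t))" using st by (simp add: A_def)
    ultimately have "Z t - Z s - L s (positive_part (X s t)) =
       ((\<Sum>i<n. ?l i) - Z s) - ((\<Sum>i<n + m. ?l i) - Z t) + ((\<Sum>i<m. A (\<tau> (n + i)) (\<tau> (Suc (n + i)))) - A (\<tau> n) (\<tau> (n + m)))"
      by (simp add: e)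
    moreover have "norm (a - b + c) \<le> norm a + norm b + norm c" for a b c :: 'e
      by norm
    ultimately have "norm (Z t - Z s - L s (positive_part (X s t))) \<le>
       norm ((\<Sum>i<n. ?l i) - Z s) + norm ((\<Sum>i<n + m. ?l i) - Z t) +
       norm ((\<Sum>i<m. A (\<tau> (n + i)) (\<tau> (Suc (n + i)))) - A (\<tau> n) (\<tau> (n + m)))"
      by (simp only:)
    then show "norm (Z t - Z s - L s (positive_part (X s t))) \<le> C * \<omega> s t powr \<theta> + \<epsilon>"
      using s1 s2 s3 unfolding e by linarith
  qed
  with C0 show ?thesis by blast
qed

text \<open>
  Conversely, a path whose increments agree with the germ up to \<open>\<omega>\<^sup>\<theta>\<close>, \<open>\<theta> > 1\<close>, is the integral: the
  errors add up to at most \<open>max \<omega>\<^sup>\<theta>\<^sup>-\<^sup>1\<close> times the control of the whole interval.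
\<close>

lemma rough_integral_of_increment:
  fixes L :: "real \<Rightarrow> 'v::euclidean_space hopf \<Rightarrow> 'e::real_normed_vector" and H :: "real \<Rightarrow> 'e"
  assumes \<theta>: "1 < \<theta>" and C: "0 \<le> C"
    and inc: "\<And>s t. 0 \<le> s \<Longrightarrow> s < t \<Longrightarrow> t \<le> T \<Longrightarrow>
      norm (H t - H s - L s (positive_part (X s t))) \<le> C * \<omega> s t powr \<theta>"
    and st: "0 \<le> s" "s \<le> t" "t \<le> T"
  shows "has_rough_integral X L s t (H t - H s)"
  unfolding has_rough_integral_def
proof (intro allI impI)
  fix \<epsilon> :: real assume \<epsilon>: "0 < \<epsilon>"
  define M where "M = C * \<omega> s t"
  have M0: "0 \<le> M" using C control_nonneg[OF st] by (simp add: M_def)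
  define \<eta> where "\<eta> = (\<epsilon> / (M + 1)) powr (1 / (\<theta> - 1))"
  have \<eta>: "0 < \<eta>" using \<epsilon> M0 by (simp add: \<eta>_def)
  have \<eta>p: "\<eta> powr (\<theta> - 1) = \<epsilon> / (M + 1)"
    using \<epsilon> M0 \<theta> by (simp add: \<eta>_def powr_powr)
  let ?D = "{(s, t). 0 \<le> s \<and> s \<le> t \<and> t \<le> T} :: (real \<times> real) set"
  have "compact ?D"
  proof -
    have "?D = ({0..T} \<times> {0..T}) \<inter> {p. fst p \<le> snd p}" by auto
    moreover have "closed {p :: real \<times> real. fst p \<le> snd p}"
      by (intro closed_Collect_le continuous_intros)
    ultimately show ?thesis by (simp add: compact_Times compact_Int_closed)
  qed
  moreover have "continuous_on ?D (\<lambda>(s, t). \<omega> s t)" using \<omega> by (simp add: control_def)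
  ultimately have "uniformly_continuous_on ?D (\<lambda>(s, t). \<omega> s t)"
    by (rule compact_uniformly_continuous[rotated])
  then obtain \<delta> where \<delta>: "0 < \<delta>" "\<And>p q. p \<in> ?D \<Longrightarrow> q \<in> ?D \<Longrightarrow> dist q p < \<delta> \<Longrightarrow>
      dist (case q of (s, t) \<Rightarrow> \<omega> s t) (case p of (s, t) \<Rightarrow> \<omega> s t) < \<eta>"
    using \<eta> unfolding uniformly_continuous_on_def by meson
  have small: "\<omega> u v < \<eta>" if "0 \<le> u" "u \<le> v" "v \<le> T" "v - u < \<delta>" for u v
  proof -
    have "dist (u, v) (u, u) < \<delta>" using that by (simp add: dist_Pair_Pair dist_real_def)
    from \<delta>(2)[OF _ _ this] that control_diag[of u] show ?thesis by (simp add: dist_real_def)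
  qed
  show "\<exists>\<delta>>0. \<forall>n. \<forall>\<tau> :: nat \<Rightarrow> real. partition s t \<delta> n \<tau> \<longrightarrow>
    norm (riemann_sum X L n \<tau> - (H t - H s)) < \<epsilon>"
  proof (intro exI[of _ \<delta>] conjI allI impI \<delta>(1))
    fix n and \<tau> :: "nat \<Rightarrow> real"
    assume *: "\<tau> 0 = s \<and> \<tau> n = t \<and> (\<forall>i<n. \<tau> i < \<tau> (Suc i) \<and> \<tau> (Suc i) - \<tau> i < \<delta>)"
    have ge: "i \<le> n \<Longrightarrow> s \<le> \<tau> i" for i
      by (induction i) (use * in \<open>auto simp: Suc_le_eq intro: order_trans less_imp_le\<close>)
    have le: "i \<le> n \<Longrightarrow> \<tau> (n - i) \<le> t" for i
    proof (induction i)
      case (Suc i)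
      have "\<tau> (n - Suc i) < \<tau> (Suc (n - Suc i))" using * Suc.prems by simp
      moreover have "Suc (n - Suc i) = n - i" using Suc.prems by simp
      ultimately show ?case using Suc by simp
    qed (use * in simp)
    have in_int: "0 \<le> \<tau> i \<and> \<tau> i \<le> T" if "i \<le> n" for i
      using ge[OF that] le[of "n - i"] that st by auto
    have sumw: "m \<le> n \<Longrightarrow> (\<Sum>i<m. \<omega> (\<tau> i) (\<tau> (Suc i))) \<le> \<omega> s (\<tau> m)" for m
    proof (induction m)
      case 0
      then show ?case using * control_diag[of s] st by simp
    next
      case (Suc m)
      have "\<omega> s (\<tau> m) + \<omega> (\<tau> m) (\<tau> (Suc m)) \<le> \<omega> s (\<tau> (Suc m))"
        using Suc.prems ge[of m] * in_int[of "Suc m"] st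
        by (intro control_superadd) (auto simp: Suc_le_eq intro: less_imp_le)
      then show ?case using Suc by simp
    qed
    have tele: "(\<Sum>i<n. H (\<tau> (Suc i)) - H (\<tau> i)) = H t - H s"
      using * sum_lessThan_telescope[of "\<lambda>i. H (\<tau> i)" n] by simp
    have "norm (riemann_sum X L n \<tau> - (H t - H s))
      = norm (\<Sum>i<n. H (\<tau> (Suc i)) - H (\<tau> i) - L (\<tau> i) (positive_part (X (\<tau> i) (\<tau> (Suc i)))))"
      unfolding tele[symmetric] by (subst norm_minus_commute) (simp add: sum_subtractf)
    also have "\<dots> \<le> (\<Sum>i<n. C * \<omega> (\<tau> i) (\<tau> (Suc i)) powr \<theta>)"
      using * in_int by (intro order_trans[OF norm_sum] sum_mono inc) (auto simp: Suc_le_eq)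
    also have "\<dots> \<le> (\<Sum>i<n. C * (\<omega> (\<tau> i) (\<tau> (Suc i)) * \<eta> powr (\<theta> - 1)))"
    proof (intro sum_mono mult_left_mono C)
      fix i assume i: "i \<in> {..<n}"
      let ?w = "\<omega> (\<tau> i) (\<tau> (Suc i))"
      have i': "0 \<le> \<tau> i" "\<tau> i \<le> \<tau> (Suc i)" "\<tau> (Suc i) \<le> T" "\<tau> (Suc i) - \<tau> i < \<delta>"
        using i * in_int[of i] in_int[of "Suc i"] by auto
      have w: "0 \<le> ?w" using i' by (intro control_nonneg) auto
      have "?w powr \<theta> = ?w * ?w powr (\<theta> - 1)"
        using w by (cases "?w = 0") (simp_all add: powr_diff)
      also have "\<dots> \<le> ?w * \<eta> powr (\<theta> - 1)"
        using w \<theta> small[OF i'] by (intro mult_left_mono powr_mono2) auto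
      finally show "?w powr \<theta> \<le> ?w * \<eta> powr (\<theta> - 1)" .
    qed
    also have "\<dots> = C * (\<epsilon> / (M + 1)) * (\<Sum>i<n. \<omega> (\<tau> i) (\<tau> (Suc i)))"
      by (simp add: \<eta>p sum_distrib_left mult_ac)
    also have "\<dots> \<le> C * (\<epsilon> / (M + 1)) * \<omega> s t"
      using sumw[of n] * C \<epsilon> M0 by (intro mult_left_mono) auto
    also have "\<dots> = M * \<epsilon> / (M + 1)" by (simp add: M_def)
    also have "\<dots> < \<epsilon>" using M0 \<epsilon> by (simp add: field_simps)
    finally show "norm (riemann_sum X L n \<tau> - (H t - H s)) < \<epsilon>" .
  qed
qed

end

section \<open>The reduced coproducts of group-like elements\<close>

lemma unshuffle_add_mset:
  "unshuffle (add_mset t f) = (basis_vec ({#t#}, {#}) + basis_vec ({#}, {#t#})) * unshuffle f"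
  by (simp add: unshuffle_def)

lemma keys_unshuffle: "k \<in> supp (unshuffle f) \<Longrightarrow> fst k + snd k = f"
proof (induction f arbitrary: k)
  case empty
  have "unshuffle {#} = (basis_vec ({#}, {#}) :: 'a forests2)"
    by (simp add: unshuffle_def one_forests2)
  with empty show ?case by simp
next
  case (add t f)
  from subsetD[OF keys_mult add.prems[unfolded unshuffle_add_mset]]
  obtain a b where k: "k = a + b" "a \<in> supp (basis_vec ({#t#}, {#}) + basis_vec ({#}, {#t#}) :: 'a forests2)"
    "b \<in> supp (unshuffle f)"
    by (elim CollectE exE conjE)
  from k(2) have "fst a + snd a = {#t#}"
    using keys_add[of "basis_vec ({#t#}, {#})" "basis_vec ({#}, {#t#})"] by auto
  moreover have "fst b + snd b = f" using k(3) by (rule add.IH)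
  ultimately have "(fst a + snd a) + (fst b + snd b) = {#t#} + f" by simp
  then show ?case by (simp add: k(1) add_ac)
qed

lemma lookup_unshuffle:
  "coef (unshuffle (f + g)) (f, g) * (fp f f * fp g g) = fp (f + g) (f + g)"
proof -
  have "fp (f + g) (f + g) = lin (\<lambda>(x, y). fp f x * fp g y) (unshuffle (f + g))"
    by (subst fp_union) (simp only: usum_def)
  moreover have "(\<lambda>(x, y). fp f x * fp g y) = (\<lambda>k. if k = (f, g) then fp f f * fp g g else 0)"
  proof
    fix k
    show "(case k of (x, y) \<Rightarrow> fp f x * fp g y) = (if k = (f, g) then fp f f * fp g g else 0)"
      using fp_orthogonal[of f "fst k"] fp_orthogonal[of g "snd k"] by (cases k) auto
  qed
  ultimately show ?thesis
    by (simp only: lin_delta real_scaleR_def)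
qed

lemma lookup_unshuffle_empty:
  "coef (unshuffle f) (f, {#}) = 1" "coef (unshuffle f) ({#}, f) = 1"
proof -
  have "coef (unshuffle f) (f, {#}) * fp f f = fp f f"
    using lookup_unshuffle[of f "{#}"] by (simp add: fp_empty)
  then show "coef (unshuffle f) (f, {#}) = 1" using fp_pos[of f] by simp
  have "coef (unshuffle f) ({#}, f) * fp f f = fp f f"
    using lookup_unshuffle[of "{#}" f] by (simp add: fp_empty)
  then show "coef (unshuffle f) ({#}, f) = 1" using fp_pos[of f] by simp
qed

lemma keys_reduced_unshuffle:
  assumes f: "f \<noteq> {#}" and k: "k \<in> supp (reduced_unshuffle f)"
  shows "fst k + snd k = f \<and> fst k \<noteq> {#} \<and> snd k \<noteq> {#}"
proof -
  have l: "coef (reduced_unshuffle f) k =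
     coef (unshuffle f) k - (if k = (f, {#}) then 1 else 0) - (if k = ({#}, f) then 1 else 0)"
    by (auto simp: reduced_unshuffle_def lookup_minus lookup_single when_def)
  have "k \<noteq> (f, {#})" "k \<noteq> ({#}, f)"
    using k f by (auto simp: in_keys_iff l lookup_unshuffle_empty)
  moreover from this have "k \<in> supp (unshuffle f)"
    using k by (simp add: in_keys_iff l)
  then have "fst k + snd k = f" by (rule keys_unshuffle)
  ultimately show ?thesis by (cases k) auto
qed

lemma keys_reduced_coproduct:
  "f \<noteq> {#} \<Longrightarrow> hs \<in> supp (reduced_coproduct n f) \<Longrightarrow>
    length hs = n \<and> {#} \<notin> set hs \<and> sum_list hs = f"
proof (induction n f arbitrary: hs rule: reduced_coproduct.induct)
  case (3 n f)
  from keys_lin[OF 3(3)[unfolded reduced_coproduct.simps]]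
  obtain k where k: "k \<in> supp (reduced_unshuffle f)"
    and hs: "hs \<in> supp (lin (\<lambda>hs. basis_vec (fst k # hs)) (reduced_coproduct (Suc n) (snd k)))"
    unfolding case_prod_unfold by (elim bexE)
  from keys_lin[OF hs] obtain hs' where hs': "hs' \<in> supp (reduced_coproduct (Suc n) (snd k))"
    "hs = fst k # hs'" by auto
  note kk = keys_reduced_unshuffle[OF 3(2) k]
  have "length hs' = Suc n \<and> {#} \<notin> set hs' \<and> sum_list hs' = snd k"
    by (rule 3(1)) (use kk hs' in auto)
  with kk hs'(2) show ?case by auto
qed auto

lemma weight_sum_list: "weight (sum_list hs) = sum_list (map weight hs)"
  by (induction hs) simp_all

lemma reduced_coproduct_large:
  assumes "f \<noteq> {#}" "size f < n"
  shows "reduced_coproduct n f = 0"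
proof -
  have "size (sum_list hs) \<ge> length hs" if "{#} \<notin> set hs" for hs :: "'a forest list"
    using that
  proof (induction hs)
    case (Cons h hs)
    then have "size h > 0" by (simp add: nonempty_has_size)
    with Cons show ?case by simp
  qed simp
  then have "hs \<notin> supp (reduced_coproduct n f)" for hs
    using keys_reduced_coproduct[OF assms(1), of hs n] assms(2) by (metis not_less)
  then show ?thesis
    by (intro poly_mapping_eqI) (simp add: in_keys_iff)
qed

lemma faa_di_bruno_cong:
  assumes "x \<in> filtered m" "\<And>g. g \<noteq> {#} \<Longrightarrow> weight g \<le> m \<Longrightarrow> A (basis_vec g) = A' (basis_vec g)"
  shows "faa_di_bruno \<psi> A y x = faa_di_bruno \<psi> A' y x"
  unfolding faa_di_bruno_def
proof (intro lin_cong sum.cong refl arg_cong[where f = "\<lambda>v. _ *\<^sub>R v"])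
  fix f n hs
  assume f: "f \<in> supp x" and n: "n \<in> {1..size f}" and hs: "hs \<in> supp (reduced_coproduct n f)"
  have "f \<noteq> {#}" using n by auto
  from keys_reduced_coproduct[OF this hs] have h: "{#} \<notin> set hs" "sum_list hs = f" by auto
  have "map (\<lambda>g. A (basis_vec g)) hs = map (\<lambda>g. A' (basis_vec g)) hs"
  proof (intro map_cong refl assms(2))
    fix g assume g: "g \<in> set hs"
    then show "g \<noteq> {#}" using h by auto
    have "weight g \<le> sum_list (map weight hs)" using g by (intro member_le_sum_list) auto
    also have "\<dots> \<le> m" using f h(2) assms(1) by (simp add: filtered_def flip: weight_sum_list)
    finally show "weight g \<le> m" .
  qed
  then show "derivs \<psi> (map (\<lambda>g. A (basis_vec g)) hs) y = derivs \<psi> (map (\<lambda>g. A' (basis_vec g)) hs) y"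
    by (simp only:)
qed

definition forests_upto :: "nat \<Rightarrow> 'a forest set" where
  "forests_upto m = {f. weight f \<le> m}"

lemma finite_forests_upto: "finite (forests_upto m :: 'a::finite forest set)"
  unfolding forests_upto_def by (rule finite_forests_weight)

text \<open>
  The numbers \<open>c f\<close> are the coefficients of an element that is group-like up to weight \<open>N\<close>.
\<close>

definition multiplicative_upto :: "nat \<Rightarrow> ('a forest \<Rightarrow> real) \<Rightarrow> bool" where
  "multiplicative_upto N c \<longleftrightarrow> (\<forall>f g. weight f + weight g \<le> N \<longrightarrow>
     c (f + g) * coef (unshuffle (f + g)) (f, g) = c f * c g)"

lemma multiplicative_usum:
  fixes c :: "'a::finite forest \<Rightarrow> real" and K :: "'a forest \<Rightarrow> 'a forest \<Rightarrow> 'e::real_vector"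
  assumes c: "multiplicative_upto N c" and m: "m \<le> N"
  shows "(\<Sum>f\<in>forests_upto m. c f *\<^sub>R usum K f) =
    (\<Sum>g\<in>forests_upto m. \<Sum>h\<in>forests_upto (m - weight g). (c g * c h) *\<^sub>R K g h)"
proof -
  define P where "P = (SIGMA g:(forests_upto m :: 'a forest set). (forests_upto (m - weight g) :: 'a forest set))"
  have finP: "finite P" unfolding P_def by (intro finite_SigmaI finite_forests_upto)
  have P: "k \<in> P \<longleftrightarrow> weight (fst k) + weight (snd k) \<le> m" for k
    unfolding P_def forests_upto_def by (cases k) auto
  have "(\<Sum>f\<in>forests_upto m. c f *\<^sub>R usum K f)
     = (\<Sum>f\<in>forests_upto m. \<Sum>k\<in>P. (c f * coef (unshuffle f) k) *\<^sub>R K (fst k) (snd k))"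
  proof (intro sum.cong refl)
    fix f :: "'a forest" assume f: "f \<in> forests_upto m"
    have "supp (unshuffle f) \<subseteq> P"
    proof
      fix k assume "k \<in> supp (unshuffle f)"
      from keys_unshuffle[OF this] have "weight (fst k) + weight (snd k) = weight f"
        by (metis weight_union)
      with f show "k \<in> P" unfolding P by (simp add: forests_upto_def)
    qed
    show "c f *\<^sub>R usum K f = (\<Sum>k\<in>P. (c f * coef (unshuffle f) k) *\<^sub>R K (fst k) (snd k))"
      unfolding usum_def lin_alt[OF finP \<open>supp (unshuffle f) \<subseteq> P\<close>]
      by (simp add: case_prod_unfold scaleR_sum_right)
  qed
  also have "\<dots> = (\<Sum>k\<in>P. \<Sum>f\<in>forests_upto m. (c f * coef (unshuffle f) k) *\<^sub>R K (fst k) (snd k))"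
    by (rule sum.swap)
  also have "\<dots> = (\<Sum>k\<in>P. (c (fst k) * c (snd k)) *\<^sub>R K (fst k) (snd k))"
  proof (intro sum.cong refl)
    fix k assume k: "k \<in> P"
    let ?f = "fst k + snd k"
    have "(\<Sum>f\<in>forests_upto m. (c f * coef (unshuffle f) k) *\<^sub>R K (fst k) (snd k))
      = (\<Sum>f\<in>forests_upto m. if f = ?f then (c ?f * coef (unshuffle ?f) k) *\<^sub>R K (fst k) (snd k) else 0)"
    proof (intro sum.cong refl)
      fix f
      show "(c f * coef (unshuffle f) k) *\<^sub>R K (fst k) (snd k) = (if f = ?f then (c ?f * coef (unshuffle ?f) k) *\<^sub>R K (fst k) (snd k) else 0)"
      proof (cases "f = ?f")
        case False
        then have "k \<notin> supp (unshuffle f)" using keys_unshuffle[of k f] by auto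
        with False show ?thesis by (simp add: in_keys_iff)
      qed simp
    qed
    also have "\<dots> = (c ?f * coef (unshuffle ?f) k) *\<^sub>R K (fst k) (snd k)"
      using k unfolding P by (simp add: finite_forests_upto) (simp add: forests_upto_def)
    also have "c ?f * coef (unshuffle ?f) k = c (fst k) * c (snd k)"
    proof -
      have "weight (fst k) + weight (snd k) \<le> N" using k m unfolding P by linarith
      then have "c ?f * coef (unshuffle ?f) (fst k, snd k) = c (fst k) * c (snd k)"
        by (rule c[unfolded multiplicative_upto_def, THEN spec, THEN spec, THEN mp])
      then show ?thesis by (simp only: prod.collapse)
    qed
    finally show "(\<Sum>f\<in>forests_upto m. (c f * coef (unshuffle f) k) *\<^sub>R K (fst k) (snd k)) = (c (fst k) * c (snd k)) *\<^sub>R K (fst k) (snd k)" .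
  qed
  also have "\<dots> = (\<Sum>g\<in>forests_upto m. \<Sum>h\<in>forests_upto (m - weight g). (c g * c h) *\<^sub>R K g h)"
    unfolding P_def by (simp add: sum.Sigma finite_forests_upto case_prod_unfold)
  finally show ?thesis .
qed

definition words_upto :: "nat \<Rightarrow> nat \<Rightarrow> 'a forest list set" where
  "words_upto n m = {fs. length fs = n \<and> {#} \<notin> set fs \<and> sum_list (map weight fs) \<le> m}"

lemma words_upto_0: "words_upto 0 m = {[]}"
  by (auto simp: words_upto_def)

lemma words_upto_Suc:
  "words_upto (Suc n) m = (\<lambda>(g, fs). g # fs) ` (SIGMA g:forests_upto m - {{#}}. words_upto n (m - weight g))"
  by (auto simp: words_upto_def forests_upto_def length_Suc_conv image_iff)

lemma words_upto_subset: "words_upto n m \<subseteq> words (forests_upto m - {{#}}) n"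
proof
  fix fs :: "'a forest list" assume fs: "fs \<in> words_upto n m"
  have "weight g \<le> m" if "g \<in> set fs" for g
  proof -
    have "weight g \<le> sum_list (map weight fs)" using that by (intro member_le_sum_list) auto
    then show ?thesis using fs by (simp add: words_upto_def)
  qed
  with fs show "fs \<in> words (forests_upto m - {{#}}) n"
    by (auto simp: words_upto_def words_def forests_upto_def)
qed

lemma finite_words_upto: "finite (words_upto n m :: 'a::finite forest list set)"
  by (rule finite_subset[OF words_upto_subset]) (simp add: finite_words finite_forests_upto)

lemma sum_words_upto_Suc:
  "(\<Sum>fs\<in>words_upto (Suc n) m. h (fs :: 'a::finite forest list)) =
    (\<Sum>g\<in>forests_upto m - {{#}}. \<Sum>fs\<in>words_upto n (m - weight g). h (g # fs))"
proof -
  have inj: "inj_on (\<lambda>(g, fs). g # fs) (SIGMA g:forests_upto m - {{#}} :: 'a forest set. (words_upto n (m - weight g) :: 'a forest list set))"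
    by (auto simp: inj_on_def)
  show ?thesis
    unfolding words_upto_Suc sum.reindex[OF inj]
    by (simp add: sum.Sigma finite_forests_upto finite_words_upto case_prod_unfold)
qed

lemma lin_reduced_coproduct:
  assumes f: "f \<noteq> {#}"
  shows "lin \<Psi> (reduced_coproduct (Suc (Suc n)) f) =
    usum (\<lambda>g h. if g = {#} \<or> h = {#} then 0 else lin (\<lambda>hs. \<Psi> (g # hs)) (reduced_coproduct (Suc n) h)) f"
proof -
  let ?R = "\<lambda>g h. lin (\<lambda>hs. \<Psi> (g # hs)) (reduced_coproduct (Suc n) h)"
  let ?K = "\<lambda>g h. if g = {#} \<or> h = {#} then 0 else ?R g h"
  have "lin \<Psi> (reduced_coproduct (Suc (Suc n)) f) = lin (\<lambda>(g, h). ?R g h) (reduced_unshuffle f)"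
    by (simp add: lin_lin case_prod_unfold)
  also have "\<dots> = usum ?R f - ?R f {#} - ?R {#} f"
    by (simp add: reduced_unshuffle_def lin_diff usum_def)
  also have "usum ?R f = usum (\<lambda>g h. ?K g h + ((if g = {#} then ?R {#} h else 0) + (if h = {#} then ?R g {#} else 0))) f"
    using f by (intro usum_cong) auto
  also have "\<dots> = usum ?K f + (usum (\<lambda>g h. if g = {#} then ?R {#} h else 0) f + usum (\<lambda>g h. if h = {#} then ?R g {#} else 0) f)"
    by (simp only: usum_plus)
  also have "usum (\<lambda>g h. if g = {#} then ?R {#} h else 0) f = ?R {#} f"
    by (rule usum_unit)
  also have "usum (\<lambda>g h. if h = {#} then ?R g {#} else 0) f = ?R f {#}"
    by (subst usum_commute) (rule usum_unit)
  finally show ?thesis by simp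
qed

text \<open>
  Iterating, the \<open>n\<close>-fold reduced coproduct of a group-like element is the \<open>n\<close>-fold tensor power of
  its positive part, restricted to total weight at most \<open>N\<close>.
\<close>

lemma multiplicative_reduced_coproduct:
  fixes c :: "'a::finite forest \<Rightarrow> real" and \<Psi> :: "'a forest list \<Rightarrow> 'e::real_vector"
  assumes c: "multiplicative_upto N c"
  shows "m \<le> N \<Longrightarrow> (\<Sum>f\<in>forests_upto m - {{#}}. c f *\<^sub>R lin \<Psi> (reduced_coproduct (Suc n) f)) =
    (\<Sum>fs\<in>words_upto (Suc n) m. prod_list (map c fs) *\<^sub>R \<Psi> fs)"
proof (induction n arbitrary: m \<Psi>)
  case 0
  show ?case by (simp add: sum_words_upto_Suc words_upto_0)
next
  case (Suc n)
  let ?R = "\<lambda>g h. lin (\<lambda>hs. \<Psi> (g # hs)) (reduced_coproduct (Suc n) h)"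
  let ?K = "\<lambda>g h. if g = {#} \<or> h = {#} then 0 else ?R g h"
  have "(\<Sum>f\<in>forests_upto m - {{#}}. c f *\<^sub>R lin \<Psi> (reduced_coproduct (Suc (Suc n)) f))
      = (\<Sum>f\<in>forests_upto m - {{#}}. c f *\<^sub>R usum ?K f)"
    by (intro sum.cong refl) (simp only: lin_reduced_coproduct Diff_iff singleton_iff not_False_eq_True simp_thms)
  also have "\<dots> = (\<Sum>f\<in>forests_upto m. c f *\<^sub>R usum ?K f)"
    by (intro sum.mono_neutral_left) (auto simp: finite_forests_upto)
  also have "\<dots> = (\<Sum>g\<in>forests_upto m. \<Sum>h\<in>forests_upto (m - weight g). (c g * c h) *\<^sub>R ?K g h)"
    by (rule multiplicative_usum[OF c Suc.prems])
  also have "\<dots> = (\<Sum>g\<in>forests_upto m - {{#}}. \<Sum>h\<in>forests_upto (m - weight g). (c g * c h) *\<^sub>R ?K g h)"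
    by (intro sum.mono_neutral_right) (auto simp: finite_forests_upto)
  also have "\<dots> = (\<Sum>g\<in>forests_upto m - {{#}}. c g *\<^sub>R (\<Sum>h\<in>forests_upto (m - weight g) - {{#}}. c h *\<^sub>R ?R g h))"
  proof (intro sum.cong refl)
    fix g :: "'a forest" assume g: "g \<in> forests_upto m - {{#}}"
    have "(\<Sum>h\<in>forests_upto (m - weight g). (c g * c h) *\<^sub>R ?K g h) = (\<Sum>h\<in>forests_upto (m - weight g) - {{#}}. (c g * c h) *\<^sub>R ?K g h)"
      by (intro sum.mono_neutral_right) (auto simp: finite_forests_upto)
    also have "\<dots> = (\<Sum>h\<in>forests_upto (m - weight g) - {{#}}. c g *\<^sub>R (c h *\<^sub>R ?R g h))"
      using g by (intro sum.cong refl) auto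
    finally show "(\<Sum>h\<in>forests_upto (m - weight g). (c g * c h) *\<^sub>R ?K g h) = c g *\<^sub>R (\<Sum>h\<in>forests_upto (m - weight g) - {{#}}. c h *\<^sub>R ?R g h)"
      by (simp only: scaleR_sum_right)
  qed
  also have "\<dots> = (\<Sum>g\<in>forests_upto m - {{#}}. c g *\<^sub>R (\<Sum>fs\<in>words_upto (Suc n) (m - weight g). prod_list (map c fs) *\<^sub>R \<Psi> (g # fs)))"
    using Suc.prems by (intro sum.cong refl arg_cong[where f = "\<lambda>v. _ *\<^sub>R v"] Suc.IH) simp
  also have "\<dots> = (\<Sum>fs\<in>words_upto (Suc (Suc n)) m. prod_list (map c fs) *\<^sub>R \<Psi> fs)"
    by (simp add: sum_words_upto_Suc[where n = "Suc n"] scaleR_sum_right)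
  finally show ?case .
qed

lemma lin_positive_part:
  assumes "x \<in> filtered (N :: nat)"
  shows "lin \<phi> (positive_part (x :: 'a::finite forests)) = (\<Sum>f\<in>forests_upto N - {{#}}. coef x f *\<^sub>R \<phi> f)"
proof -
  have k: "supp x \<subseteq> forests_upto N"
    using assms by (auto simp: filtered_def forests_upto_def)
  have "lin \<phi> (positive_part x) = lin (\<lambda>f. if f = {#} then 0 else \<phi> f) x"
    unfolding positive_part_def lin_lin by (intro lin_cong) auto
  also have "\<dots> = (\<Sum>f\<in>forests_upto N. coef x f *\<^sub>R (if f = {#} then 0 else \<phi> f))"
    by (rule lin_alt[OF finite_forests_upto k])
  also have "\<dots> = (\<Sum>f\<in>forests_upto N - {{#}}. coef x f *\<^sub>R \<phi> f)"
    by (intro sum.mono_neutral_cong_right) (auto simp: finite_forests_upto)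
  finally show ?thesis .
qed

lemma faa_di_bruno_group_like:
  fixes x :: "'a::finite forests"
  assumes x: "x \<in> filtered N" and c: "multiplicative_upto N (coef x)"
  shows "faa_di_bruno \<psi> A y (positive_part x) =
    (\<Sum>n=1..N. (1 / fact n) *\<^sub>R (\<Sum>fs\<in>words_upto n N. prod_list (map (coef x) fs) *\<^sub>R
       derivs \<psi> (map (\<lambda>g. A (basis_vec g)) fs) y))"
proof -
  let ?\<Psi> = "\<lambda>hs. derivs \<psi> (map (\<lambda>g. A (basis_vec g)) hs) y"
  let ?c = "coef x"
  have "faa_di_bruno \<psi> A y (positive_part x) =
    (\<Sum>f\<in>forests_upto N - {{#}}. ?c f *\<^sub>R (\<Sum>n=1..size f. (1 / fact n) *\<^sub>R lin ?\<Psi> (reduced_coproduct n f)))"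
    unfolding faa_di_bruno_def by (rule lin_positive_part[OF x])
  also have "\<dots> = (\<Sum>f\<in>forests_upto N - {{#}}. ?c f *\<^sub>R (\<Sum>n=1..N. (1 / fact n) *\<^sub>R lin ?\<Psi> (reduced_coproduct n f)))"
  proof (rule sum.cong[OF refl])
    fix f :: "'a forest" assume f: "f \<in> forests_upto N - {{#}}"
    then have "size f \<le> N" using size_le_weight[of f] by (auto simp: forests_upto_def)
    with f have "(\<Sum>n=1..size f. (1 / fact n) *\<^sub>R lin ?\<Psi> (reduced_coproduct n f)) = (\<Sum>n=1..N. (1 / fact n) *\<^sub>R lin ?\<Psi> (reduced_coproduct n f))"
      by (intro sum.mono_neutral_left) (auto simp: reduced_coproduct_large)
    then show "?c f *\<^sub>R (\<Sum>n=1..size f. (1 / fact n) *\<^sub>R lin ?\<Psi> (reduced_coproduct n f)) =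
        ?c f *\<^sub>R (\<Sum>n=1..N. (1 / fact n) *\<^sub>R lin ?\<Psi> (reduced_coproduct n f))"
      by (simp only:)
  qed
  also have "\<dots> = (\<Sum>n=1..N. \<Sum>f\<in>forests_upto N - {{#}}. ?c f *\<^sub>R ((1 / fact n) *\<^sub>R lin ?\<Psi> (reduced_coproduct n f)))"
    unfolding scaleR_sum_right by (rule sum.swap)
  also have "\<dots> = (\<Sum>n=1..N. (1 / fact n) *\<^sub>R (\<Sum>fs\<in>words_upto n N. prod_list (map ?c fs) *\<^sub>R ?\<Psi> fs))"
  proof (intro sum.cong refl)
    fix n assume "n \<in> {1..N}"
    then obtain k where n: "n = Suc k" by (cases n) auto
    show "(\<Sum>f\<in>forests_upto N - {{#}}. ?c f *\<^sub>R ((1 / fact n) *\<^sub>R lin ?\<Psi> (reduced_coproduct n f))) =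
      (1 / fact n) *\<^sub>R (\<Sum>fs\<in>words_upto n N. prod_list (map ?c fs) *\<^sub>R ?\<Psi> fs)"
      unfolding n multiplicative_reduced_coproduct[OF c le_refl, symmetric]
      by (simp add: scaleR_sum_right mult.commute)
  qed
  finally show ?thesis .
qed

section \<open>Coefficients of a branched rough path\<close>

lemma brp_filtered:
  "branched_rough_path \<rho> T \<omega> X \<Longrightarrow> 0 \<le> s \<Longrightarrow> s \<le> t \<Longrightarrow> t \<le> T \<Longrightarrow> X s t \<in> filtered (nat \<lfloor>\<rho>\<rfloor>)"
  by (simp add: branched_rough_path_def Let_def)

lemma brp_chen:
  "branched_rough_path \<rho> T \<omega> X \<Longrightarrow> 0 \<le> s \<Longrightarrow> s \<le> u \<Longrightarrow> u \<le> t \<Longrightarrow> t \<le> T \<Longrightarrow>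
     X s t = truncate (nat \<lfloor>\<rho>\<rfloor>) (X s u \<star> X u t)"
  unfolding branched_rough_path_def Let_def by blast

lemma brp_empty:
  assumes "branched_rough_path \<rho> T \<omega> X" "0 \<le> s" "s \<le> t" "t \<le> T"
  shows "coef (X s t) {#} = 1"
proof -
  have "pairing 1 (X s t) = 1"
    using assms by (simp add: branched_rough_path_def Let_def)
  then show ?thesis
    unfolding one_forests pairing_basis by (simp add: fp_empty)
qed

text \<open>
  Coefficients are pairings divided by automorphism factors, and the number of ways to split
  \<open>f + g\<close> into \<open>f\<close> and \<open>g\<close> is the quotient of these factors.
\<close>

lemma brp_multiplicative:
  assumes X: "branched_rough_path \<rho> T \<omega> X" and st: "0 \<le> s" "s \<le> t" "t \<le> T"
  shows "multiplicative_upto (nat \<lfloor>\<rho>\<rfloor>) (coef (X s t))"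
  unfolding multiplicative_upto_def
proof (intro allI impI)
  fix f g :: "'a basis forest" assume w: "weight f + weight g \<le> nat \<lfloor>\<rho>\<rfloor>"
  let ?c = "coef (X s t)"
  have "pairing (basis_vec f * basis_vec g) (X s t) = pairing (basis_vec f) (X s t) * pairing (basis_vec g) (X s t)"
    using X st w graded_basis[of f] graded_basis[of g]
    unfolding branched_rough_path_def Let_def by blast
  then have "?c (f + g) * fp (f + g) (f + g) = ?c f * ?c g * (fp f f * fp g g)"
    by (simp add: mult_single pairing_basis mult_ac)
  then have "(?c (f + g) * coef (unshuffle (f + g)) (f, g)) * (fp f f * fp g g) = ?c f * ?c g * (fp f f * fp g g)"
    by (simp only: mult.assoc lookup_unshuffle)
  then show "?c (f + g) * coef (unshuffle (f + g)) (f, g) = ?c f * ?c g"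
    using fp_pos[of f] fp_pos[of g] by simp
qed

lemma brp_bound:
  assumes X: "branched_rough_path \<rho> T \<omega> X" and f: "f \<noteq> {#}" "weight f \<le> nat \<lfloor>\<rho>\<rfloor>"
  shows "\<exists>K\<ge>0. \<forall>s t. 0 \<le> s \<and> s < t \<and> t \<le> T \<longrightarrow>
    \<bar>coef (X s t) f\<bar> \<le> K * \<omega> s t powr (real (weight f) / \<rho>)"
proof -
  have "weight f \<in> {1..nat \<lfloor>\<rho>\<rfloor>}" using f by (metis atLeastAtMost_iff less_one not_less weight_eq_0)
  with X graded_basis[of f] obtain K where K: "\<And>s t. 0 \<le> s \<and> s < t \<and> t \<le> T \<Longrightarrow>
    \<bar>pairing (basis_vec f) (X s t)\<bar> \<le> K * \<omega> s t powr (real (weight f) / \<rho>)"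
    unfolding branched_rough_path_def Let_def by meson
  have "\<bar>coef (X s t) f\<bar> \<le> (\<bar>K\<bar> / fp f f) * \<omega> s t powr (real (weight f) / \<rho>)"
    if "0 \<le> s \<and> s < t \<and> t \<le> T" for s t
  proof -
    have "\<bar>coef (X s t) f\<bar> * fp f f \<le> K * \<omega> s t powr (real (weight f) / \<rho>)"
      using K[OF that] fp_pos[of f] by (simp add: pairing_basis abs_mult)
    also have "\<dots> \<le> \<bar>K\<bar> * \<omega> s t powr (real (weight f) / \<rho>)"
      by (intro mult_right_mono) auto
    finally show ?thesis using fp_pos[of f] by (simp add: field_simps)
  qed
  then show ?thesis using fp_pos[of f] by (intro exI[of _ "\<bar>K\<bar> / fp f f"]) auto
qed

section \<open>Orders of growth\<close>

text \<open>As in the growth condition on rough paths, only \<open>s < t\<close> is considered.\<close>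

locale growth_order = regular_control T \<omega> for T \<omega> +
  fixes \<rho> :: real
  assumes \<rho>0: "0 < \<rho>"
begin

definition bounded_by :: "real \<Rightarrow> nat \<Rightarrow> (real \<Rightarrow> real \<Rightarrow> 'e::real_normed_vector) \<Rightarrow> bool" where
  "bounded_by K r G \<longleftrightarrow> 0 \<le> K \<and>
     (\<forall>s t. 0 \<le> s \<longrightarrow> s < t \<longrightarrow> t \<le> T \<longrightarrow> norm (G s t) \<le> K * \<omega> s t powr (real r / \<rho>))"

definition of_order :: "nat \<Rightarrow> (real \<Rightarrow> real \<Rightarrow> 'e::real_normed_vector) \<Rightarrow> bool" where
  "of_order r G \<longleftrightarrow> (\<exists>K. bounded_by K r G)"

lemma of_orderI:
  assumes "0 \<le> K" "\<And>s t. 0 \<le> s \<Longrightarrow> s < t \<Longrightarrow> t \<le> T \<Longrightarrow> norm (G s t) \<le> K * \<omega> s t powr (real r / \<rho>)"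
  shows "of_order r G"
  unfolding of_order_def bounded_by_def using assms by (intro exI[of _ K]) simp

lemma bounded_by_nonneg: "bounded_by K r G \<Longrightarrow> 0 \<le> K"
  by (simp add: bounded_by_def)

lemma bounded_byD:
  "bounded_by K r G \<Longrightarrow> 0 \<le> s \<Longrightarrow> s < t \<Longrightarrow> t \<le> T \<Longrightarrow> norm (G s t) \<le> K * \<omega> s t powr (real r / \<rho>)"
  by (simp add: bounded_by_def)

lemma of_order_zero: "of_order r (\<lambda>s t. 0)"
  by (rule of_orderI[of 0]) simp_all

lemma of_order_add:
  assumes "of_order r G" "of_order r H"
  shows "of_order r (\<lambda>s t. G s t + H s t)"
proof -
  obtain K M where K: "bounded_by K r G" and M: "bounded_by M r H"
    using assms unfolding of_order_def by (elim exE)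
  show ?thesis
  proof (rule of_orderI[of "K + M"])
    fix s t :: real assume st: "0 \<le> s" "s < t" "t \<le> T"
    show "norm (G s t + H s t) \<le> (K + M) * \<omega> s t powr (real r / \<rho>)"
      using norm_triangle_ineq[of "G s t" "H s t"] bounded_byD[OF K st] bounded_byD[OF M st]
      by (simp add: distrib_right)
  qed (use bounded_by_nonneg[OF K] bounded_by_nonneg[OF M] in simp)
qed

lemma of_order_dominated:
  assumes G: "of_order r G"
    and le: "\<And>s t. 0 \<le> s \<Longrightarrow> s < t \<Longrightarrow> t \<le> T \<Longrightarrow> norm (H s t) \<le> B * norm (G s t)"
  shows "of_order r H"
proof -
  obtain K where K: "bounded_by K r G"
    using G unfolding of_order_def by (elim exE)
  show ?thesis
  proof (rule of_orderI[of "\<bar>B\<bar> * K"])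
    fix s t :: real assume st: "0 \<le> s" "s < t" "t \<le> T"
    have "norm (H s t) \<le> \<bar>B\<bar> * norm (G s t)"
      by (rule order_trans[OF le[OF st] mult_right_mono[OF abs_ge_self norm_ge_zero]])
    also have "\<dots> \<le> \<bar>B\<bar> * (K * \<omega> s t powr (real r / \<rho>))"
      by (intro mult_left_mono bounded_byD[OF K] st) simp
    finally show "norm (H s t) \<le> \<bar>B\<bar> * K * \<omega> s t powr (real r / \<rho>)" by (simp add: mult.assoc)
  qed (use bounded_by_nonneg[OF K] in simp)
qed

lemma of_order_cong:
  assumes "of_order r G" "\<And>s t. 0 \<le> s \<Longrightarrow> s < t \<Longrightarrow> t \<le> T \<Longrightarrow> H s t = G s t"
  shows "of_order r H"
  by (rule of_order_dominated[OF assms(1), where B = 1]) (simp add: assms(2))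

lemma of_order_scaleR:
  assumes "of_order r G"
  shows "of_order r (\<lambda>s t. c *\<^sub>R G s t)"
  by (rule of_order_dominated[OF assms, where B = "\<bar>c\<bar>"]) simp

lemma of_order_sum: "(\<And>a. a \<in> A \<Longrightarrow> of_order r (G a)) \<Longrightarrow> of_order r (\<lambda>s t. \<Sum>a\<in>A. G a s t)"
  by (induction A rule: infinite_finite_induct) (simp_all add: of_order_zero of_order_add)

lemma of_order_weaken:
  assumes r: "0 < r'" "r' \<le> r" and G: "of_order r G"
  shows "of_order r' G"
proof -
  obtain K where K: "bounded_by K r G"
    using G unfolding of_order_def by (elim exE)
  let ?a = "real r / \<rho> - real r' / \<rho>"
  have a: "0 \<le> ?a" using r \<rho>0 by (simp add: divide_right_mono)
  show ?thesis
  proof (rule of_orderI[of "K * \<omega> 0 T powr ?a"])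
    fix s t :: real assume st: "0 \<le> s" "s < t" "t \<le> T"
    have w: "0 \<le> \<omega> s t" "\<omega> s t \<le> \<omega> 0 T"
      using st by (auto intro!: control_nonneg control_mono)
    have "\<omega> s t powr (real r / \<rho>) = \<omega> s t powr ?a * \<omega> s t powr (real r' / \<rho>)"
      by (simp flip: powr_add)
    also have "\<dots> \<le> \<omega> 0 T powr ?a * \<omega> s t powr (real r' / \<rho>)"
      using w a by (intro mult_right_mono powr_mono2) auto
    finally have "K * \<omega> s t powr (real r / \<rho>) \<le> K * (\<omega> 0 T powr ?a * \<omega> s t powr (real r' / \<rho>))"
      using bounded_by_nonneg[OF K] by (rule mult_left_mono)
    with bounded_byD[OF K st] show "norm (G s t) \<le> K * \<omega> 0 T powr ?a * \<omega> s t powr (real r' / \<rho>)"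
      by (simp add: mult.assoc)
  qed (use bounded_by_nonneg[OF K] in simp)
qed

lemma of_order_times:
  fixes G H :: "real \<Rightarrow> real \<Rightarrow> real"
  assumes "of_order r G" "of_order r' H"
  shows "of_order (r + r') (\<lambda>s t. G s t * H s t)"
proof -
  obtain K M where K: "bounded_by K r G" and M: "bounded_by M r' H"
    using assms unfolding of_order_def by (elim exE)
  show ?thesis
  proof (rule of_orderI[of "K * M"])
    fix s t :: real assume st: "0 \<le> s" "s < t" "t \<le> T"
    have "norm (G s t * H s t) \<le> (K * \<omega> s t powr (real r / \<rho>)) * (M * \<omega> s t powr (real r' / \<rho>))"
      unfolding norm_mult using bounded_by_nonneg[OF K]
      by (intro mult_mono bounded_byD[OF K] bounded_byD[OF M] st) auto
    then show "norm (G s t * H s t) \<le> K * M * \<omega> s t powr (real (r + r') / \<rho>)"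
      by (simp add: add_divide_distrib powr_add mult_ac)
  qed (use bounded_by_nonneg[OF K] bounded_by_nonneg[OF M] in simp)
qed

lemma of_order_power:
  fixes v :: "real \<Rightarrow> real \<Rightarrow> 'e::real_normed_vector"
  assumes "of_order 1 v"
  shows "of_order (Suc n) (\<lambda>s t. norm (v s t) ^ Suc n)"
proof (induction n)
  case 0
  show ?case using of_order_dominated[OF assms, where B = 1 and H = "\<lambda>s t. norm (v s t) ^ Suc 0"] by simp
next
  case (Suc n)
  have "of_order 1 (\<lambda>s t. norm (v s t))"
    using of_order_dominated[OF assms, where B = 1 and H = "\<lambda>s t. norm (v s t)"] by simp
  from of_order_times[OF this Suc] show ?case by simp
qed

lemma of_order_prod_list:
  fixes x :: "'j \<Rightarrow> real \<Rightarrow> real \<Rightarrow> real"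
  assumes "fs \<noteq> []" "\<And>f. f \<in> set fs \<Longrightarrow> of_order (r f) (x f)"
  shows "of_order (sum_list (map r fs)) (\<lambda>s t. prod_list (map (\<lambda>f. x f s t) fs))"
  using assms
proof (induction fs rule: list_nonempty_induct)
  case (cons f fs)
  from of_order_times[OF cons.prems[of f] cons.IH] cons.prems show ?case by simp
qed simp

lemma approx_order_of_order:
  assumes "approx_order \<rho> T \<omega> m a b"
  shows "of_order m (\<lambda>s t. a s t - b s t)"
proof -
  from assms obtain K where K: "\<forall>s t. 0 \<le> s \<and> s \<le> t \<and> t \<le> T \<longrightarrow> norm (a s t - b s t) \<le> K * \<omega> s t powr (real m / \<rho>)"
    unfolding approx_order_def by (elim exE)
  show ?thesis
  proof (rule of_orderI[of "\<bar>K\<bar>"])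
    fix s t :: real assume st: "0 \<le> s" "s < t" "t \<le> T"
    then have "norm (a s t - b s t) \<le> K * \<omega> s t powr (real m / \<rho>)" using K by simp
    also have "\<dots> \<le> \<bar>K\<bar> * \<omega> s t powr (real m / \<rho>)" by (intro mult_right_mono) auto
    finally show "norm (a s t - b s t) \<le> \<bar>K\<bar> * \<omega> s t powr (real m / \<rho>)" .
  qed simp
qed

lemma approx_order_bounded:
  fixes h :: "real \<Rightarrow> 'e::real_normed_vector"
  assumes "approx_order \<rho> T \<omega> m (\<lambda>s t. h t) (\<lambda>s t. h s)"
  shows "\<exists>B. \<forall>t\<in>{0..T}. norm (h t) \<le> B"
proof -
  from assms obtain K where K: "\<forall>s t. 0 \<le> s \<and> s \<le> t \<and> t \<le> T \<longrightarrow> norm (h t - h s) \<le> K * \<omega> s t powr (real m / \<rho>)"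
    unfolding approx_order_def by (elim exE)
  have "norm (h t) \<le> norm (h 0) + \<bar>K\<bar> * \<omega> 0 T powr (real m / \<rho>)" if t: "t \<in> {0..T}" for t
  proof -
    have "norm (h t - h 0) \<le> K * \<omega> 0 t powr (real m / \<rho>)" using K t by simp
    also have "\<dots> \<le> \<bar>K\<bar> * \<omega> 0 t powr (real m / \<rho>)" by (intro mult_right_mono) auto
    also have "\<dots> \<le> \<bar>K\<bar> * \<omega> 0 T powr (real m / \<rho>)"
      using t \<rho>0 by (intro mult_left_mono powr_mono2) (auto intro!: control_nonneg control_mono)
    finally show ?thesis using norm_triangle_ineq2[of "h t" "h 0"] by linarith
  qed
  then show ?thesis by (intro exI ballI)
qed

end

section \<open>Truncation and linear maps on subspaces\<close>

lemma linear_truncate: "linear (truncate n)"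
  unfolding truncate_def by (rule linear_lin)

lemma truncate_filtered: "x \<in> filtered n \<Longrightarrow> truncate n x = x"
proof -
  assume "x \<in> filtered n"
  then have "truncate n x = lin basis_vec x"
    unfolding truncate_def by (intro lin_cong) (simp add: filtered_def)
  then show ?thesis by (simp flip: poly_mapping_decomp)
qed

lemma truncate_graded: "x \<in> graded k \<Longrightarrow> truncate n x = (if k \<le> n then x else 0)"
proof (cases "k \<le> n")
  case True
  assume "x \<in> graded k"
  with True show ?thesis by (simp add: truncate_filtered filtered_def graded_def)
next
  case False
  assume "x \<in> graded k"
  then have "truncate n x = lin (\<lambda>f. 0) x"
    using False unfolding truncate_def by (intro lin_cong) (simp add: graded_def)
  with False show ?thesis by simp
qed

lemma truncate_in_filtered: "truncate n x \<in> filtered n"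
  unfolding filtered_def truncate_def by (auto dest!: keys_lin split: if_splits)

lemma graded_filtered: "x \<in> graded k \<Longrightarrow> k \<le> n \<Longrightarrow> x \<in> filtered n"
  by (auto simp: graded_def filtered_def)

lemma subspace_filtered: "subspace (filtered n)"
  unfolding subspace_def filtered_def
proof safe
  fix x y :: "'a forests" and f
  assume "\<forall>f\<in>supp x. weight f \<le> n" "\<forall>f\<in>supp y. weight f \<le> n" "f \<in> supp (x + y)"
  then show "weight f \<le> n" using keys_add[of x y] by auto
qed (auto simp: in_keys_iff)

lemma filtered_expand:
  assumes "x \<in> filtered (N :: nat)"
  shows "lin \<phi> (x :: 'a::finite forests) = (\<Sum>f\<in>forests_upto N. coef x f *\<^sub>R \<phi> f)"
  using assms by (intro lin_alt finite_forests_upto) (auto simp: filtered_def forests_upto_def)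

lemma truncate_gl:
  assumes "q \<in> graded b" "b \<le> (N :: nat)"
  shows "truncate N (y \<star> q) = truncate (N - b) y \<star> (q :: 'a::finite forests)"
proof -
  have y: "y \<star> q = lin (\<lambda>f. basis_vec f \<star> q) y"
    by (rule linear_ext_lin[OF linear_gl_left])
  have "truncate N (y \<star> q) = lin (\<lambda>f. truncate N (basis_vec f \<star> q)) y"
    unfolding y by (rule linear_of_lin[OF linear_truncate])
  also have "\<dots> = lin (\<lambda>f. (if weight f \<le> N - b then basis_vec f else 0) \<star> q) y"
    using assms(2)
    by (intro lin_cong) (auto simp: truncate_graded[OF gl_graded[OF graded_basis assms(1)]] linear_0[OF linear_gl_left])
  also have "\<dots> = truncate (N - b) y \<star> q"
    unfolding truncate_def by (rule linear_of_lin[OF linear_gl_left, symmetric])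
  finally show ?thesis .
qed

lemma gl_nonempty: "q \<in> graded b \<Longrightarrow> 0 < b \<Longrightarrow> y \<star> q \<in> nonempty_span"
proof -
  assume q: "q \<in> graded b" "0 < b"
  have "y \<star> q = lin (\<lambda>f. basis_vec f \<star> q) y"
    by (rule linear_ext_lin[OF linear_gl_left])
  also have "\<dots> \<in> nonempty_span"
  proof (intro lin_in_subspace subspace_nonempty_span)
    show "basis_vec f \<star> q \<in> nonempty_span" for f
      using q by (intro graded_nonempty[OF gl_graded[OF graded_basis q(1)]]) simp
  qed
  finally show ?thesis .
qed

lemma linear_on_lin:
  assumes L: "linear_on S L" and S: "subspace S" and k: "\<And>k. k \<in> supp x \<Longrightarrow> basis_vec k \<in> S"
  shows "L x = lin (\<lambda>k. L (basis_vec k)) x"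
proof -
  have L0: "L 0 = 0"
  proof -
    have "L (0 *\<^sub>R 0) = 0 *\<^sub>R L 0"
      using L subspace_0[OF S] unfolding linear_on_def by blast
    then show ?thesis by simp
  qed
  have "L (\<Sum>k\<in>A. c k *\<^sub>R basis_vec k) = (\<Sum>k\<in>A. c k *\<^sub>R L (basis_vec k))" if "finite A" "A \<subseteq> supp x" for A c
    using that
  proof (induction A rule: finite_induct)
    case (insert a A)
    have "c a *\<^sub>R basis_vec a \<in> S" using insert k by (intro subspace_scale[OF S]) auto
    moreover have "(\<Sum>k\<in>A. c k *\<^sub>R basis_vec k) \<in> S"
      using insert k by (intro subspace_sum[OF S] subspace_scale[OF S]) auto
    moreover have "basis_vec a \<in> S" using insert k by auto
    ultimately show ?case using insert L by (simp add: linear_on_def)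
  qed (simp add: L0)
  from this[OF finite_keys order_refl, of "coef x"]
  have "L (lin basis_vec x) = lin (\<lambda>k. L (basis_vec k)) x"
    unfolding lin_def .
  then show ?thesis
    unfolding poly_mapping_decomp[of x, symmetric] .
qed

lemma linear_on_zero: "linear_on S L \<Longrightarrow> subspace S \<Longrightarrow> L 0 = 0"
  using subspace_0[of S] unfolding linear_on_def by (metis scaleR_zero_left)

lemma positive_part_nonempty: "positive_part x \<in> nonempty_span"
  unfolding positive_part_def
  by (intro lin_in_subspace subspace_nonempty_span) (simp add: nonempty_span_def lookup_single when_def)

lemma positive_part_filtered: "x \<in> filtered n \<Longrightarrow> positive_part x \<in> filtered n"
  unfolding positive_part_def
  by (intro lin_in_subspace subspace_filtered) (auto simp: filtered_def)

lemma prod_list_map_mono: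
  assumes "\<And>f. f \<in> set fs \<Longrightarrow> 0 \<le> a f \<and> a f \<le> (b f :: real)"
  shows "prod_list (map a fs) \<le> prod_list (map b fs) \<and> 0 \<le> prod_list (map a fs)"
  using assms
proof (induction fs)
  case (Cons f fs)
  then have "0 \<le> a f \<and> a f \<le> b f" "prod_list (map a fs) \<le> prod_list (map b fs) \<and> 0 \<le> prod_list (map a fs)"
    by simp_all
  then show ?case by (auto intro!: mult_mono)
qed simp

lemma gl_generated_induct:
  fixes x :: "'a::finite forests"
  assumes n: "0 < n" and x: "x \<in> graded n" and zero: "P 0"
    and step: "\<And>c h q a b y. h \<in> graded a \<Longrightarrow> q \<in> gl_generators \<Longrightarrow> q \<in> graded b \<Longrightarrow> a + b = n \<Longrightarrow> 0 < b \<Longrightarrow>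
      y \<in> graded n \<Longrightarrow> P y \<Longrightarrow> P (c *\<^sub>R (h \<star> q) + y)"
  shows "P x"
proof -
  have "x \<in> graded n \<and> P x"
    using gl_generated[OF n x]
  proof (induction rule: span_induct_alt)
    case base
    then show ?case using zero subspace_0[OF subspace_graded] by simp
  next
    case (step c z y)
    then obtain h q a b where z: "z = h \<star> q" "h \<in> graded a" "q \<in> gl_generators" "q \<in> graded b" "a + b = n" "0 < b"
      by (elim CollectE exE conjE)
    have "z \<in> graded n" using gl_graded[OF z(2,4)] z(1,5) by simp
    then have "c *\<^sub>R z + y \<in> graded n"
      using step by (intro subspace_add[OF subspace_graded] subspace_scale[OF subspace_graded]) auto
    moreover have "P (c *\<^sub>R z + y)"
      unfolding z(1) using step assms(4)[OF z(2-6)] by blast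
    ultimately show ?case by blast
  qed
  then show ?thesis by simp
qed

section \<open>Solutions of rough differential equations\<close>

text \<open>
  The data of a solution, unpacked: \<open>L u\<close> is the linear map on \<open>(\<H>\<^sub>G\<^sub>L)\<^sub>+\<close> associated with the
  integrand \<open>F(\<Y>)\<close> at time \<open>u\<close>, and \<open>Z\<close> is its integral.
\<close>

locale rough_solution = growth_order T \<omega> \<rho> for T \<omega> \<rho> +
  fixes X :: "real \<Rightarrow> real \<Rightarrow> 'v::euclidean_space hopf"
    and F Fhat :: "'v hopf \<Rightarrow> 'w::euclidean_space \<Rightarrow> 'w" and Y :: "real \<Rightarrow> 'w"
    and \<Y> Z L :: "real \<Rightarrow> 'v hopf \<Rightarrow> 'w" and N :: nat
  assumes \<rho>: "1 \<le> \<rho>" and N: "N = nat \<lfloor>\<rho>\<rfloor>"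
    and X: "branched_rough_path \<rho> T \<omega> X" and Fhat: "F_hat F Fhat"
    and \<Y>: "controlled_path \<rho> T \<omega> X N \<Y>"
    and integrand: "controlled_integrand \<rho> T \<omega> X (\<lambda>u q. compose_controlled N (F q) (\<Y> u))"
    and L: "\<And>u. u \<in> {0..T} \<Longrightarrow> integrand_map N (\<lambda>q. compose_controlled N (F q) (\<Y> u)) (L u)"
    and Z_int: "\<And>t. t \<in> {0..T} \<Longrightarrow> has_rough_integral X L 0 t (Z t 1)"
    and Z_L: "\<And>t h. t \<in> {0..T} \<Longrightarrow> h \<in> nonempty_span \<Longrightarrow> h \<in> filtered N \<Longrightarrow> Z t h = L t h"
    and Y: "\<And>t. t \<in> {0..T} \<Longrightarrow> \<Y> t 1 = Y t"
    and Y_Z: "\<And>s t. s \<in> {0..T} \<Longrightarrow> t \<in> {0..T} \<Longrightarrow> Y t - Y s = Z t 1 - Z s 1"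
    and \<Y>_Z: "\<And>t h. t \<in> {0..T} \<Longrightarrow> h \<in> nonempty_span \<Longrightarrow> h \<in> filtered (N - 1) \<Longrightarrow> \<Y> t h = Z t h"
begin

definition \<theta> :: real where "\<theta> = real (Suc N) / \<rho>"

lemma \<theta>: "1 < \<theta>"
proof -
  have "\<rho> < real_of_int (\<lfloor>\<rho>\<rfloor> + 1)" by linarith
  also have "\<dots> = real (Suc N)" using \<rho> by (simp add: N)
  finally show ?thesis using \<rho> by (simp add: \<theta>_def)
qed

lemma Fhat_linear: "linear_on nonempty_span (\<lambda>h. Fhat h y)"
  using Fhat by (simp add: F_hat_def)

text \<open>
  Extending \<open>Fhat\<close> by \<open>0\<close> at the empty forest makes it linear on the whole space, and passing to
  positive parts becomes immaterial.
\<close>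

definition l :: "real \<Rightarrow> 'v hopf \<Rightarrow> 'w" where
  "l u = lin (\<lambda>f. if f = {#} then 0 else Fhat (basis_vec f) (Y u))"

lemma linear_l: "linear (l u)"
  unfolding l_def by (rule linear_lin)

lemma nonempty_keys: "h \<in> nonempty_span \<Longrightarrow> k \<in> supp h \<Longrightarrow> k \<noteq> {#}"
  by (auto simp: nonempty_span_def in_keys_iff)

lemma basis_nonempty: "k \<noteq> {#} \<Longrightarrow> basis_vec k \<in> nonempty_span"
  by (simp add: nonempty_span_def lookup_single when_def)

lemma L_linear: "u \<in> {0..T} \<Longrightarrow> linear_on (nonempty_span \<inter> filtered N) (L u)"
  using L by (simp add: integrand_map_def)

lemma L_star:
  assumes "u \<in> {0..T}" "a + b \<le> N" "h \<in> filtered a" "q \<in> gl_generators" "q \<in> graded b"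
  shows "L u (h \<star> q) = compose_controlled N (F q) (\<Y> u) h"
proof -
  have "\<forall>a b h q. a + b \<le> N \<and> h \<in> filtered a \<and> q \<in> gl_generators \<inter> filtered b \<longrightarrow>
      L u (h \<star> q) = compose_controlled N (F q) (\<Y> u) h"
    using L[OF assms(1)] unfolding integrand_map_def by (rule conjunct2)
  from this[THEN spec, THEN spec, THEN spec, THEN spec, THEN mp, of a b h q] assms show ?thesis
    by (simp add: graded_filtered)
qed

lemma Fhat_star:
  assumes h: "h \<in> nonempty_span" and q: "q \<in> gl_generators"
  shows "Fhat (h \<star> q) y = faa_di_bruno (F q) (\<lambda>k. Fhat k y) y h"
proof -
  have "\<forall>h\<in>nonempty_span. \<forall>q\<in>gl_generators. \<forall>y. Fhat (h \<star> q) y = faa_di_bruno (F q) (\<lambda>k. Fhat k y) y h"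
    using Fhat unfolding F_hat_def by (elim conjE)
  then show ?thesis using h q by blast
qed

lemma Fhat_generator: "q \<in> gl_generators \<Longrightarrow> Fhat q = F q"
  using Fhat by (simp add: F_hat_def)

lemma graded_0: "h \<in> graded 0 \<Longrightarrow> h = coef h {#} *\<^sub>R 1"
proof (rule poly_mapping_eqI)
  fix k assume h: "h \<in> graded 0"
  show "coef h k = coef (coef h {#} *\<^sub>R 1) k"
  proof (cases "k = {#}")
    case True
    then show ?thesis by (simp add: lookup_one)
  next
    case False
    then have "k \<notin> supp h" using h by (auto simp: graded_def)
    with False show ?thesis by (simp add: lookup_one in_keys_iff when_def)
  qed
qed

lemma faa_di_bruno_one: "faa_di_bruno \<psi> A y (c *\<^sub>R 1) = 0"
  by (simp add: faa_di_bruno_def lin_scaleR)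

text \<open>
  On products \<open>h \<star> q\<close> both maps are given by the same formula in terms of their values on the parts
  of \<open>h\<close>, where \<open>\<Y>\<close> agrees with \<open>L\<close>.  Since these products span, the claim follows by
  induction on the weight.
\<close>

lemma L_Fhat:
  assumes u: "u \<in> {0..T}"
  shows "1 \<le> k \<Longrightarrow> k \<le> N \<Longrightarrow> x \<in> graded k \<Longrightarrow> L u x = Fhat x (Y u)"
proof (induction k arbitrary: x rule: less_induct)
  case (less k)
  let ?S = "nonempty_span \<inter> filtered N"
  have sub: "graded k \<subseteq> ?S"
    using less.prems(1,2) graded_nonempty[of _ k] graded_filtered[of _ k N] by auto
  have gen: "L u (h \<star> q) = Fhat (h \<star> q) (Y u)"
    if h: "h \<in> graded a" and q: "q \<in> gl_generators" "q \<in> graded b" and ab: "a + b = k" "0 < b" for h q a b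
  proof -
    have ha: "h \<in> filtered a" using h by (rule graded_filtered) simp
    have "L u (h \<star> q) = compose_controlled N (F q) (\<Y> u) h"
      using u ha q ab less.prems by (intro L_star[of u a b]) auto
    also have "\<dots> = coef h {#} *\<^sub>R F q (Y u) + faa_di_bruno (F q) (\<Y> u) (Y u) h"
      using ab less.prems truncate_filtered[OF graded_filtered[OF h, of "N - 1"]]
      by (simp add: compose_controlled_def Y[OF u])
    also have "\<dots> = Fhat (h \<star> q) (Y u)"
    proof (cases "a = 0")
      case True
      define c where "c = coef h {#}"
      have h1: "h = c *\<^sub>R 1" using graded_0 h True by (simp add: c_def)
      have qn: "q \<in> nonempty_span" using q(2) ab(2) by (rule graded_nonempty)
      have "h \<star> q = c *\<^sub>R q"
        by (simp add: h1 linear_cmul[OF linear_gl_left] gl_one_left)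
      moreover have "Fhat (c *\<^sub>R q) (Y u) = c *\<^sub>R Fhat q (Y u)"
        using Fhat_linear[of "Y u"] qn by (simp add: linear_on_def)
      moreover have "faa_di_bruno (F q) (\<Y> u) (Y u) h = 0"
        by (simp add: h1 faa_di_bruno_one)
      ultimately show ?thesis by (simp add: c_def Fhat_generator[OF q(1)])
    next
      case False
      then have hn: "h \<in> nonempty_span" using graded_nonempty[OF h] by simp
      have "faa_di_bruno (F q) (\<Y> u) (Y u) h = faa_di_bruno (F q) (\<lambda>k. Fhat k (Y u)) (Y u) h"
      proof (rule faa_di_bruno_cong[OF ha])
        fix g :: "'v basis forest" assume g: "g \<noteq> {#}" "weight g \<le> a"
        have w: "1 \<le> weight g" using g(1) by (metis less_one not_less weight_eq_0)
        have fil: "basis_vec g \<in> filtered (N - 1)" "basis_vec g \<in> filtered N"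
          using g ab less.prems by (auto intro!: graded_filtered[OF graded_basis])
        have "\<Y> u (basis_vec g) = L u (basis_vec g)"
          using \<Y>_Z[OF u basis_nonempty[OF g(1)] fil(1)] Z_L[OF u basis_nonempty[OF g(1)] fil(2)] by simp
        also have "\<dots> = Fhat (basis_vec g) (Y u)"
          using g w ab less.prems by (intro less.IH[of "weight g"] graded_basis) auto
        finally show "\<Y> u (basis_vec g) = Fhat (basis_vec g) (Y u)" .
      qed
      then show ?thesis
        using hn by (simp add: Fhat_star[OF hn q(1)] nonempty_span_def)
    qed
    finally show ?thesis .
  qed
  have S: "subspace ?S"
    by (intro subspace_inter subspace_nonempty_span subspace_filtered)
  show ?case
  proof (rule gl_generated_induct[OF _ less.prems(3)])
    show "0 < k" using less.prems by simp
    show "L u 0 = Fhat 0 (Y u)"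
      using linear_on_zero[OF L_linear[OF u] S] linear_on_zero[OF Fhat_linear subspace_nonempty_span] by simp
    fix c :: real and h q y :: "'v hopf" and a b
    assume h: "h \<in> graded a" and q: "q \<in> gl_generators" "q \<in> graded b" and ab: "a + b = k" "0 < b"
      and y: "y \<in> graded k" "L u y = Fhat y (Y u)"
    have hq: "h \<star> q \<in> ?S" using gl_graded[OF h q(2)] ab sub by auto
    have yS: "y \<in> ?S" using y sub by auto
    have chq: "c *\<^sub>R (h \<star> q) \<in> ?S" using hq by (rule subspace_scale[OF S])
    have "L u (c *\<^sub>R (h \<star> q) + y) = c *\<^sub>R L u (h \<star> q) + L u y"
      using L_linear[OF u] hq yS chq unfolding linear_on_def by simp
    also have "\<dots> = c *\<^sub>R Fhat (h \<star> q) (Y u) + Fhat y (Y u)"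
      by (simp add: gen[OF h q ab] y)
    also have "\<dots> = Fhat (c *\<^sub>R (h \<star> q) + y) (Y u)"
      using Fhat_linear[of "Y u"] hq yS chq unfolding linear_on_def by simp
    finally show "L u (c *\<^sub>R (h \<star> q) + y) = Fhat (c *\<^sub>R (h \<star> q) + y) (Y u)" .
  qed
qed

abbreviation B where "B \<equiv> forests_upto N - {{#}} :: 'v basis forest set"

lemma B: "f \<in> B \<longleftrightarrow> f \<noteq> {#} \<and> 1 \<le> weight f \<and> weight f \<le> N"
proof -
  have "f \<noteq> {#} \<Longrightarrow> 1 \<le> weight f" by (metis less_one not_less weight_eq_0)
  then show ?thesis by (auto simp: forests_upto_def)
qed

lemma finite_B: "finite B"
  by (simp add: finite_forests_upto)

lemma L_l:
  assumes u: "u \<in> {0..T}" and h: "h \<in> nonempty_span" "h \<in> filtered N"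
  shows "L u h = l u h"
proof -
  have k: "k \<in> B" if "k \<in> supp h" for k
    using nonempty_keys[OF h(1) that] h(2) that by (simp add: filtered_def forests_upto_def)
  have "L u h = lin (\<lambda>k. L u (basis_vec k)) h"
  proof (rule linear_on_lin[OF L_linear[OF u]])
    show "subspace (nonempty_span \<inter> filtered N :: 'v hopf set)"
      by (intro subspace_inter subspace_nonempty_span subspace_filtered)
    fix k assume "k \<in> supp h"
    from k[OF this] show "basis_vec k \<in> nonempty_span \<inter> filtered N"
      unfolding B by (intro IntI basis_nonempty graded_filtered[OF graded_basis]) simp_all
  qed
  also have "\<dots> = l u h"
    unfolding l_def
  proof (rule lin_cong)
    fix f assume "f \<in> supp h"
    from k[OF this] have f: "f \<noteq> {#}" "1 \<le> weight f" "weight f \<le> N" unfolding B by simp_all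
    show "L u (basis_vec f) = (if f = {#} then 0 else Fhat (basis_vec f) (Y u))"
      using L_Fhat[OF u f(2,3) graded_basis] f(1) by simp
  qed
  finally show ?thesis .
qed

lemma l_positive_part: "l u (positive_part x) = l u x"
  unfolding l_def positive_part_def lin_lin by (intro lin_cong) simp

lemma X_filtered: "0 \<le> s \<Longrightarrow> s \<le> t \<Longrightarrow> t \<le> T \<Longrightarrow> X s t \<in> filtered N"
  unfolding N by (rule brp_filtered[OF X])

lemma L_X: "0 \<le> s \<Longrightarrow> s \<le> t \<Longrightarrow> t \<le> T \<Longrightarrow> L s (positive_part (X s t)) = l s (X s t)"
proof -
  assume "0 \<le> s" "s \<le> t" "t \<le> T"
  then have "L s (positive_part (X s t)) = l s (positive_part (X s t))"
    by (intro L_l positive_part_nonempty positive_part_filtered X_filtered) auto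
  then show ?thesis by (simp only: l_positive_part)
qed

lemma Y_bounded: "\<exists>R. \<forall>t\<in>{0..T}. norm (Y t) \<le> R"
proof -
  have "approx_order \<rho> T \<omega> 1 (\<lambda>s t. \<Y> t 1) (\<lambda>s t. \<Y> s 1)"
    using \<Y> by (simp add: controlled_path_def)
  from approx_order_bounded[OF this] obtain R where "\<forall>t\<in>{0..T}. norm (\<Y> t 1) \<le> R"
    by (elim exE)
  then show ?thesis using Y by (intro exI[of _ R]) simp
qed

lemma Fhat_bounded:
  assumes f: "f \<noteq> {#}"
  shows "\<exists>M. \<forall>t\<in>{0..T}. norm (Fhat (basis_vec f) (Y t)) \<le> M"
proof -
  obtain R where R: "\<forall>t\<in>{0..T}. norm (Y t) \<le> R" using Y_bounded by (elim exE)
  have "smooth (Fhat (basis_vec f))"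
    using Fhat basis_nonempty[OF f] by (simp add: F_hat_def)
  then have "continuous_on UNIV (Fhat (basis_vec f))"
    unfolding smooth_def by (intro C_k_continuous[of 0]) simp
  then have "compact (Fhat (basis_vec f) ` cball 0 R)"
    by (intro compact_continuous_image compact_cball) (rule continuous_on_subset, auto)
  from compact_imp_bounded[OF this] obtain M where "\<forall>y\<in>cball 0 R. norm (Fhat (basis_vec f) y) \<le> M"
    unfolding bounded_iff by auto
  then show ?thesis using R by (intro exI[of _ M]) auto
qed

lemma coeff_O: "f \<in> B \<Longrightarrow> of_order (weight f) (\<lambda>s t. coef (X s t) f)"
proof -
  assume "f \<in> B"
  then have "f \<noteq> {#}" "weight f \<le> nat \<lfloor>\<rho>\<rfloor>" unfolding N[symmetric] unfolding B by auto
  from brp_bound[OF X this] show ?thesis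
    unfolding of_order_def bounded_by_def real_norm_def imp_conjL .
qed

lemma controlled_generator:
  assumes q: "q \<in> gl_generators" "q \<in> graded b" "b \<le> N"
  shows "controlled_path \<rho> T \<omega> X N (\<lambda>u. compose_controlled N (F q) (\<Y> u))"
proof -
  have "\<forall>q\<in>gl_generators \<inter> filtered N. controlled_path \<rho> T \<omega> X N (\<lambda>u. compose_controlled N (F q) (\<Y> u))"
    using integrand unfolding controlled_integrand_def Let_def N[symmetric] by (rule conjunct2)
  then show ?thesis using q graded_filtered[OF q(2,3)] by blast
qed

text \<open>
  On a product \<open>h \<star> q\<close> the increment is that of the controlled integrand at \<open>q\<close>, evaluated at \<open>h\<close>.
  The component at \<open>q\<close> is controlled to order \<open>N - |h|\<close>, which suffices as \<open>|q| \<ge> 1\<close>.  The truncations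
  at weight \<open>N\<close> and at weight \<open>N - |q|\<close> differ by terms with a factor of \<open>X\<close> of weight at least
  \<open>N + 1 - k\<close>.
\<close>

lemma increment_generator:
  assumes h: "h \<in> graded a" and q: "q \<in> gl_generators" "q \<in> graded b" and k: "a + b = k" "0 < b" "k \<le> N"
  shows "of_order (Suc N - k) (\<lambda>s t. l t (h \<star> q) - l s (truncate N (X s t \<star> (h \<star> q))))"
proof -
  define H where "H u = compose_controlled N (F q) (\<Y> u)" for u
  have CP: "controlled_path \<rho> T \<omega> X N H"
    unfolding H_def using q k by (intro controlled_generator[of q b]) auto
  have linH: "linear (H s)" if "s \<in> {0..T}" for s
    using CP that unfolding controlled_path_def by blast
  have "\<forall>n<N. \<forall>h\<in>graded n. approx_order \<rho> T \<omega> (N - n) (\<lambda>s t. H t h) (\<lambda>s t. H s (X s t \<star> h))"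
    using CP unfolding controlled_path_def by (elim conjE)
  then have "approx_order \<rho> T \<omega> (N - a) (\<lambda>s t. H t h) (\<lambda>s t. H s (X s t \<star> h))"
    using h k by simp
  then have "of_order (N - a) (\<lambda>s t. H t h - H s (X s t \<star> h))"
    by (rule approx_order_of_order)
  then have O1: "of_order (Suc N - k) (\<lambda>s t. H t h - H s (X s t \<star> h))"
    by (rule of_order_weaken[rotated 2]) (use k in auto)
  let ?d = "\<lambda>s g. H s (basis_vec g \<star> h) - H s (truncate (N - b) (basis_vec g \<star> h))"
  have O2: "of_order (Suc N - k) (\<lambda>s t. coef (X s t) g *\<^sub>R ?d s g)" if g: "g \<in> forests_upto N" for g
  proof (cases "weight g + a \<le> N - b")
    case True
    then have "?d s g = 0" for s
      using truncate_graded[OF gl_graded[OF graded_basis h], of "N - b" g] by simp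
    then show ?thesis by (simp add: of_order_zero)
  next
    case False
    then have w: "Suc N - k \<le> weight g" "0 < weight g" using k by auto
    then have "g \<in> B" using g by (auto simp: forests_upto_def)
    from of_order_weaken[OF _ w(1) coeff_O[OF this]] k(3)
    have wk: "of_order (Suc N - k) (\<lambda>s t. coef (X s t) g)" by simp
    have ds: "?d s g = H s (basis_vec g \<star> h)" if "s \<in> {0..T}" for s
      using truncate_graded[OF gl_graded[OF graded_basis h], of "N - b" g] False linear_0[OF linH[OF that]] by simp
    have "approx_order \<rho> T \<omega> 1 (\<lambda>s t. H t (basis_vec g \<star> h)) (\<lambda>s t. H s (basis_vec g \<star> h))"
      using CP unfolding controlled_path_def by (elim conjE) (erule spec)
    from approx_order_bounded[OF this] obtain M where M: "\<forall>s\<in>{0..T}. norm (H s (basis_vec g \<star> h)) \<le> M"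
      by (elim exE)
    show ?thesis
    proof (rule of_order_dominated[OF wk, where B = M])
      fix s t :: real assume "0 \<le> s" "s < t" "t \<le> T"
      then have s: "s \<in> {0..T}" by simp
      show "norm (coef (X s t) g *\<^sub>R ?d s g) \<le> M * norm (coef (X s t) g)"
        unfolding ds[OF s] norm_scaleR real_norm_def mult.commute[of "\<bar>_\<bar>"]
        by (rule mult_right_mono[OF bspec[OF M s] abs_ge_zero])
    qed
  qed
  from of_order_add[OF O1 of_order_sum[of "forests_upto N", OF O2]]
  show ?thesis
  proof (rule of_order_cong)
    fix s t :: real assume st: "0 \<le> s" "s < t" "t \<le> T"
    then have s: "s \<in> {0..T}" and t: "t \<in> {0..T}" by simp_all
    have hf: "h \<in> filtered a" using h by (rule graded_filtered) simp
    have hq: "h \<star> q \<in> graded k" using gl_graded[OF h q(2)] k by simp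
    have e1: "l t (h \<star> q) = H t h"
      unfolding H_def using k
      by (subst L_l[OF t, symmetric])
        (auto intro!: graded_nonempty[OF hq] graded_filtered[OF hq] L_star[OF t _ hf q])
    have "truncate N (X s t \<star> (h \<star> q)) = truncate (N - b) (X s t \<star> h) \<star> q"
      unfolding gl_assoc[symmetric] using k by (intro truncate_gl q) simp
    moreover have "truncate (N - b) (X s t \<star> h) \<star> q \<in> filtered N"
      unfolding calculation[symmetric] by (rule truncate_in_filtered)
    ultimately have e2: "l s (truncate N (X s t \<star> (h \<star> q))) = H s (truncate (N - b) (X s t \<star> h))"
      unfolding H_def using k
      by (subst L_l[OF s, symmetric])
        (auto intro!: gl_nonempty[OF q(2)] L_star[OF s _ truncate_in_filtered q])
    have "X s t \<star> h = lin (\<lambda>g. basis_vec g \<star> h) (X s t)"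
      by (rule linear_ext_lin[OF linear_gl_left])
    then have "H s (X s t \<star> h) - H s (truncate (N - b) (X s t \<star> h)) = lin (\<lambda>g. H s (basis_vec g \<star> h)) (X s t) -
        lin (\<lambda>g. H s (truncate (N - b) (basis_vec g \<star> h))) (X s t)"
      by (simp only: linear_of_lin[OF linear_truncate] linear_of_lin[OF linH[OF s]])
    also have "\<dots> = (\<Sum>g\<in>forests_upto N. coef (X s t) g *\<^sub>R ?d s g)"
      using X_filtered[of s t] st by (simp add: filtered_expand sum_subtractf scaleR_diff_right)
    finally have e3: "H s (X s t \<star> h) - H s (truncate (N - b) (X s t \<star> h)) =
      (\<Sum>g\<in>forests_upto N. coef (X s t) g *\<^sub>R ?d s g)" .
    show "l t (h \<star> q) - l s (truncate N (X s t \<star> (h \<star> q))) =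
      (H t h - H s (X s t \<star> h)) + (\<Sum>g\<in>forests_upto N. coef (X s t) g *\<^sub>R ?d s g)"
      unfolding e1 e2 e3[symmetric] by simp
  qed
qed

lemma increment_l:
  assumes k: "1 \<le> k" "k \<le> N" and x: "x \<in> graded k"
  shows "of_order (Suc N - k) (\<lambda>s t. l t x - l s (truncate N (X s t \<star> x)))"
proof (rule gl_generated_induct[OF _ x])
  show "0 < k" using k by simp
  show "of_order (Suc N - k) (\<lambda>s t. l t 0 - l s (truncate N (X s t \<star> 0)))"
    by (simp add: linear_0[OF linear_l] linear_0[OF linear_gl_right] linear_0[OF linear_truncate] of_order_zero)
  fix c :: real and h q y :: "'v hopf" and a b
  assume hq: "h \<in> graded a" "q \<in> gl_generators" "q \<in> graded b" "a + b = k" "0 < b"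
    and y: "of_order (Suc N - k) (\<lambda>s t. l t y - l s (truncate N (X s t \<star> y)))"
  from of_order_add[OF of_order_scaleR[OF increment_generator[OF hq k(2)], of c] y]
  show "of_order (Suc N - k) (\<lambda>s t. l t (c *\<^sub>R (h \<star> q) + y) - l s (truncate N (X s t \<star> (c *\<^sub>R (h \<star> q) + y))))"
    by (rule of_order_cong)
      (simp add: linear_add[OF linear_l] linear_cmul[OF linear_l] linear_add[OF linear_gl_right] linear_cmul[OF linear_gl_right]
        linear_add[OF linear_truncate] linear_cmul[OF linear_truncate] algebra_simps)
qed

lemma l_expand:
  assumes "0 \<le> s" "s \<le> t" "t \<le> T"
  shows "l u (X s t) = (\<Sum>f\<in>B. coef (X s t) f *\<^sub>R Fhat (basis_vec f) (Y u))"
  unfolding l_positive_part[of u "X s t", symmetric] unfolding l_def lin_positive_part[OF X_filtered[OF assms]]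
  by (intro sum.cong refl) simp

text \<open>By Chen's relation, the germ \<open>l s (X s t)\<close> fails to be additive by the increments of \<open>l\<close>.\<close>

lemma l_defect:
  assumes "0 \<le> s" "s \<le> u" "u \<le> t" "t \<le> T"
  shows "l s (X s t) - l s (X s u) - l u (X u t) = - (\<Sum>f\<in>B. coef (X u t) f *\<^sub>R
     (l u (basis_vec f) - l s (truncate N (X s u \<star> basis_vec f))))"
proof -
  let ?x = "coef (X u t)"
  let ?\<phi> = "\<lambda>f. l s (truncate N (X s u \<star> basis_vec f))"
  have ut: "0 \<le> u" "u \<le> T" "s \<le> T" using assms by auto
  have "X s u \<star> X u t = lin (\<lambda>f. X s u \<star> basis_vec f) (X u t)"
    by (rule linear_ext_lin[OF linear_gl_right])
  then have "X s t = truncate N (lin (\<lambda>f. X s u \<star> basis_vec f) (X u t))"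
    using brp_chen[OF X assms] by (simp add: N)
  then have "l s (X s t) = lin ?\<phi> (X u t)"
    by (simp only: linear_of_lin[OF linear_truncate] linear_of_lin[OF linear_l])
  also have "\<dots> = (\<Sum>f\<in>forests_upto N. ?x f *\<^sub>R ?\<phi> f)"
    by (rule filtered_expand) (rule X_filtered[OF ut(1) assms(3,4)])
  also have "\<dots> = ?x {#} *\<^sub>R ?\<phi> {#} + (\<Sum>f\<in>B. ?x f *\<^sub>R ?\<phi> f)"
    by (rule sum.remove[OF finite_forests_upto]) (simp add: forests_upto_def)
  also have "?x {#} *\<^sub>R ?\<phi> {#} = l s (X s u)"
    using brp_empty[OF X ut(1) assms(3,4)] truncate_filtered[OF X_filtered[OF assms(1,2) ut(2)]]
    by (simp add: gl_one_right)
  finally have 1: "l s (X s t) = l s (X s u) + (\<Sum>f\<in>B. ?x f *\<^sub>R ?\<phi> f)" .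
  have 2: "l u (X u t) = (\<Sum>f\<in>B. ?x f *\<^sub>R l u (basis_vec f))"
    unfolding l_expand[OF ut(1) assms(3,4)]
    by (intro sum.cong refl) (simp add: l_def)
  show ?thesis
    unfolding 1 2 by (simp add: scaleR_diff_right sum_subtractf)
qed

text \<open>
  Each summand of the defect is a coefficient of \<open>X\<close> of weight \<open>|f|\<close> times an increment of order
  \<open>N + 1 - |f|\<close>.
\<close>

lemma germ_bound:
  "\<exists>K\<ge>0. \<forall>s u t. 0 \<le> s \<longrightarrow> s < u \<longrightarrow> u < t \<longrightarrow> t \<le> T \<longrightarrow>
     norm (l s (X s t) - l s (X s u) - l u (X u t)) \<le> K * \<omega> s t powr \<theta>"
proof -
  let ?d = "\<lambda>f s u. l u (basis_vec f) - l s (truncate N (X s u \<star> basis_vec f))"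
  have "\<exists>K\<ge>0. \<forall>s u t. 0 \<le> s \<longrightarrow> s < u \<longrightarrow> u < t \<longrightarrow> t \<le> T \<longrightarrow>
      norm (coef (X u t) f *\<^sub>R ?d f s u) \<le> K * \<omega> s t powr \<theta>" if f: "f \<in> B" for f
  proof -
    have f': "1 \<le> weight f" "weight f \<le> N" using f unfolding B by auto
    obtain K where K: "bounded_by K (weight f) (\<lambda>s t. coef (X s t) f)"
      using coeff_O[OF f] unfolding of_order_def by (elim exE)
    obtain M where M: "bounded_by M (Suc N - weight f) (?d f)"
      using increment_l[OF f' graded_basis] unfolding of_order_def by (elim exE)
    note K0 = bounded_by_nonneg[OF K] and M0 = bounded_by_nonneg[OF M]
    show ?thesis
    proof (intro exI[of _ "K * M"] conjI allI impI)
      show "0 \<le> K * M" using K0 M0 by simp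
      fix s u t :: real assume *: "0 \<le> s" "s < u" "u < t" "t \<le> T"
      have w: "0 \<le> \<omega> u t" "\<omega> u t \<le> \<omega> s t" "0 \<le> \<omega> s u" "\<omega> s u \<le> \<omega> s t"
        using * by (auto intro!: control_nonneg control_mono)
      have "norm (coef (X u t) f) \<le> K * \<omega> u t powr (real (weight f) / \<rho>)"
        using bounded_byD[OF K, of u t] * by simp
      also have "\<dots> \<le> K * \<omega> s t powr (real (weight f) / \<rho>)"
        using K0 w \<rho>0 by (intro mult_left_mono powr_mono2) auto
      finally have 1: "norm (coef (X u t) f) \<le> K * \<omega> s t powr (real (weight f) / \<rho>)" .
      have "norm (?d f s u) \<le> M * \<omega> s u powr (real (Suc N - weight f) / \<rho>)"
        using bounded_byD[OF M, of s u] * by simp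
      also have "\<dots> \<le> M * \<omega> s t powr (real (Suc N - weight f) / \<rho>)"
        using M0 w \<rho>0 by (intro mult_left_mono powr_mono2) auto
      finally have 2: "norm (?d f s u) \<le> M * \<omega> s t powr (real (Suc N - weight f) / \<rho>)" .
      have e: "real (weight f) / \<rho> + real (Suc N - weight f) / \<rho> = \<theta>"
        using f' by (simp add: \<theta>_def flip: add_divide_distrib)
      have "norm (coef (X u t) f *\<^sub>R ?d f s u) \<le>
          (K * \<omega> s t powr (real (weight f) / \<rho>)) * (M * \<omega> s t powr (real (Suc N - weight f) / \<rho>))"
        unfolding norm_scaleR using 1 2 K0 by (intro mult_mono) auto
      also have "\<dots> = K * M * \<omega> s t powr \<theta>"
        unfolding e[symmetric] powr_add by (simp only: mult_ac)
      finally show "norm (coef (X u t) f *\<^sub>R ?d f s u) \<le> K * M * \<omega> s t powr \<theta>" .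
    qed
  qed
  then have "\<forall>f\<in>B. \<exists>K. 0 \<le> K \<and> (\<forall>s u t. 0 \<le> s \<longrightarrow> s < u \<longrightarrow> u < t \<longrightarrow> t \<le> T \<longrightarrow>
      norm (coef (X u t) f *\<^sub>R ?d f s u) \<le> K * \<omega> s t powr \<theta>)"
    by (intro ballI)
  from bchoice[OF this] obtain K where K: "\<forall>f\<in>B. 0 \<le> K f \<and> (\<forall>s u t. 0 \<le> s \<longrightarrow> s < u \<longrightarrow> u < t \<longrightarrow> t \<le> T \<longrightarrow>
      norm (coef (X u t) f *\<^sub>R ?d f s u) \<le> K f * \<omega> s t powr \<theta>)"
    by (elim exE)
  show ?thesis
  proof (intro exI[of _ "sum K B"] conjI allI impI)
    show "0 \<le> sum K B" using K by (intro sum_nonneg) blast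
    fix s u t :: real assume *: "0 \<le> s" "s < u" "u < t" "t \<le> T"
    have "norm (l s (X s t) - l s (X s u) - l u (X u t)) = norm (\<Sum>f\<in>B. coef (X u t) f *\<^sub>R ?d f s u)"
      using * by (subst l_defect) auto
    also have "\<dots> \<le> (\<Sum>f\<in>B. K f * \<omega> s t powr \<theta>)"
      using K * by (intro order_trans[OF norm_sum] sum_mono) simp
    also have "\<dots> = sum K B * \<omega> s t powr \<theta>" by (simp add: sum_distrib_right)
    finally show "norm (l s (X s t) - l s (X s u) - l u (X u t)) \<le> sum K B * \<omega> s t powr \<theta>" .
  qed
qed

lemma Y_increment: "of_order (Suc N) (\<lambda>s t. Y t - Y s - l s (X s t))"
proof -
  from germ_bound obtain K where K: "0 \<le> K" "\<forall>s u t. 0 \<le> s \<longrightarrow> s < u \<longrightarrow> u < t \<longrightarrow> t \<le> T \<longrightarrow>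
     norm (l s (X s t) - l s (X s u) - l u (X u t)) \<le> K * \<omega> s t powr \<theta>"
    by (elim exE conjE)
  have "\<exists>C\<ge>0. \<forall>s t. 0 \<le> s \<and> s < t \<and> t \<le> T \<longrightarrow>
    norm (Z t 1 - Z s 1 - L s (positive_part (X s t))) \<le> C * \<omega> s t powr \<theta>"
  proof (rule rough_integral_increment[OF \<theta> K(1) _ Z_int])
    fix s u t :: real assume *: "0 \<le> s" "s < u" "u < t" "t \<le> T"
    then show "norm (L s (positive_part (X s t)) - L s (positive_part (X s u)) - L u (positive_part (X u t))) \<le> K * \<omega> s t powr \<theta>"
      using K(2) by (simp add: L_X)
  qed
  then obtain C where C: "0 \<le> C" "\<forall>s t. 0 \<le> s \<and> s < t \<and> t \<le> T \<longrightarrow>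
    norm (Z t 1 - Z s 1 - L s (positive_part (X s t))) \<le> C * \<omega> s t powr \<theta>"
    by (elim exE conjE)
  show ?thesis
  proof (rule of_orderI[OF C(1)])
    fix s t :: real assume *: "0 \<le> s" "s < t" "t \<le> T"
    then show "norm (Y t - Y s - l s (X s t)) \<le> C * \<omega> s t powr (real (Suc N) / \<rho>)"
      using C(2) Y_Z[of s t] by (simp add: L_X \<theta>_def)
  qed
qed

lemma l_X_order: "of_order 1 (\<lambda>s t. l s (X s t))"
proof -
  have "of_order 1 (\<lambda>s t. coef (X s t) f *\<^sub>R Fhat (basis_vec f) (Y s))" if f: "f \<in> B" for f
  proof -
    have f': "f \<noteq> {#}" "1 \<le> weight f" using f unfolding B by auto
    obtain M where M: "\<forall>t\<in>{0..T}. norm (Fhat (basis_vec f) (Y t)) \<le> M"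
      using Fhat_bounded[OF f'(1)] by (elim exE)
    show ?thesis
    proof (rule of_order_dominated[OF of_order_weaken[OF _ f'(2) coeff_O[OF f]], where B = M])
      fix s t :: real assume "0 \<le> s" "s < t" "t \<le> T"
      then have s: "s \<in> {0..T}" by simp
      show "norm (coef (X s t) f *\<^sub>R Fhat (basis_vec f) (Y s)) \<le> M * norm (coef (X s t) f)"
        unfolding norm_scaleR real_norm_def mult.commute[of "\<bar>_\<bar>"]
        by (rule mult_right_mono[OF bspec[OF M s] abs_ge_zero])
    qed simp
  qed
  from of_order_sum[of B, OF this] show ?thesis
  proof (rule of_order_cong)
    fix s t :: real assume "0 \<le> s" "s < t" "t \<le> T"
    then show "l s (X s t) = (\<Sum>f\<in>B. coef (X s t) f *\<^sub>R Fhat (basis_vec f) (Y s))"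
      by (intro l_expand) auto
  qed
qed

end

section \<open>The change of variable formula\<close>

context rough_solution
begin

text \<open>
  Let \<open>v = l s (X s t)\<close>.  Since \<open>Y t\<close> and \<open>Y s + v\<close> differ by a term of order \<open>N + 1\<close> and \<open>v\<close> is of
  order \<open>1\<close>, Taylor's formula gives \<open>\<phi> (Y t) - \<phi> (Y s)\<close> up to order \<open>N + 1\<close> as the sum of
  \<open>1/n! D\<^sup>n\<phi>(Y s)(v, \<dots>, v)\<close> over \<open>1 \<le> n \<le> N\<close>.  Its multilinear expansion runs over all words of
  \<open>n\<close> forests.  As \<open>X s t\<close> is group-like, the words of total weight at most \<open>N\<close> make up
  \<open>F_bold Fhat \<phi>\<close>; the others are of order \<open>N + 1\<close>.
\<close>

lemma phi_increment:
  fixes \<phi> :: "'w \<Rightarrow> 'u::euclidean_space"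
  assumes \<phi>: "C_k (Suc N) \<phi>"
  shows "of_order (Suc N) (\<lambda>s t. \<phi> (Y t) - \<phi> (Y s) - F_bold Fhat \<phi> (positive_part (X s t)) (Y s))"
proof -
  let ?x = "\<lambda>s t. coef (X s t)"
  let ?A = "\<lambda>s f. Fhat (basis_vec f) (Y s)"
  let ?v = "\<lambda>s t. l s (X s t)"
  obtain R where R: "\<forall>t\<in>{0..T}. norm (Y t) \<le> R" using Y_bounded by (elim exE)
  obtain V where V: "bounded_by V 1 ?v"
    using l_X_order unfolding of_order_def by (elim exE)
  note V0 = bounded_by_nonneg[OF V]
  define K where "K = cball (0 :: 'w) (R + V * \<omega> 0 T powr (real 1 / \<rho>))"
  have K: "compact K" "convex K" by (simp_all add: K_def)
  have pos: "0 \<le> V * \<omega> 0 T powr (real 1 / \<rho>)" using V0 by simp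
  have YK: "Y t \<in> K" if "t \<in> {0..T}" for t
    using bspec[OF R that] pos by (simp add: K_def)
  have YvK: "Y s + ?v s t \<in> K" if st: "0 \<le> s" "s < t" "t \<le> T" for s t
  proof -
    have "norm (?v s t) \<le> V * \<omega> s t powr (real 1 / \<rho>)" using bounded_byD[OF V st] by simp
    also have "\<dots> \<le> V * \<omega> 0 T powr (real 1 / \<rho>)"
      using V0 st \<rho>0 by (intro mult_left_mono powr_mono2) (auto intro!: control_nonneg control_mono)
    finally show ?thesis
      using bspec[OF R, of s] st norm_triangle_ineq[of "Y s" "?v s t"] by (simp add: K_def)
  qed
  have G1: "of_order (Suc N) (\<lambda>s t. \<phi> (Y t) - \<phi> (Y s + ?v s t))"
  proof -
    have "C_k (Suc 0) \<phi>" by (rule C_k_le[OF \<phi>]) simp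
    from taylor_bound[OF this K] obtain C where C: "\<forall>y\<in>K. \<forall>z\<in>K.
      norm (\<phi> z - (\<Sum>n\<le>0. (1 / fact n) *\<^sub>R derivs \<phi> (replicate n (z - y)) y)) \<le> C * norm (z - y) ^ Suc 0"
      by (elim exE conjE)
    show ?thesis
    proof (rule of_order_dominated[OF Y_increment, where B = C])
      fix s t :: real assume st: "0 \<le> s" "s < t" "t \<le> T"
      show "norm (\<phi> (Y t) - \<phi> (Y s + ?v s t)) \<le> C * norm (Y t - Y s - ?v s t)"
        using C[THEN bspec, THEN bspec, OF YvK[OF st] YK[of t]] st by (simp add: diff_diff_add)
    qed
  qed
  have G2: "of_order (Suc N) (\<lambda>s t. \<phi> (Y s + ?v s t) - (\<Sum>n\<le>N. (1 / fact n) *\<^sub>R derivs \<phi> (replicate n (?v s t)) (Y s)))"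
  proof -
    from taylor_bound[OF \<phi> K] obtain C where C: "\<forall>y\<in>K. \<forall>z\<in>K.
      norm (\<phi> z - (\<Sum>n\<le>N. (1 / fact n) *\<^sub>R derivs \<phi> (replicate n (z - y)) y)) \<le> C * norm (z - y) ^ Suc N"
      by (elim exE conjE)
    show ?thesis
    proof (rule of_order_dominated[OF of_order_power[OF l_X_order, of N], where B = C])
      fix s t :: real assume st: "0 \<le> s" "s < t" "t \<le> T"
      show "norm (\<phi> (Y s + ?v s t) - (\<Sum>n\<le>N. (1 / fact n) *\<^sub>R derivs \<phi> (replicate n (?v s t)) (Y s)))
         \<le> C * norm (norm (?v s t) ^ Suc N)"
        using C[THEN bspec, THEN bspec, OF YK[of s] YvK[OF st]] st by simp
    qed
  qed
  let ?t = "\<lambda>s t fs. prod_list (map (?x s t) fs) *\<^sub>R derivs \<phi> (map (?A s) fs) (Y s)"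
  have G3: "of_order (Suc N) (\<lambda>s t. ?t s t fs)" if n: "n \<in> {1..N}" and fs: "fs \<in> words B n - words_upto n N" for n fs
  proof -
    have len: "length fs = n" and fB: "\<And>f. f \<in> set fs \<Longrightarrow> f \<in> B" using fs by (auto simp: words_def)
    have "{#} \<notin> set fs" using fB by blast
    with fs len have w: "Suc N \<le> sum_list (map weight fs)" by (simp add: words_upto_def)
    have "fs \<noteq> []" using n len by auto
    then have "of_order (sum_list (map weight fs)) (\<lambda>s t. prod_list (map (\<lambda>f. ?x s t f) fs))"
      using fB by (intro of_order_prod_list[where r = weight and x = "\<lambda>f s t. ?x s t f"] coeff_O)
    from of_order_weaken[OF _ w this]
    have P: "of_order (Suc N) (\<lambda>s t. prod_list (map (?x s t) fs))" by simp
    have "\<forall>f\<in>B. \<exists>M. \<forall>t\<in>{0..T}. norm (?A t f) \<le> M"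
      unfolding B by (intro ballI Fhat_bounded) simp
    from bchoice[OF this] obtain M where M: "\<forall>f\<in>B. \<forall>t\<in>{0..T}. norm (?A t f) \<le> M f" by (elim exE)
    have "n \<le> Suc N" using n by simp
    from derivs_bounded[OF \<phi> this K(1)] obtain C where C: "0 \<le> C"
      "\<forall>x\<in>K. \<forall>vs. length vs = n \<longrightarrow> norm (derivs \<phi> vs x) \<le> C * prod_list (map norm vs)"
      by (elim exE conjE)
    show ?thesis
    proof (rule of_order_dominated[OF P, where B = "C * prod_list (map M fs)"])
      fix s t :: real assume st: "0 \<le> s" "s < t" "t \<le> T"
      then have s: "s \<in> {0..T}" by simp
      have "norm (derivs \<phi> (map (?A s) fs) (Y s)) \<le> C * prod_list (map norm (map (?A s) fs))"
        using C(2)[THEN bspec, OF YK[OF s], THEN spec, THEN mp, of "map (?A s) fs"] len by simp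
      also have "\<dots> \<le> C * prod_list (map M fs)"
      proof (rule mult_left_mono[OF _ C(1)])
        have "prod_list (map (\<lambda>f. norm (?A s f)) fs) \<le> prod_list (map M fs) \<and> 0 \<le> prod_list (map (\<lambda>f. norm (?A s f)) fs)"
          by (intro prod_list_map_mono conjI norm_ge_zero bspec[OF bspec[OF M fB] s])
        then show "prod_list (map norm (map (?A s) fs)) \<le> prod_list (map M fs)" by (simp add: o_def)
      qed
      finally have "norm (derivs \<phi> (map (?A s) fs) (Y s)) \<le> C * prod_list (map M fs)" .
      then show "norm (?t s t fs) \<le> C * prod_list (map M fs) * norm (prod_list (map (?x s t) fs))"
        unfolding norm_scaleR real_norm_def mult.commute[of "\<bar>_\<bar>"]
        by (rule mult_right_mono) (rule abs_ge_zero)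
    qed
  qed
  have "of_order (Suc N) (\<lambda>s t. \<Sum>n=1..N. (1 / fact n) *\<^sub>R (\<Sum>fs\<in>words B n - words_upto n N. ?t s t fs))"
    by (intro of_order_sum of_order_scaleR G3)
  from of_order_add[OF of_order_add[OF G1 G2] this] show ?thesis
  proof (rule of_order_cong)
    fix s t :: real assume st: "0 \<le> s" "s < t" "t \<le> T"
    then have st': "0 \<le> s" "s \<le> t" "t \<le> T" by auto
    have expand: "derivs \<phi> (replicate n (?v s t)) (Y s) = (\<Sum>fs\<in>words B n. ?t s t fs)" if "n \<in> {1..N}" for n
      unfolding l_expand[OF st'] using that by (intro derivs_power_expand[OF \<phi> finite_B]) simp
    have bold: "F_bold Fhat \<phi> (positive_part (X s t)) (Y s) = (\<Sum>n=1..N. (1 / fact n) *\<^sub>R (\<Sum>fs\<in>words_upto n N. ?t s t fs))"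
      unfolding F_bold_def using brp_multiplicative[OF X st']
      by (intro faa_di_bruno_group_like X_filtered st') (simp add: N)
    have "(\<Sum>n\<le>N. (1 / fact n) *\<^sub>R derivs \<phi> (replicate n (?v s t)) (Y s)) =
        \<phi> (Y s) + (\<Sum>n=1..N. (1 / fact n) *\<^sub>R derivs \<phi> (replicate n (?v s t)) (Y s))"
      by (simp add: atMost_atLeast0 sum.atLeast_Suc_atMost)
    also have "(\<Sum>n=1..N. (1 / fact n) *\<^sub>R derivs \<phi> (replicate n (?v s t)) (Y s)) =
      (\<Sum>n=1..N. (1 / fact n) *\<^sub>R (\<Sum>fs\<in>words B n - words_upto n N. ?t s t fs) + (1 / fact n) *\<^sub>R (\<Sum>fs\<in>words_upto n N. ?t s t fs))"
    proof (rule sum.cong[OF refl])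
      fix n assume n: "n \<in> {1..N}"
      have "(\<Sum>fs\<in>words B n. ?t s t fs) = (\<Sum>fs\<in>words B n - words_upto n N. ?t s t fs) + (\<Sum>fs\<in>words_upto n N. ?t s t fs)"
        by (rule sum.subset_diff[OF words_upto_subset finite_words[OF finite_B]])
      then show "(1 / fact n) *\<^sub>R derivs \<phi> (replicate n (?v s t)) (Y s) =
        (1 / fact n) *\<^sub>R (\<Sum>fs\<in>words B n - words_upto n N. ?t s t fs) + (1 / fact n) *\<^sub>R (\<Sum>fs\<in>words_upto n N. ?t s t fs)"
        unfolding expand[OF n] by (simp only: scaleR_add_right)
    qed
    also have "\<dots> = (\<Sum>n=1..N. (1 / fact n) *\<^sub>R (\<Sum>fs\<in>words B n - words_upto n N. ?t s t fs)) + F_bold Fhat \<phi> (positive_part (X s t)) (Y s)"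
      unfolding bold by (rule sum.distrib)
    finally have e: "(\<Sum>n\<le>N. (1 / fact n) *\<^sub>R derivs \<phi> (replicate n (?v s t)) (Y s)) =
       \<phi> (Y s) + ((\<Sum>n=1..N. (1 / fact n) *\<^sub>R (\<Sum>fs\<in>words B n - words_upto n N. ?t s t fs)) + F_bold Fhat \<phi> (positive_part (X s t)) (Y s))" .
    show "\<phi> (Y t) - \<phi> (Y s) - F_bold Fhat \<phi> (positive_part (X s t)) (Y s) =
      (\<phi> (Y t) - \<phi> (Y s + ?v s t)) + (\<phi> (Y s + ?v s t) - (\<Sum>n\<le>N. (1 / fact n) *\<^sub>R derivs \<phi> (replicate n (?v s t)) (Y s)))
      + (\<Sum>n=1..N. (1 / fact n) *\<^sub>R (\<Sum>fs\<in>words B n - words_upto n N. ?t s t fs))"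
      unfolding e by (simp only: diff_diff_eq[symmetric]) (simp add: algebra_simps)
  qed
qed

end

theorem theorem2p14:
  fixes X :: "real \<Rightarrow> real \<Rightarrow> 'v::euclidean_space hopf"
    and F Fhat :: "'v hopf \<Rightarrow> 'w::euclidean_space \<Rightarrow> 'w"
    and \<phi> :: "'w \<Rightarrow> 'u::euclidean_space"
    and Y :: "real \<Rightarrow> 'w" and y\<^sub>0 :: 'w
    and \<omega> :: "real \<Rightarrow> real \<Rightarrow> real" and \<rho> T :: real
  assumes "1 \<le> \<rho>" and "0 \<le> T"
    and "control T \<omega>"
    and "branched_rough_path \<rho> T \<omega> X"
    and "vector_fields F"
    and "rde_solution \<rho> T \<omega> X F y\<^sub>0 Y"
    and "F_hat F Fhat"
    and "C_k (nat \<lfloor>\<rho>\<rfloor> + 1) \<phi>"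
  shows "\<forall>s t. 0 \<le> s \<and> s \<le> t \<and> t \<le> T \<longrightarrow>
    has_rough_integral X (\<lambda>u h. F_bold Fhat \<phi> h (Y u)) s t (\<phi> (Y t) - \<phi> (Y s))"
proof (intro allI impI)
  fix s t :: real assume st: "0 \<le> s \<and> s \<le> t \<and> t \<le> T"
  define N where "N = nat \<lfloor>\<rho>\<rfloor>"
  obtain \<Y> Z where \<Y>: "controlled_path \<rho> T \<omega> X N \<Y>"
    and int: "controlled_integral \<rho> T \<omega> X (\<lambda>u q. compose_controlled N (F q) (\<Y> u)) Z"
    and eq: "\<forall>t\<in>{0..T}. \<Y> t 1 = Y t \<and> \<Y> t 1 = y\<^sub>0 + Z t 1 \<and> (\<forall>h\<in>nonempty_span \<inter> filtered (N - 1). \<Y> t h = Z t h)"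
    using assms(6) unfolding rde_solution_def Let_def N_def by (elim exE conjE)
  from int have ci: "controlled_integrand \<rho> T \<omega> X (\<lambda>u q. compose_controlled N (F q) (\<Y> u))"
    unfolding controlled_integral_def Let_def by (rule conjunct1)
  from int obtain L where L: "\<forall>u\<in>{0..T}. integrand_map N (\<lambda>q. compose_controlled N (F q) (\<Y> u)) (L u)"
    and Z: "\<forall>t\<in>{0..T}. has_rough_integral X L 0 t (Z t 1) \<and> (\<forall>h\<in>nonempty_span \<inter> filtered N. Z t h = L t h)"
    unfolding controlled_integral_def Let_def N_def by (elim exE conjE)
  interpret rough_solution T \<omega> \<rho> X F Fhat Y \<Y> Z L N
  proof
    show "0 < \<rho>" "1 \<le> \<rho>" "N = nat \<lfloor>\<rho>\<rfloor>" "control T \<omega>" "branched_rough_path \<rho> T \<omega> X" "F_hat F Fhat"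
      using assms by (simp_all add: N_def)
    show "Y t - Y s = Z t 1 - Z s 1" if "s \<in> {0..T}" "t \<in> {0..T}" for s t
    proof -
      have "Y t = y\<^sub>0 + Z t 1" "Y s = y\<^sub>0 + Z s 1" using eq that by metis+
      then show ?thesis by simp
    qed
  qed (use \<Y> ci L Z eq in auto)
  have "C_k (Suc N) \<phi>" using assms(8) by (simp only: N_def Suc_eq_plus1)
  then obtain C where C: "bounded_by C (Suc N) (\<lambda>s t. \<phi> (Y t) - \<phi> (Y s) - F_bold Fhat \<phi> (positive_part (X s t)) (Y s))"
    using phi_increment unfolding of_order_def by blast
  show "has_rough_integral X (\<lambda>u h. F_bold Fhat \<phi> h (Y u)) s t (\<phi> (Y t) - \<phi> (Y s))"
    by (rule rough_integral_of_increment[OF \<theta> bounded_by_nonneg[OF C]])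
      (use bounded_byD[OF C] st in \<open>simp_all add: \<theta>_def\<close>)
qed

end
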